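(* Let $d,s\geq 1$ and $\lambda_1,\dots,\lambda_s\in\mathbb{Z}\setminus\{0\}$. Suppose that the system of equations $$\lambda_1\mathbf{x}_1+\dots+\lambda_s\mathbf{x}_s=0,\qquad \lambda_1|\mathbf{x}_1|^2+\dots+\lambda_s|\mathbf{x}_s|^2=0\qquad(\mathbf{x}_i\in\mathbb{Z}^d)$$ has a nonsingular real solution in $(0,+\infty)^{ds}$ and nonsingular $p$-adic solutions for every prime $p$. Let $\mathcal{N}(N,d,\boldsymbol{\lambda})$ denote the number of solutions with $\mathbf{x}_1,\dots,\mathbf{x}_s\in[N]^d$. If $s>2+\frac4d$, then there are constants $\mathfrak{S}>0$ and $\mathfrak{J}>0$ (depending on $d$ and $\boldsymbol{\lambda}$) such that $$\mathcal{N}(N,d,\boldsymbol{\lambda})\sim\mathfrak{S}\cdot\mathfrak{J}\cdot N^{ds-(d+2)}\qquad(N\to\infty).$$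
   Context: $[N]=\{1,\dots,N\}$ and $|\cdot|$ is the Euclidean norm on $\mathbb{R}^d$. A nonsingular real (resp. $p$-adic) solution is a solution over $\mathbb{R}$ (resp. $\mathbb{Q}_p$) at which the Jacobian matrix of the system of $d+1$ equations has rank $d+1$. *)

theory Defs
  imports
    "HOL-Analysis.Analysis"
    "HOL-Algebra.QuotRing"
    "HOL-Library.Landau_Symbols"
    "HOL-Computational_Algebra.Primes"
    "Jordan_Normal_Form.Missing_VectorSpace"
begin

section \<open>The system of equations\<close>

text \<open>
  The index type \<open>'s\<close> numbers the variables \<open>\<^bold>x\<^sub>1, \<dots>, \<^bold>x\<^sub>s\<close>, and \<open>'d\<close> numbers the coordinates
  of each of them, so \<open>x $ (i, j)\<close> is the \<open>j\<close>-th coordinate of \<open>\<^bold>x\<^sub>i\<close>.  Among the \<open>d + 1\<close>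
  equations, \<open>Some j\<close> is the \<open>j\<close>-th coordinate of the linear one and \<open>None\<close> is the quadratic one,
  in which \<open>|\<^bold>x\<^sub>i|\<^sup>2\<close> is the sum of the squares of the coordinates.
\<close>

definition lin_quad_system ::
    "int ^ 's \<Rightarrow> 'a::comm_ring_1 ^ ('s::finite \<times> 'd::finite) \<Rightarrow> 'a ^ ('d option)" where
  "lin_quad_system lam x =
     (\<chi> r. case r of
        Some j \<Rightarrow> (\<Sum>i\<in>UNIV. of_int (lam $ i) * x $ (i, j))
      | None \<Rightarrow> (\<Sum>i\<in>UNIV. of_int (lam $ i) * (\<Sum>j\<in>UNIV. (x $ (i, j))\<^sup>2)))"

definition num_solutions :: "'d::finite itself \<Rightarrow> int ^ 's::finite \<Rightarrow> nat \<Rightarrow> nat" where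
  "num_solutions _ lam N =
     card {x :: int ^ ('s \<times> 'd). (\<forall>c. x $ c \<in> {1..int N}) \<and> lin_quad_system lam x = 0}"

definition nonsingular_real_solution ::
    "int ^ 's \<Rightarrow> real ^ ('s::finite \<times> 'd::finite) \<Rightarrow> bool" where
  "nonsingular_real_solution lam x \<longleftrightarrow>
     lin_quad_system lam x = 0 \<and>
     rank (jacobian (lin_quad_system lam) (at x)) = CARD('d) + 1"


section \<open>The field of p-adic numbers\<close>

definition padic_abs :: "nat \<Rightarrow> rat \<Rightarrow> real" where
  "padic_abs p q =
     (if q = 0 then 0
      else real p powi (int (multiplicity (int p) (snd (quotient_of q)))
                        - int (multiplicity (int p) (fst (quotient_of q)))))"

definition padic_Cauchy :: "nat \<Rightarrow> (nat \<Rightarrow> rat) \<Rightarrow> bool" where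
  "padic_Cauchy p X \<longleftrightarrow> (\<forall>e>0. \<exists>M. \<forall>m\<ge>M. \<forall>n\<ge>M. padic_abs p (X m - X n) < e)"

definition padic_Cauchy_ring :: "nat \<Rightarrow> (nat \<Rightarrow> rat) ring" where
  "padic_Cauchy_ring p =
     \<lparr>carrier = {X. padic_Cauchy p X}, mult = (\<lambda>X Y n. X n * Y n), one = (\<lambda>_. 1),
      zero = (\<lambda>_. 0), add = (\<lambda>X Y n. X n + Y n)\<rparr>"

definition padic_null :: "nat \<Rightarrow> (nat \<Rightarrow> rat) set" where
  "padic_null p = {X. (\<lambda>n. padic_abs p (X n)) \<longlonglongrightarrow> 0}"

text \<open>
  \<open>\<rat>\<^sub>p\<close> as the completion of \<open>\<rat>\<close> with respect to the \<open>p\<close>-adic absolute value: Cauchy sequences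
  modulo null sequences.
\<close>

definition padic_field :: "nat \<Rightarrow> (nat \<Rightarrow> rat) set ring" where
  "padic_field p = padic_Cauchy_ring p Quot padic_null p"

type_synonym padic = "(nat \<Rightarrow> rat) set"


section \<open>Nonsingular p-adic solutions\<close>

text \<open>
  The rank of a matrix over a field \<open>K\<close> is the dimension of its row space; \<open>A r\<close> is row \<open>r\<close>, an
  element of the \<open>K\<close>-vector space of functions from the set of columns to \<open>carrier K\<close>.
\<close>

definition matrix_rank_over :: "('a, 'b) ring_scheme \<Rightarrow> ('r::finite \<Rightarrow> 'c::finite \<Rightarrow> 'a) \<Rightarrow> nat" where
  "matrix_rank_over K A =
     (let V = ring.func_space K (UNIV :: 'c set)
      in vectorspace.dim K (V\<lparr>carrier := LinearCombinations.module.span K V (range A)\<rparr>))"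

definition lin_quad_system_over ::
    "('a, 'b) ring_scheme \<Rightarrow> int ^ 's \<Rightarrow> ('s::finite \<times> 'd::finite \<Rightarrow> 'a) \<Rightarrow> 'd option \<Rightarrow> 'a" where
  "lin_quad_system_over K lam x r =
     (case r of
        Some j \<Rightarrow> (\<Oplus>\<^bsub>K\<^esub>i\<in>UNIV. [lam $ i] \<cdot>\<^bsub>K\<^esub> x (i, j))
      | None \<Rightarrow> (\<Oplus>\<^bsub>K\<^esub>i\<in>UNIV. [lam $ i] \<cdot>\<^bsub>K\<^esub> (\<Oplus>\<^bsub>K\<^esub>j\<in>UNIV. x (i, j) [^]\<^bsub>K\<^esub> (2::nat))))"

text \<open>
  The formal partial derivatives of the equations; lemma \<open>jacobian_lin_quad_system\<close> below shows
  that over \<open>\<real>\<close> these are the entries of the library's \<^const>\<open>jacobian\<close>.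
\<close>

definition lin_quad_jacobian_over ::
    "('a, 'b) ring_scheme \<Rightarrow> int ^ 's \<Rightarrow> ('s::finite \<times> 'd::finite \<Rightarrow> 'a) \<Rightarrow>
       'd option \<Rightarrow> 's \<times> 'd \<Rightarrow> 'a" where
  "lin_quad_jacobian_over K lam x r c =
     (case r of
        Some j \<Rightarrow> (if snd c = j then [lam $ fst c] \<cdot>\<^bsub>K\<^esub> \<one>\<^bsub>K\<^esub> else \<zero>\<^bsub>K\<^esub>)
      | None \<Rightarrow> [(2 * lam $ fst c)] \<cdot>\<^bsub>K\<^esub> x c)"

definition nonsingular_padic_solution ::
    "nat \<Rightarrow> int ^ 's \<Rightarrow> ('s::finite \<times> 'd::finite \<Rightarrow> padic) \<Rightarrow> bool" where
  "nonsingular_padic_solution p lam x \<longleftrightarrow>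
     (\<forall>c. x c \<in> carrier (padic_field p)) \<and>
     (\<forall>r. lin_quad_system_over (padic_field p) lam x r = \<zero>\<^bsub>padic_field p\<^esub>) \<and>
     matrix_rank_over (padic_field p) (lin_quad_jacobian_over (padic_field p) lam x) = CARD('d) + 1"


section \<open>Consistency of the definitions\<close>

lemma lin_quad_system_real_eq_0_iff:
  fixes x :: "real ^ ('s::finite \<times> 'd::finite)"
  shows "lin_quad_system lam x = 0 \<longleftrightarrow>
    (\<Sum>i\<in>UNIV. of_int (lam $ i) *\<^sub>R (\<chi> j. x $ (i, j))) = 0 \<and>
    (\<Sum>i\<in>UNIV. of_int (lam $ i) * (norm (\<chi> j. x $ (i, j)))\<^sup>2) = 0"
proof -
  have "(norm (\<chi> j. x $ (i, j)))\<^sup>2 = (\<Sum>j\<in>UNIV. (x $ (i, j))\<^sup>2)" for i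
    by (simp add: norm_vec_def L2_set_def sum_nonneg)
  then show ?thesis
    unfolding lin_quad_system_def vec_eq_iff by (auto simp: split_option_all)
qed

lemma jacobian_lin_quad_system:
  fixes x :: "real ^ ('s::finite \<times> 'd::finite)"
  shows "jacobian (lin_quad_system lam) (at x) =
    (\<chi> r c. case r of
        Some j \<Rightarrow> (if snd c = j then of_int (lam $ fst c) else 0)
      | None \<Rightarrow> of_int (2 * lam $ fst c) * x $ c)"
    (is "_ = ?J")
proof -
  let ?D = "\<lambda>h. \<chi> r. case r of
        Some j \<Rightarrow> (\<Sum>i\<in>UNIV. of_int (lam $ i) * h $ (i, j))
      | None \<Rightarrow> (\<Sum>i\<in>UNIV. of_int (lam $ i) * (\<Sum>j\<in>UNIV. 2 * x $ (i, j) * h $ (i, j)))"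
  have nth: "((\<lambda>y. y $ c) has_derivative (\<lambda>h. h $ c)) (at x)" for c
    by (rule bounded_linear.has_derivative[OF bounded_linear_vec_nth has_derivative_ident])
  have "((\<lambda>y. lin_quad_system lam y $ r) has_derivative (\<lambda>h. ?D h $ r)) (at x)" for r
    unfolding lin_quad_system_def
    by (cases r) (auto intro!: derivative_eq_intros nth simp: mult_ac)
  then have D: "(lin_quad_system lam has_derivative ?D) (at x)"
    by (subst has_derivative_componentwise_within)
      (auto simp: Basis_vec_def inner_axis simp del: vec_lambda_beta)
  have "?D h = ?J *v h" for h
  proof -
    have "(\<Sum>i\<in>UNIV. real_of_int (lam $ i) * h $ (i, j)) =
        (\<Sum>i\<in>UNIV. \<Sum>k\<in>UNIV. (if k = j then of_int (lam $ i) else 0) * h $ (i, k))" for j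
      by (simp add: if_distrib[of "\<lambda>a. a * _"] cong: if_cong)
    moreover have "(\<Sum>c\<in>UNIV. g c) = (\<Sum>i\<in>UNIV. \<Sum>j\<in>UNIV. g (i, j))" for g :: "'s \<times> 'd \<Rightarrow> real"
      by (simp add: sum.cartesian_product)
    ultimately show ?thesis
      by (simp add: vec_eq_iff matrix_vector_mult_def split_option_all sum_distrib_left mult_ac cong: if_cong)
  qed
  then have "?D = (*v) ?J" by (rule ext)
  then have "frechet_derivative (lin_quad_system lam) (at x) = (*v) ?J"
    using frechet_derivative_at[OF D] by simp
  then show ?thesis
    unfolding jacobian_def by (simp only: matrix_of_matrix_vector_mul)
qed

lemma padic_abs_Fract:
  assumes p: "prime p" and "a \<noteq> 0" "b \<noteq> 0"
  shows "padic_abs p (Fract a b) =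
    real p powi (int (multiplicity (int p) b) - int (multiplicity (int p) a))"
proof -
  obtain c d where q: "quotient_of (Fract a b) = (c, d)" by fastforce
  have "d > 0" using q quotient_of_denom_pos by blast
  have eq: "Fract a b = Fract c d"
    using quotient_of_div[OF q] by (simp add: Fract_of_int_quotient)
  then have cross: "a * d = c * b" using assms \<open>d > 0\<close> by (simp add: eq_rat)
  have "c \<noteq> 0" using cross assms \<open>d > 0\<close> by auto
  have "multiplicity (int p) (a * d) = multiplicity (int p) (c * b)" using cross by simp
  then have "multiplicity (int p) a + multiplicity (int p) d =
      multiplicity (int p) c + multiplicity (int p) b"
    using p assms \<open>d > 0\<close> \<open>c \<noteq> 0\<close> by (simp add: prime_elem_multiplicity_mult_distrib)
  moreover have "Fract a b \<noteq> 0" using assms by (simp add: Zero_rat_def eq_rat)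
  moreover from calculation have "int (multiplicity (int p) d) - int (multiplicity (int p) c) =
      int (multiplicity (int p) b) - int (multiplicity (int p) a)" by linarith
  ultimately show ?thesis
    unfolding padic_abs_def q by simp
qed

lemma padic_abs_0 [simp]: "padic_abs p 0 = 0"
  by (simp add: padic_abs_def)

lemma padic_abs_1 [simp]: "padic_abs p 1 = 1"
  by (simp add: padic_abs_def)

lemma padic_abs_nonneg [simp]: "padic_abs p q \<ge> 0"
  by (simp add: padic_abs_def)

lemma padic_abs_pos: "prime p \<Longrightarrow> q \<noteq> 0 \<Longrightarrow> padic_abs p q > 0"
  by (simp add: padic_abs_def prime_gt_0_nat)

lemma padic_abs_mult:
  assumes p: "prime p"
  shows "padic_abs p (q * r) = padic_abs p q * padic_abs p r"
proof (cases "q = 0 \<or> r = 0")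
  case False
  obtain a b where q: "q = Fract a b" "b > 0" by (cases q) auto
  obtain c d where r: "r = Fract c d" "d > 0" by (cases r) auto
  have "a \<noteq> 0" "c \<noteq> 0" using False q r by (auto simp: Zero_rat_def eq_rat)
  with p q r show ?thesis
    by (simp add: padic_abs_Fract prime_elem_multiplicity_mult_distrib
        power_int_add[symmetric] prime_gt_0_nat algebra_simps)
qed auto

lemma padic_abs_add:
  assumes p: "prime p"
  shows "padic_abs p (q + r) \<le> max (padic_abs p q) (padic_abs p r)"
proof (cases "q = 0 \<or> r = 0 \<or> q + r = 0")
  case False
  obtain a b where q: "q = Fract a b" "b > 0" by (cases q) auto
  obtain c d where r: "r = Fract c d" "d > 0" by (cases r) auto
  define k where "k = b * d"
  have k: "k \<noteq> 0" using q r by (simp add: k_def)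
  have q': "q = Fract (a * d) k" and r': "r = Fract (c * b) k"
    using q r by (auto simp: k_def eq_rat)
  have s': "q + r = Fract (a * d + c * b) k"
    using q r by (simp add: k_def)
  have nz: "a * d \<noteq> 0" "c * b \<noteq> 0" "a * d + c * b \<noteq> 0"
    using False q' r' s' k by (auto simp: Zero_rat_def eq_rat)
  let ?v = "multiplicity (int p)"
  have "int p ^ min (?v (a * d)) (?v (c * b)) dvd a * d + c * b"
    by (intro dvd_add multiplicity_dvd') auto
  then have "?v (a * d + c * b) \<ge> min (?v (a * d)) (?v (c * b))"
    using p nz by (intro multiplicity_geI) (auto simp: prime_gt_1_nat)
  then have "?v (a * d + c * b) \<ge> ?v (a * d) \<or> ?v (a * d + c * b) \<ge> ?v (c * b)"
    by linarith
  moreover have "padic_abs p (Fract m k) \<le> padic_abs p (Fract n k)"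
    if "m \<noteq> 0" "n \<noteq> 0" "?v m \<ge> ?v n" for m n
    using that k p prime_ge_1_nat[OF p]
    by (simp add: padic_abs_Fract del: of_nat_diff) (intro power_int_increasing, auto)
  ultimately show ?thesis
    unfolding q' r' using nz s' q' r' by (auto simp: le_max_iff_disj)
qed (auto simp: le_max_iff_disj)

lemma padic_abs_triangle:
  "prime p \<Longrightarrow> padic_abs p (q + r) \<le> padic_abs p q + padic_abs p r"
  using padic_abs_add[of p q r] padic_abs_nonneg[of p q] padic_abs_nonneg[of p r] by linarith

lemma padic_abs_minus [simp]: "padic_abs p (- q) = padic_abs p q"
proof -
  have "multiplicity (int p) (- a) = multiplicity (int p) a" for a
    by (rule multiplicity_cong) simp
  then show ?thesis by (simp add: padic_abs_def rat_uminus_code case_prod_beta)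
qed

lemma padic_abs_inverse:
  assumes "prime p"
  shows "padic_abs p (inverse q) = inverse (padic_abs p q)"
proof (cases "q = 0")
  case False
  then have "padic_abs p q * padic_abs p (inverse q) = 1"
    by (simp flip: padic_abs_mult[OF assms])
  then show ?thesis by (simp add: inverse_unique)
qed auto

lemma padic_Cauchy_const: "padic_Cauchy p (\<lambda>_. c)"
  by (simp add: padic_Cauchy_def)

lemma padic_Cauchy_add:
  assumes p: "prime p" and "padic_Cauchy p X" "padic_Cauchy p Y"
  shows "padic_Cauchy p (\<lambda>n. X n + Y n)"
  unfolding padic_Cauchy_def
proof (intro allI impI)
  fix e :: real assume "e > 0"
  obtain M where M: "\<And>m n. m \<ge> M \<Longrightarrow> n \<ge> M \<Longrightarrow> padic_abs p (X m - X n) < e"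
    using assms \<open>e > 0\<close> unfolding padic_Cauchy_def by meson
  obtain K where K: "\<And>m n. m \<ge> K \<Longrightarrow> n \<ge> K \<Longrightarrow> padic_abs p (Y m - Y n) < e"
    using assms \<open>e > 0\<close> unfolding padic_Cauchy_def by meson
  have "padic_abs p (X m + Y m - (X n + Y n)) < e" if "m \<ge> max M K" "n \<ge> max M K" for m n
    using padic_abs_add[OF p, of "X m - X n" "Y m - Y n"] M[of m n] K[of m n] that
    by (simp add: algebra_simps)
  then show "\<exists>M. \<forall>m\<ge>M. \<forall>n\<ge>M. padic_abs p (X m + Y m - (X n + Y n)) < e" by blast
qed

lemma padic_Cauchy_bounded:
  assumes p: "prime p" and "padic_Cauchy p X"
  shows "\<exists>B>0. \<forall>n. padic_abs p (X n) \<le> B"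
proof -
  obtain M where M: "\<And>m n. m \<ge> M \<Longrightarrow> n \<ge> M \<Longrightarrow> padic_abs p (X m - X n) < 1"
    using assms(2)[unfolded padic_Cauchy_def, rule_format, of 1] by auto
  define B where "B = 1 + (\<Sum>k\<le>M. padic_abs p (X k))"
  have le: "padic_abs p (X n) \<le> (\<Sum>k\<le>M. padic_abs p (X k))" if "n \<le> M" for n
    using that by (intro member_le_sum) auto
  have "padic_abs p (X n) \<le> B" for n
  proof (cases "n \<le> M")
    case True
    then show ?thesis using le by (simp add: B_def add_increasing)
  next
    case False
    then show ?thesis
      using padic_abs_triangle[OF p, of "X n - X M" "X M"] M[of n M] le[of M] by (simp add: B_def)
  qed
  moreover have "B > 0" unfolding B_def by (simp add: add_pos_nonneg sum_nonneg)
  ultimately show ?thesis by blast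
qed

lemma padic_Cauchy_mult:
  assumes p: "prime p" and "padic_Cauchy p X" "padic_Cauchy p Y"
  shows "padic_Cauchy p (\<lambda>n. X n * Y n)"
  unfolding padic_Cauchy_def
proof (intro allI impI)
  fix e :: real assume "e > 0"
  obtain B where B: "B > 0" "\<And>n. padic_abs p (X n) \<le> B"
    using padic_Cauchy_bounded assms by blast
  obtain C where C: "C > 0" "\<And>n. padic_abs p (Y n) \<le> C"
    using padic_Cauchy_bounded assms by blast
  have "e / C > 0" "e / B > 0" using \<open>e > 0\<close> B C by auto
  obtain M where M: "\<And>m n. m \<ge> M \<Longrightarrow> n \<ge> M \<Longrightarrow> padic_abs p (X m - X n) < e / C"
    using assms \<open>e / C > 0\<close> unfolding padic_Cauchy_def by meson
  obtain K where K: "\<And>m n. m \<ge> K \<Longrightarrow> n \<ge> K \<Longrightarrow> padic_abs p (Y m - Y n) < e / B"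
    using assms \<open>e / B > 0\<close> unfolding padic_Cauchy_def by meson
  have "padic_abs p (X m * Y m - X n * Y n) < e" if "m \<ge> max M K" "n \<ge> max M K" for m n
  proof -
    have "padic_abs p (X m * (Y m - Y n)) < e"
    proof -
      have "padic_abs p (X m * (Y m - Y n)) \<le> B * padic_abs p (Y m - Y n)"
        using B by (simp add: padic_abs_mult[OF p] mult_right_mono)
      also have "\<dots> < B * (e / B)" using K that B by (intro mult_strict_left_mono) auto
      finally show ?thesis using B by simp
    qed
    moreover have "padic_abs p ((X m - X n) * Y n) < e"
    proof -
      have "padic_abs p ((X m - X n) * Y n) \<le> padic_abs p (X m - X n) * C"
        using C by (simp add: padic_abs_mult[OF p] mult_left_mono)
      also have "\<dots> < (e / C) * C" using M that C by (intro mult_strict_right_mono) auto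
      finally show ?thesis using C by simp
    qed
    ultimately show ?thesis
      using padic_abs_add[OF p, of "X m * (Y m - Y n)" "(X m - X n) * Y n"]
      by (simp add: algebra_simps)
  qed
  then show "\<exists>M. \<forall>m\<ge>M. \<forall>n\<ge>M. padic_abs p (X m * Y m - X n * Y n) < e" by blast
qed

lemma padic_Cauchy_uminus:
  assumes "prime p" "padic_Cauchy p X"
  shows "padic_Cauchy p (\<lambda>n. - X n)"
  using padic_Cauchy_mult[OF assms(1) padic_Cauchy_const[of p "-1"] assms(2)] by simp

lemma cring_padic_Cauchy_ring:
  assumes p: "prime p"
  shows "cring (padic_Cauchy_ring p)"
proof (rule cringI)
  show "abelian_group (padic_Cauchy_ring p)"
  proof (rule abelian_groupI)
    fix X assume "X \<in> carrier (padic_Cauchy_ring p)"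
    then show "\<exists>Y\<in>carrier (padic_Cauchy_ring p).
        Y \<oplus>\<^bsub>padic_Cauchy_ring p\<^esub> X = \<zero>\<^bsub>padic_Cauchy_ring p\<^esub>"
      using padic_Cauchy_uminus[OF p, of X]
      by (intro bexI[of _ "\<lambda>n. - X n"]) (auto simp: padic_Cauchy_ring_def)
  qed (auto simp: padic_Cauchy_ring_def padic_Cauchy_add[OF p] padic_Cauchy_const algebra_simps)
  show "comm_monoid (padic_Cauchy_ring p)"
    by (rule comm_monoidI)
      (auto simp: padic_Cauchy_ring_def padic_Cauchy_mult[OF p] padic_Cauchy_const algebra_simps)
qed (auto simp: padic_Cauchy_ring_def algebra_simps)

lemma padic_null_Cauchy:
  assumes p: "prime p" and X: "X \<in> padic_null p"
  shows "padic_Cauchy p X"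
  unfolding padic_Cauchy_def
proof (intro allI impI)
  fix e :: real assume "e > 0"
  then obtain M where M: "\<And>n. n \<ge> M \<Longrightarrow> padic_abs p (X n) < e"
    using X unfolding padic_null_def by (auto simp: LIMSEQ_iff)
  have "padic_abs p (X m - X n) < e" if "m \<ge> M" "n \<ge> M" for m n
    using padic_abs_add[OF p, of "X m" "- X n"] M[of m] M[of n] that by simp
  then show "\<exists>M. \<forall>m\<ge>M. \<forall>n\<ge>M. padic_abs p (X m - X n) < e" by blast
qed

lemma padic_null_add:
  assumes p: "prime p" and "X \<in> padic_null p" "Y \<in> padic_null p"
  shows "(\<lambda>n. X n + Y n) \<in> padic_null p"
proof -
  have lim: "(\<lambda>n. padic_abs p (X n) + padic_abs p (Y n)) \<longlonglongrightarrow> 0"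
    using assms by (auto simp: padic_null_def intro: tendsto_add_zero)
  have "(\<lambda>n. padic_abs p (X n + Y n)) \<longlonglongrightarrow> 0"
    by (rule tendsto_sandwich[OF _ _ tendsto_const lim]) (simp_all add: padic_abs_triangle[OF p])
  then show ?thesis by (simp add: padic_null_def)
qed

lemma padic_null_mult:
  assumes p: "prime p" and X: "X \<in> padic_null p" and Y: "padic_Cauchy p Y"
  shows "(\<lambda>n. X n * Y n) \<in> padic_null p"
proof -
  obtain C where C: "C > 0" "\<And>n. padic_abs p (Y n) \<le> C"
    using padic_Cauchy_bounded[OF p Y] by blast
  have lim: "(\<lambda>n. padic_abs p (X n) * C) \<longlonglongrightarrow> 0"
    using X by (auto simp: padic_null_def intro: tendsto_mult_left_zero)
  have "(\<lambda>n. padic_abs p (X n * Y n)) \<longlonglongrightarrow> 0"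
    by (rule tendsto_sandwich[OF _ _ tendsto_const lim])
      (use C in \<open>simp_all add: padic_abs_mult[OF p] mult_left_mono\<close>)
  then show ?thesis by (simp add: padic_null_def)
qed

lemma ideal_padic_null:
  assumes p: "prime p"
  shows "ideal (padic_null p) (padic_Cauchy_ring p)"
proof -
  interpret R: cring "padic_Cauchy_ring p" by (rule cring_padic_Cauchy_ring[OF p])
  have carr: "carrier (padic_Cauchy_ring p) = {X. padic_Cauchy p X}"
    by (simp add: padic_Cauchy_ring_def)
  show ?thesis
  proof (rule idealI)
    show "subgroup (padic_null p) (add_monoid (padic_Cauchy_ring p))"
    proof (rule group.subgroupI)
      show "group (add_monoid (padic_Cauchy_ring p))" by (rule R.a_group)
      show "padic_null p \<subseteq> carrier (add_monoid (padic_Cauchy_ring p))"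
        using padic_null_Cauchy[OF p] by (auto simp: carr)
      have "(\<lambda>_. 0) \<in> padic_null p" by (simp add: padic_null_def)
      then show "padic_null p \<noteq> {}" by blast
    next
      fix X assume X: "X \<in> padic_null p"
      have "\<ominus>\<^bsub>padic_Cauchy_ring p\<^esub> X = (\<lambda>n. - X n)"
        by (rule R.minus_equality)
          (use X padic_null_Cauchy[OF p X] padic_Cauchy_uminus[OF p] in \<open>auto simp: padic_Cauchy_ring_def\<close>)
      then show "inv\<^bsub>add_monoid (padic_Cauchy_ring p)\<^esub> X \<in> padic_null p"
        using X by (simp add: a_inv_def padic_null_def)
    next
      fix X Y assume "X \<in> padic_null p" "Y \<in> padic_null p"
      then show "X \<otimes>\<^bsub>add_monoid (padic_Cauchy_ring p)\<^esub> Y \<in> padic_null p"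
        using padic_null_add[OF p] by (simp add: padic_Cauchy_ring_def)
    qed
  next
    fix X Y assume "X \<in> padic_null p" "Y \<in> carrier (padic_Cauchy_ring p)"
    then show "X \<otimes>\<^bsub>padic_Cauchy_ring p\<^esub> Y \<in> padic_null p"
      and "Y \<otimes>\<^bsub>padic_Cauchy_ring p\<^esub> X \<in> padic_null p"
      using padic_null_mult[OF p, of X Y] by (auto simp: padic_Cauchy_ring_def mult.commute)
  qed (rule R.ring_axioms)
qed

lemma padic_not_null_away_from_0:
  assumes p: "prime p" and X: "padic_Cauchy p X" "X \<notin> padic_null p"
  shows "\<exists>e>0. \<exists>M. \<forall>n\<ge>M. padic_abs p (X n) \<ge> e"
proof -
  obtain e where e: "e > 0" "\<And>M. \<exists>n\<ge>M. padic_abs p (X n) \<ge> e"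
    using X by (auto simp: padic_null_def LIMSEQ_iff not_less)
  obtain M where M: "\<And>m n. m \<ge> M \<Longrightarrow> n \<ge> M \<Longrightarrow> padic_abs p (X m - X n) < e"
    using X e unfolding padic_Cauchy_def by meson
  obtain m where m: "m \<ge> M" "padic_abs p (X m) \<ge> e" using e by blast
  have "padic_abs p (X n) \<ge> e" if "n \<ge> M" for n
    using padic_abs_add[OF p, of "X m - X n" "X n"] M[of m n] m that by auto
  then show ?thesis using e by blast
qed

lemma maximalideal_padic_null:
  assumes p: "prime p"
  shows "maximalideal (padic_null p) (padic_Cauchy_ring p)"
proof (rule maximalidealI)
  let ?R = "padic_Cauchy_ring p"
  show "ideal (padic_null p) ?R" by (rule ideal_padic_null[OF p])
  have "(\<lambda>_. 1) \<in> carrier ?R" "(\<lambda>_. 1) \<notin> padic_null p"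
    by (auto simp: padic_Cauchy_ring_def padic_Cauchy_const padic_null_def LIMSEQ_const_iff)
  then show "carrier ?R \<noteq> padic_null p" by blast
  fix J assume J: "ideal J ?R" and sub: "padic_null p \<subseteq> J" "J \<subseteq> carrier ?R"
  show "J = padic_null p \<or> J = carrier ?R"
  proof (rule disjCI)
    interpret J: ideal J ?R by (rule J)
    assume "J \<noteq> carrier ?R"
    show "J = padic_null p"
    proof (rule ccontr)
      assume "J \<noteq> padic_null p"
      then obtain X where X: "X \<in> J" "X \<notin> padic_null p" using sub by blast
      then have XC: "padic_Cauchy p X" using sub by (auto simp: padic_Cauchy_ring_def)
      obtain e M where e: "e > 0" and M: "\<And>n. n \<ge> M \<Longrightarrow> padic_abs p (X n) \<ge> e"
        using padic_not_null_away_from_0[OF p XC X(2)] by blast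
      have nz: "X n \<noteq> 0" if "n \<ge> M" for n using M[OF that] e by auto
      define Y where "Y n = (if n < M then 0 else inverse (X n))" for n
      have "padic_Cauchy p Y"
        unfolding padic_Cauchy_def
      proof (intro allI impI)
        fix u :: real assume "u > 0"
        then have "u * (e * e) > 0" using e by simp
        then obtain K where K: "\<And>m n. m \<ge> K \<Longrightarrow> n \<ge> K \<Longrightarrow> padic_abs p (X m - X n) < u * (e * e)"
          using XC unfolding padic_Cauchy_def by meson
        have "padic_abs p (Y m - Y n) < u" if mn: "m \<ge> max M K" "n \<ge> max M K" for m n
        proof -
          have "Y m - Y n = (X n - X m) * inverse (X m) * inverse (X n)"
            using mn nz[of m] nz[of n] by (simp add: Y_def field_simps)
          then have "padic_abs p (Y m - Y n) =
              padic_abs p (X n - X m) / (padic_abs p (X m) * padic_abs p (X n))"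
            by (simp add: padic_abs_mult[OF p] padic_abs_inverse[OF p] divide_inverse mult_ac)
          also have "\<dots> \<le> padic_abs p (X n - X m) / (e * e)"
            using mn M[of m] M[of n] e by (intro divide_left_mono mult_mono) (auto intro!: mult_pos_pos)
          also have "\<dots> < u" using K[of n m] mn e by (simp add: divide_less_eq)
          finally show ?thesis .
        qed
        then show "\<exists>M. \<forall>m\<ge>M. \<forall>n\<ge>M. padic_abs p (Y m - Y n) < u" by blast
      qed
      then have 1: "(\<lambda>n. X n * Y n) \<in> J"
        using J.I_r_closed[OF X(1), of Y] by (simp add: padic_Cauchy_ring_def)
      have "eventually (\<lambda>n. padic_abs p (1 - X n * Y n) = 0) sequentially"
        using eventually_ge_at_top[of M] by eventually_elim (use nz in \<open>simp add: Y_def\<close>)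
      then have "(\<lambda>n. 1 - X n * Y n) \<in> padic_null p"
        unfolding padic_null_def by (simp add: tendsto_eventually)
      then have "(\<lambda>n. 1 - X n * Y n) \<in> J" using sub by blast
      from additive_subgroup.a_closed[OF J.additive_subgroup_axioms 1 this] have "\<one>\<^bsub>?R\<^esub> \<in> J" by (simp add: padic_Cauchy_ring_def)
      then show False using J.one_imp_carrier \<open>J \<noteq> carrier ?R\<close> by blast
    qed
  qed
qed

theorem field_padic_field: "prime p \<Longrightarrow> field (padic_field p)"
  unfolding padic_field_def
  by (rule maximalideal.quotient_is_field[OF maximalideal_padic_null cring_padic_Cauchy_ring])

end

theory Submission
  imports Defs "HOL-Analysis.Kronecker_Approximation_Theorem"
begin

text \<open>
  Only the quadratic equation is handled by a circle method: \<open>gsum l N \<beta>\<close> is the exponential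
  sum over the points of one coordinate of the linear equation, so the number of solutions is the
  integral of \<open>(gsum l N \<beta>) ^ d\<close> over a period.  Writing \<open>gsum\<close> as an average over \<open>\<alpha>\<close> of
  products of the quadratic Weyl sums \<open>wsum\<close>, bounding all but two factors by Weyl differencing,
  uniformly in \<open>\<alpha>\<close>, and using orthogonality for the last two gives a bound near every rational
  \<open>a / q\<close> that decays in both \<open>q\<close> and \<open>N\<^sup>2 * \<bar>\<beta> - a / q\<bar>\<close>; raised to the power \<open>d\<close> it has integrable exponent
  \<open>-9/4\<close> because \<open>d * (s - 2) > 4\<close> forces \<open>d * (s - 2) \<ge> 5\<close>.

  No asymptotic expansion on major arcs is needed.  Counting points with the weight \<open>kcount M H\<close>,
  a tent function of \<open>Q / (M * H)\<close> supported on multiples of \<open>M\<close>, multiplies the integrand by a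
  Fejer-type kernel concentrated at fractions with denominator dividing \<open>M\<close>; by the bound above the
  weighted and the exact count differ by a small multiple of the main term when \<open>M\<close> is divisible by
  all small \<open>q\<close> and \<open>N\<^sup>2 / (M * H)\<close> is large.  For fixed \<open>M\<close> the weighted count is a Riemann sum
  with a periodic weight, hence has a limit, namely a density modulo \<open>M\<close> times a smoothed real
  density.  So the normalised exact count is Cauchy.  Its limit is positive because both densities
  are bounded below: at primes not dividing a fixed number by Gauss sums, at the remaining primes by
  lifting a \<open>p\<close>-adic solution at which the quadratic form is nonsingular along the linear
  subspace, and at the real place by the corresponding real argument.
\<close>

subsection \<open>Exponential sums and Weyl differencing\<close>

text \<open>The exponents are tuned to the smallest admissible case \<open>d * (s - 2) = 5\<close>.
  Weyl differencing can save \<open>1/2\<close> per factor up to a logarithm; the proof keeps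
  \<open>9/20\<close>, so that harmonic sums may be bounded by small powers, and five factors give
  \<open>9/4\<close>. Of the decay in \<open>N\<^sup>2 * \<bar>\<beta> - a / q\<bar>\<close>, the
  power \<open>2\<close> makes the majorant integrable in \<beta> and the remaining
  \<open>1/4\<close> pays for the kernel; of the decay in \<open>q\<close>, one power is lost to the
  number of numerators, and \<open>-5/4\<close> is still summable. A classical argument would expand
  the generating function near rationals in \<beta> and in all linear frequencies at once. The
  obstacle is avoided because the comparison weight is periodic times continuous, so that its count
  needs no Fourier analysis. The price is that each weighted count is only an approximation: its
  parameters depend on the tolerance, and positivity of the limit needs lower bounds for both
  densities that are uniform in those parameters. This is why the local bounds come with explicit
  constants independent of the modulus.\<close>

definition ee :: "real \<Rightarrow> complex" where "ee t = cis (2 * pi * t)"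

definition int_dist :: "real \<Rightarrow> real" where "int_dist t = \<bar>t - of_int (round t)\<bar>"

lemma ee_0 [simp]: "ee 0 = 1" by (simp add: ee_def)
lemma norm_ee [simp]: "norm (ee t) = 1" by (simp add: ee_def)
lemma ee_nonzero [simp]: "ee t \<noteq> 0" by (simp add: ee_def)
lemma ee_add: "ee (s + t) = ee s * ee t" by (simp add: ee_def cis_mult distrib_left)
lemma ee_minus: "ee (- t) = cnj (ee t)" by (simp add: ee_def cis_cnj)
lemma ee_diff: "ee (s - t) = ee s * cnj (ee t)" using ee_add[of s "-t"] by (simp add: ee_minus)
lemma ee_of_int [simp]: "ee (of_int n) = 1" by (simp add: ee_def cis_multiple_2pi)
lemma ee_power: "ee t ^ k = ee (of_nat k * t)"
  by (simp add: ee_def Complex.DeMoivre mult_ac)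
lemma ee_sum: "ee (\<Sum>i\<in>A. f i) = (\<Prod>i\<in>A. ee (f i))"
  by (induction A rule: infinite_finite_induct) (auto simp: ee_add)

lemma ee_add_int [simp]: "ee (t + of_int n) = ee t" by (simp add: ee_add)

lemma ee_eq_1_iff: "ee t = 1 \<longleftrightarrow> t \<in> \<int>"
proof
  assume "ee t = 1"
  then have "cos (2 * pi * t) = 1" by (simp add: ee_def complex_eq_iff)
  then obtain n :: int where "2 * pi * t = of_int n * 2 * pi" by (auto simp: cos_one_2pi_int)
  then have "t = of_int n" by simp
  then show "t \<in> \<int>" by simp
qed (auto elim: Ints_cases)

lemma int_dist_nonneg [simp]: "int_dist t \<ge> 0" by (simp add: int_dist_def)

lemma int_dist_le_half: "int_dist t \<le> 1 / 2"
  using of_int_round_abs_le[of t] by (simp add: int_dist_def abs_minus_commute)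

lemma int_dist_le: "int_dist t \<le> \<bar>t - of_int n\<bar>"
  unfolding int_dist_def using round_diff_minimal[of t n] by simp

lemma int_dist_eq: "\<bar>t\<bar> \<le> 1 / 2 \<Longrightarrow> int_dist t = \<bar>t\<bar>"
proof (rule antisym)
  show "int_dist t \<le> \<bar>t\<bar>" using int_dist_le[of t 0] by simp
  assume a: "\<bar>t\<bar> \<le> 1 / 2"
  show "\<bar>t\<bar> \<le> int_dist t"
  proof (cases "round t = 0")
    case False
    then have "\<bar>real_of_int (round t)\<bar> \<ge> 1" by linarith
    then show ?thesis using a unfolding int_dist_def by linarith
  qed (simp add: int_dist_def)
qed

text \<open>Half of the slope at 0 is enough: together with \<open>pi \<ge> 2\<close> it gives the
  constant of \<open>norm_1_minus_ee_ge\<close>. The Taylor polynomial \<open>x - x ^ 3 / 6\<close>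
  with remainder \<open>x ^ 5 / 120\<close> suffices up to 1.6.\<close>

lemma sin_ge_half: assumes "0 \<le> x" "x \<le> pi / 2" shows "sin x \<ge> x / 2"
proof -
  have "pi \<le> 3.2" using pi_approx by simp
  then have x2: "x \<le> 1.6" using assms by simp
  have sc: "sin_coeff 0 = 0" "sin_coeff 1 = 1" "sin_coeff 2 = 0" "sin_coeff 3 = -1/6" "sin_coeff 4 = 0"
    by (simp_all add: sin_coeff_def fact_numeral)
  have "\<bar>sin x - (\<Sum>m<5. sin_coeff m * x ^ m)\<bar> \<le> inverse (fact 5) * \<bar>x\<bar> ^ 5"
    by (rule Maclaurin_sin_bound)
  moreover have "(\<Sum>m<5. sin_coeff m * x ^ m) = x - x ^ 3 / 6"
  proof -
    have "{..<5::nat} = {0, 1, 2, 3, 4}" by auto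
    then have "(\<Sum>m<5. sin_coeff m * x ^ m) = sin_coeff 0 * x ^ 0 + sin_coeff 1 * x ^ 1 + sin_coeff 2 * x ^ 2
      + sin_coeff 3 * x ^ 3 + sin_coeff 4 * x ^ 4" by simp
    then show ?thesis unfolding sc by simp
  qed
  ultimately have "\<bar>sin x - (x - x ^ 3 / 6)\<bar> \<le> x ^ 5 / 120" using assms
    by (simp add: fact_numeral)
  then have "sin x \<ge> x - x ^ 3 / 6 - x ^ 5 / 120" by linarith
  moreover have "x ^ 2 \<le> 1.6 ^ 2" using assms x2 by (intro power_mono) auto
  then have "x * (x ^ 2) \<le> x * 2.56" using assms by (intro mult_left_mono) (auto simp: power2_eq_square)
  then have "x ^ 3 \<le> 2.56 * x" by (simp add: eval_nat_numeral)
  moreover have "x ^ 3 * x ^ 2 \<le> (2.56 * x) * 2.56" using calculation(2) \<open>x ^ 2 \<le> 1.6 ^ 2\<close> assms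
    by (intro mult_mono) (auto simp: power2_eq_square)
  then have "x ^ 5 \<le> 6.6 * x" using assms by (simp add: eval_nat_numeral)
  ultimately show ?thesis using assms by simp
qed

lemma norm_1_minus_ee: "norm (1 - ee t) = 2 * \<bar>sin (pi * t)\<bar>"
proof -
  have "(norm (1 - ee t))\<^sup>2 = (1 - cos (2 * (pi * t)))\<^sup>2 + (sin (2 * (pi * t)))\<^sup>2"
    by (simp add: cmod_power2 ee_def mult.assoc)
  also have "\<dots> = 2 - 2 * cos (2 * (pi * t))"
    using sin_cos_squared_add[of "2 * (pi * t)"] by (simp add: power2_eq_square algebra_simps)
  also have "\<dots> = (2 * \<bar>sin (pi * t)\<bar>)\<^sup>2" by (simp only: cos_double_sin) (simp add: power_mult_distrib)
  finally show ?thesis by (metis norm_ge_zero abs_ge_zero mult_nonneg_nonneg zero_le_numeral power2_eq_imp_eq)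
qed

lemma norm_1_minus_ee_le: "norm (1 - ee t) \<le> 2 * pi * \<bar>t\<bar>"
  unfolding norm_1_minus_ee using abs_sin_le_one[of "pi * t"] abs_sin_x_le_abs_x[of "pi * t"] by (simp add: abs_mult)

lemma norm_1_minus_ee_ge: "norm (1 - ee t) \<ge> 2 * int_dist t"
proof -
  define u where "u = t - of_int (round t)"
  have "ee t = ee u" using ee_add_int[of u "round t"] by (simp add: u_def)
  moreover have iu: "int_dist t = \<bar>u\<bar>" by (simp add: int_dist_def u_def)
  moreover have "\<bar>u\<bar> \<le> 1/2" using int_dist_le_half[of t] iu by simp
  then have "sin (pi * \<bar>u\<bar>) \<ge> pi * \<bar>u\<bar> / 2" by (intro sin_ge_half) auto
  moreover have "\<bar>sin (pi * u)\<bar> \<ge> sin (pi * \<bar>u\<bar>)" by (auto simp: abs_if)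
  moreover have "pi * \<bar>u\<bar> \<ge> 2 * \<bar>u\<bar>" using pi_ge_two by (intro mult_right_mono) auto
  ultimately show ?thesis unfolding norm_1_minus_ee[of t, unfolded \<open>ee t = ee u\<close> norm_1_minus_ee[of u]]
    using norm_1_minus_ee[of t] norm_1_minus_ee[of u] by simp
qed

text \<open>Lies between the minimum of \<open>N\<close> and \<open>1 / int_dist t\<close> and twice
  that minimum. The form without a case distinction can be compared with powers directly.\<close>

definition gbound :: "nat \<Rightarrow> real \<Rightarrow> real" where "gbound N t = 2 * real N / (1 + real N * int_dist t)"

lemma gbound_nonneg [simp]: "gbound N t \<ge> 0" by (simp add: gbound_def)

lemma norm_sum_ee_le:
  assumes "k \<le> N" shows "norm (\<Sum>j<k. ee (real j * t)) \<le> gbound N t"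
proof (cases "real N * int_dist t \<le> 1")
  case True
  have "norm (\<Sum>j<k. ee (real j * t)) \<le> real k" by (rule order_trans[OF norm_sum]) simp
  also have "\<dots> \<le> real N" using assms by simp
  also have "\<dots> \<le> gbound N t" unfolding gbound_def using True mult_left_mono[OF True, of "real N"]
    by (simp add: pos_le_divide_eq add_pos_nonneg algebra_simps)
  finally show ?thesis .
next
  case False
  have "int_dist t \<noteq> 0" using False by (intro notI) simp
  moreover have "N \<noteq> 0" using False by (intro notI) simp
  ultimately have d: "int_dist t > 0" "N > 0" using int_dist_nonneg[of t] by linarith+
  have n: "norm (1 - ee t) \<ge> 2 * int_dist t" by (rule norm_1_minus_ee_ge)
  then have ne: "ee t \<noteq> 1" using d by auto
  have "(\<Sum>j<k. ee (real j * t)) = (\<Sum>j<k. ee t ^ j)" by (simp add: ee_power)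
  also have "\<dots> = (1 - ee t ^ k) / (1 - ee t)" using ne by (simp add: sum_gp_strict)
  finally have "norm (\<Sum>j<k. ee (real j * t)) = norm (1 - ee t ^ k) / norm (1 - ee t)"
    by (simp add: norm_divide)
  also have "\<dots> \<le> 2 / (2 * int_dist t)" using n d norm_triangle_ineq4[of 1 "ee t ^ k"]
    by (intro frac_le) (auto simp: norm_power)
  also have "\<dots> \<le> gbound N t" using d False unfolding gbound_def
    by (simp add: field_simps)
  finally show ?thesis .
qed

lemma norm_sum_ee_int_le:
  assumes "b - a + 1 \<le> int N" shows "norm (\<Sum>n\<in>{a..b}. ee (c + of_int n * t)) \<le> gbound N t"
proof -
  have "(\<Sum>n\<in>{a..b}. ee (c + of_int n * t)) = (\<Sum>j<nat (b - a + 1). ee (c + of_int (a + int j) * t))"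
    by (rule sum.reindex_bij_witness[of _ "\<lambda>j. a + int j" "\<lambda>n. nat (n - a)"]) auto
  also have "\<dots> = ee (c + of_int a * t) * (\<Sum>j<nat (b - a + 1). ee (real j * t))"
    by (simp add: sum_distrib_left flip: ee_add) (simp add: algebra_simps)
  finally show ?thesis using assms by (simp add: norm_mult norm_sum_ee_le)
qed

text \<open>Weyl differencing: with \<open>h = n - n'\<close> the square opens into sums over
  \<open>n'\<close> whose phase is linear with frequency \<open>2 * \<beta> * h\<close>. The
  coefficient \<alpha> survives only in a factor of modulus 1, so the bound does not see it; this
  uniformity is what later allows an average over the linear frequency.\<close>

lemma weyl_square:
  "(norm (\<Sum>n\<in>{1..int N}. ee (\<alpha> * of_int n + \<beta> * (of_int n)\<^sup>2)))\<^sup>2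
     \<le> (\<Sum>h\<in>{-int N..int N}. gbound N (2 * \<beta> * of_int h))"
proof -
  let ?f = "\<lambda>n. ee (\<alpha> * of_int n + \<beta> * (of_int n)\<^sup>2)"
  have "complex_of_real ((norm (\<Sum>n\<in>{1..int N}. ?f n))\<^sup>2) = (\<Sum>n\<in>{1..int N}. ?f n) * cnj (\<Sum>n\<in>{1..int N}. ?f n)"
    by (rule complex_norm_square)
  also have "\<dots> = (\<Sum>(n,n')\<in>{1..int N}\<times>{1..int N}. ?f n * cnj (?f n'))"
    by (simp add: sum_product sum.cartesian_product)
  also have "\<dots> = (\<Sum>(h,n')\<in>Sigma {-int N..int N} (\<lambda>h. {max 1 (1-h)..min (int N) (int N - h)}). ?f (n'+h) * cnj (?f n'))"
    by (rule sum.reindex_bij_witness[of _ "\<lambda>(h,n'). (n'+h,n')" "\<lambda>(n,n'). (n-n',n')"]) auto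
  also have "\<dots> = (\<Sum>h\<in>{-int N..int N}. \<Sum>n'\<in>{max 1 (1-h)..min (int N) (int N - h)}. ?f (n'+h) * cnj (?f n'))"
    by (subst sum.Sigma) auto
  also have "\<dots> = (\<Sum>h\<in>{-int N..int N}. \<Sum>n'\<in>{max 1 (1-h)..min (int N) (int N - h)}.
      ee ((\<alpha> * of_int h + \<beta> * (of_int h)\<^sup>2) + of_int n' * (2 * \<beta> * of_int h)))"
    by (intro sum.cong refl, subst ee_diff[symmetric], rule arg_cong[of _ _ ee])
      (simp add: power2_eq_square algebra_simps)
  finally have eq: "complex_of_real ((norm (\<Sum>n\<in>{1..int N}. ?f n))\<^sup>2) = (\<Sum>h\<in>{-int N..int N}.
      \<Sum>n'\<in>{max 1 (1-h)..min (int N) (int N - h)}.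
      ee ((\<alpha> * of_int h + \<beta> * (of_int h)\<^sup>2) + of_int n' * (2 * \<beta> * of_int h)))" (is "_ = ?R") .
  have "(norm (\<Sum>n\<in>{1..int N}. ?f n))\<^sup>2 = norm (complex_of_real ((norm (\<Sum>n\<in>{1..int N}. ?f n))\<^sup>2))"
    by (simp only: norm_of_real abs_of_nonneg zero_le_power2)
  also have "\<dots> = norm ?R" by (simp only: eq)
  also have "\<dots> \<le> (\<Sum>h\<in>{-int N..int N}. gbound N (2 * \<beta> * of_int h))"
    by (intro sum_norm_le norm_sum_ee_int_le) auto
  finally show ?thesis .
qed

text \<open>Comparison with the increments of \<open>10 * x powr (1/10)\<close> by the mean value
  theorem. Wherever a harmonic sum would produce a logarithm, \<open>1 / m\<close> is enlarged to
  \<open>m powr (-9/10)\<close>; this is the origin of the exponents with denominators 10 and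
  20.\<close>

lemma sum_powr_le: "(\<Sum>m=1..n. real m powr (-9/10)) \<le> 10 * real n powr (1/10)"
proof (induction n)
  case (Suc n)
  have "real (Suc n) powr (-9/10) \<le> 10 * real (Suc n) powr (1/10) - 10 * real n powr (1/10)"
  proof (cases "n = 0")
    case False
    have "\<exists>z. real n < z \<and> z < real (Suc n) \<and> real (Suc n) powr (1/10) - real n powr (1/10)
       = (real (Suc n) - real n) * ((1/10) * z powr (1/10 - 1))"
      using False by (intro MVT2) (auto intro!: derivative_eq_intros)
    then obtain z where z: "real n < z" "z < real (Suc n)" and
      e: "10 * real (Suc n) powr (1/10) - 10 * real n powr (1/10) = z powr (-9/10)" by auto
    show ?thesis unfolding e using z False by (intro powr_mono2') auto
  qed simp
  then show ?case using Suc by simp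
qed simp

lemma int_dist_add_int [simp]: "int_dist (t + of_int n) = int_dist t"
proof -
  have "t + of_int n + 1 / 2 = (t + 1 / 2) + of_int n" by simp
  then have "round (t + of_int n) = round t + n" unfolding round_def by (simp only: floor_add_int)
  then show ?thesis by (simp add: int_dist_def)
qed

lemma int_dist_add_ge: "int_dist (s + t) \<ge> int_dist s - \<bar>t\<bar>"
  using int_dist_le[of s "round (s + t)"] unfolding int_dist_def by linarith

lemma int_dist_frac_ge:
  assumes "0 < s" "s < int q"
  shows "int_dist (of_int s / real q) \<ge> min (of_int s) (of_int (int q - s)) / real q"
proof -
  define n where "n = round (of_int s / real q :: real)"
  have q: "real q > 0" using assms by simp
  have "real q * \<bar>of_int s / real q - of_int n\<bar> = \<bar>of_int (s - n * int q)\<bar>"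
    using q by (simp add: abs_mult_pos' algebra_simps flip: abs_mult_pos)
  also have "\<dots> \<ge> min (of_int s) (of_int (int q - s))"
  proof (cases "n \<le> 0")
    case True
    then have "n * int q \<le> 0" by (simp add: mult_nonpos_nonneg)
    then show ?thesis using assms by linarith
  next
    case False
    then have "1 * int q \<le> n * int q" by (intro mult_right_mono) auto
    then show ?thesis using assms by linarith
  qed
  finally show ?thesis using q unfolding int_dist_def n_def[symmetric]
    by (simp add: pos_divide_le_eq mult.commute)
qed

lemma nat_div_le_real: "real (n div x) \<le> real n / real x"
  using floor_divide_of_nat_eq[of n x, where 'a = real] of_int_floor_le[of "real n / real x"] by simp

text \<open>Since \<open>a\<close> is invertible mod \<open>q\<close>, the admissible
  \<open>h\<close> lie in a single residue class, and each of the blocks of length \<open>q\<close>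
  that cover the interval contains at most one of them.\<close>

lemma card_cong_le:
  assumes "coprime a (int q)" "q > 0"
  shows "card {h \<in> {-int B..int B}. h * a mod int q = s} \<le> 2 * B div q + 1"
proof -
  let ?S = "{h \<in> {-int B..int B}. h * a mod int q = s}"
  have inj: "inj_on (\<lambda>h. nat ((h + int B) div int q)) ?S"
  proof (rule inj_onI)
    fix h h' assume h: "h \<in> ?S" "h' \<in> ?S"
      and eq: "nat ((h + int B) div int q) = nat ((h' + int B) div int q)"
    have "(h * a) mod int q = (h' * a) mod int q" using h by simp
    then have "int q dvd (h - h') * a" by (simp add: mod_eq_dvd_iff algebra_simps)
    then have "int q dvd h - h'" using assms(1) by (simp add: coprime_dvd_mult_left_iff coprime_commute)
    then have "int q dvd (h + int B) - (h' + int B)" by simp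
    then have m: "(h + int B) mod int q = (h' + int B) mod int q" by (simp only: mod_eq_dvd_iff)
    have "(h + int B) div int q \<ge> 0" "(h' + int B) div int q \<ge> 0"
      using h assms by (auto intro!: div_int_pos_iff[THEN iffD2])
    then have "(h + int B) div int q = (h' + int B) div int q" using eq by simp
    then have "h + int B = h' + int B" using m by (metis div_mult_mod_eq)
    then show "h = h'" by simp
  qed
  have "(\<lambda>h. nat ((h + int B) div int q)) ` ?S \<subseteq> {..2 * B div q}"
  proof clarify
    fix h assume h: "h \<in> {-int B..int B}"
    have "(h + int B) div int q \<le> int (2 * B) div int q" using h assms by (intro zdiv_mono1) auto
    then show "nat ((h + int B) div int q) \<le> 2 * B div q" by (simp add: nat_le_iff zdiv_int)
  qed
  from card_inj_on_le[OF inj this] show ?thesis by simp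
qed

text \<open>Serves twice: for the residues \<open>h * a mod q\<close> in the Weyl bound, and for the
  reduced denominators of \<open>b / m\<close> in the lower bound for complete sums.\<close>

lemma sum_fibre_le:
  fixes k c :: "'b \<Rightarrow> real"
  assumes "finite J" "finite T" "f ` J \<subseteq> T" and k: "\<And>s. s \<in> T \<Longrightarrow> 0 \<le> k s"
    and c: "\<And>s. s \<in> T \<Longrightarrow> real (card {h \<in> J. f h = s}) \<le> c s"
  shows "(\<Sum>h\<in>J. k (f h)) \<le> (\<Sum>s\<in>T. c s * k s)"
proof -
  have "(\<Sum>h\<in>J. k (f h)) = (\<Sum>s\<in>T. \<Sum>h\<in>{h \<in> J. f h = s}. k (f h))"
    by (rule sum.group[symmetric]) fact+
  also have "\<dots> = (\<Sum>s\<in>T. real (card {h \<in> J. f h = s}) * k s)" by (intro sum.cong refl) simp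
  also have "\<dots> \<le> (\<Sum>s\<in>T. c s * k s)" by (intro sum_mono mult_right_mono k c)
  finally show ?thesis .
qed

text \<open>Frequencies with \<open>q dvd h\<close> stay near an integer and measure the distance
  \<theta> from \<beta> to \<open>a / q\<close>; the others spread over the nonzero residues mod
  \<open>q\<close> and give harmonic sums. The factor \<open>L\<close> makes room for the
  frequencies \<open>2 * l * h\<close> coming from the coefficients of the system. The constant is
  \<open>1006 = 3 * (320 + 2) + 40\<close>, with 320 from the nonzero residues, 2 from
  \<open>h = 0\<close> and 40 from the other multiples of \<open>q\<close>.\<close>

lemma W_bound:
  fixes N q L :: nat and \<beta> \<theta> :: real
  assumes N: "N \<ge> 1" and L: "L \<ge> 1" and q: "q \<ge> 1" "q \<le> 2 * L * N" and cop: "coprime a (int q)"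
    and th: "\<theta> = \<bar>\<beta> - of_int a / real q\<bar>" "\<theta> \<le> 1 / (2 * L * N * q)"
  shows "(\<Sum>h\<in>{-int (L*N)..int (L*N)}. gbound N (of_int h * \<beta>))
     \<le> 1006 * L\<^sup>2 * N\<^sup>2 * (q * (1 + N\<^sup>2 * \<theta>)) powr (-9/10)"
proof -
  define B where "B = L * N"
  have B: "B \<ge> 1" "q \<le> 2 * B" "real B = real L * real N" "real B > 0"
    using N L q by (auto simp: B_def)
  have N0: "real N > 0" "real q > 0" "real L \<ge> 1" using N q L by auto
  have th0: "\<theta> \<ge> 0" by (simp add: th)
  have th2: "real B * \<theta> \<le> 1 / (2 * q)"
    using th(2) B N0 by (simp add: field_simps)
  define z where "z = q * (1 + N\<^sup>2 * \<theta>)"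
  have z: "real q \<le> z" "z \<ge> 1" "z > 0"
  proof -
    show 1: "real q \<le> z" using th0 by (simp add: z_def algebra_simps)
    show "z \<ge> 1" "z > 0" using 1 q by auto
  qed
  \<comment> \<open>Both summands of \<open>z\<close> are of order \<open>L * N\<close>, by the
    bounds on \<open>q\<close> and on \<theta>. This is used at the end to trade a factor
    \<open>N\<close> for a saving in \<open>z\<close>.\<close>
  have zle: "z \<le> 3 * L * N"
  proof -
    have "q * N\<^sup>2 * \<theta> \<le> N"
    proof -
      have "2 * L * N * q * \<theta> \<le> 1" using th(2) N0 B by (simp add: field_simps)
      moreover have "1 * (N * q * \<theta>) \<le> (2 * L) * (N * q * \<theta>)" using N0 th0 by (intro mult_right_mono) auto
      ultimately have "N * q * \<theta> \<le> 1" by (simp add: mult_ac)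
      then have "real N * (real N * real q * \<theta>) \<le> real N * 1" using N0 by (intro mult_left_mono) auto
      then show ?thesis by (simp add: power2_eq_square mult_ac)
    qed
    moreover have "real q \<le> 2 * L * N" using q(2) by (metis of_nat_le_iff of_nat_mult of_nat_numeral)
    moreover have "real N \<le> L * N" using N0 by simp
    ultimately show ?thesis by (simp add: z_def algebra_simps)
  qed
  define \<delta> where "\<delta> = \<beta> - of_int a / real q"
  have \<delta>: "\<theta> = \<bar>\<delta>\<bar>" by (simp add: th \<delta>_def)
  have hb: "of_int h * \<beta> = of_int (h * a) / real q + of_int h * \<delta>" for h
    using N0 by (simp add: \<delta>_def field_simps)
  \<comment> \<open>Half the spacing \<open>1 / q\<close>: a nonzero residue keeps at least half its
    distance from the integers, and a multiple of \<open>q\<close> stays within \<open>1/2\<close>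
    of one.\<close>
  have habs: "\<bar>of_int h * \<delta>\<bar> \<le> 1 / (2 * q)" if "h \<in> {-int B..int B}" for h
  proof -
    have "\<bar>h\<bar> \<le> int B" using that by auto
    then have "\<bar>of_int h\<bar> \<le> real B" by linarith
    then have "\<bar>of_int h :: real\<bar> * \<theta> \<le> B * \<theta>" using th0 by (intro mult_right_mono) auto
    then show ?thesis using th2 by (simp add: abs_mult \<delta>)
  qed
  let ?I = "{-int B..int B}"
  have split: "(\<Sum>h\<in>?I. gbound N (of_int h * \<beta>)) =
     (\<Sum>h\<in>{h\<in>?I. int q dvd h}. gbound N (of_int h * \<beta>)) + (\<Sum>h\<in>{h\<in>?I. \<not> int q dvd h}. gbound N (of_int h * \<beta>))"
  proof -
    have "finite {h\<in>?I. int q dvd h}" "finite {h\<in>?I. \<not> int q dvd h}" by (rule finite_subset[of _ ?I]; auto)+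
    then show ?thesis by (subst sum.union_disjoint[symmetric]) (auto intro!: sum.cong)
  qed
  define n where "n = B div q"
  have nB: "real n \<le> B / q" unfolding n_def by (rule nat_div_le_real)
  have A1: "gbound N (of_int (int q * m) * \<beta>) \<le> 2 * N * ((1 + N\<^sup>2 * \<theta>) powr (-9/10) * ((q / B) powr (-9/10) * \<bar>m\<bar> powr (-9/10)))"
    if m: "m \<noteq> 0" "int q * m \<in> ?I" for m :: int
  proof -
    have "real_of_int (int q * m) * \<beta> = of_int (int q * m) * \<delta> + of_int (m * a)"
      using hb[of "int q * m"] N0 by simp
    moreover have "\<bar>of_int (int q * m) * \<delta>\<bar> \<le> 1 / 2"
    proof -
      have "1 / (2 * real q) \<le> 1 / 2" using q by (simp add: field_simps)
      then show ?thesis using habs[OF m(2)] by linarith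
    qed
    ultimately have id: "int_dist (of_int (int q * m) * \<beta>) = q * \<bar>m\<bar> * \<theta>"
      by (simp only: int_dist_add_int int_dist_eq) (simp add: \<delta> abs_mult)
    have mq: "q * \<bar>m\<bar> / B \<le> 1"
    proof -
      have "\<bar>int q * m\<bar> \<le> int B" using m by auto
      then have "real_of_int \<bar>int q * m\<bar> \<le> real_of_int (int B)" by linarith
      then show ?thesis using B by (simp add: abs_mult)
    qed
    \<comment> \<open>The size of the multiple of \<open>q\<close> relative to \<open>B\<close>. As
      \<open>x \<le> 1\<close>, the denominator dominates the product
      \<open>(1 + N\<^sup>2 * \<theta>) * x\<close>, which separates the dependence on \<theta> from
      that on \<open>m\<close>.\<close>
    define x where "x = q * \<bar>m\<bar> / B"
    have x: "0 < x" "x \<le> 1" using mq m N0 B by (auto simp: x_def)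
    have "(1 + N\<^sup>2 * \<theta>) * x \<le> 1 + N * (q * \<bar>m\<bar> * \<theta>)"
    proof -
      have "N\<^sup>2 * \<theta> * x = (N * (q * \<bar>m\<bar> * \<theta>)) / L"
        using N0 B by (simp add: x_def power2_eq_square)
      also have "\<dots> \<le> (N * (q * \<bar>m\<bar> * \<theta>)) / 1" using N0 th0 by (intro divide_left_mono) auto
      finally show ?thesis using x by (simp add: algebra_simps)
    qed
    moreover have y0: "(1 + N\<^sup>2 * \<theta>) * x > 0" using x th0 by (intro mult_pos_pos add_pos_nonneg) auto
    moreover have "1 + N * (q * \<bar>m\<bar> * \<theta>) \<ge> 1" using th0 by simp
    ultimately have "inverse (1 + N * (q * \<bar>m\<bar> * \<theta>)) \<le> ((1 + N\<^sup>2 * \<theta>) * x) powr (-9/10)"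
    proof -
      let ?y = "1 + N * (q * \<bar>m\<bar> * \<theta>)"
      have "inverse ?y = ?y powr (-1)" using \<open>?y \<ge> 1\<close> by (simp add: powr_minus)
      also have "\<dots> \<le> ?y powr (-9/10)" using \<open>?y \<ge> 1\<close> by (intro powr_mono) auto
      also have "\<dots> \<le> ((1 + N\<^sup>2 * \<theta>) * x) powr (-9/10)"
        using y0 \<open>(1 + N\<^sup>2 * \<theta>) * x \<le> ?y\<close> by (intro powr_mono2') auto
      finally show ?thesis .
    qed
    moreover have "x powr (-9/10) = (q / B) powr (-9/10) * \<bar>m\<bar> powr (-9/10)"
      using m N0 B by (simp add: x_def powr_mult[symmetric] mult_ac)
    moreover have "((1 + N\<^sup>2 * \<theta>) * x) powr (-9/10) = (1 + N\<^sup>2 * \<theta>) powr (-9/10) * x powr (-9/10)"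
      using x th0 by (simp add: powr_mult)
    ultimately have "inverse (1 + N * (q * \<bar>m\<bar> * \<theta>)) \<le> (1 + N\<^sup>2 * \<theta>) powr (-9/10) * ((q / B) powr (-9/10) * \<bar>m\<bar> powr (-9/10))"
      by simp
    then have "2 * N * inverse (1 + N * (q * \<bar>m\<bar> * \<theta>)) \<le> 2 * N * ((1 + N\<^sup>2 * \<theta>) powr (-9/10) * ((q / B) powr (-9/10) * \<bar>m\<bar> powr (-9/10)))"
      by (intro mult_left_mono) auto
    then show ?thesis unfolding gbound_def id by (simp only: divide_inverse)
  qed
  define c where "c = 2 * N * ((1 + N\<^sup>2 * \<theta>) powr (-9/10) * (q / B) powr (-9/10))"
  have c0: "c \<ge> 0" by (simp add: c_def)
  have partA: "(\<Sum>h\<in>{h\<in>?I. int q dvd h}. gbound N (of_int h * \<beta>)) \<le> 2 * N + 40 * L * N\<^sup>2 * z powr (-9/10)"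
  proof -
    have sub: "{h\<in>?I. int q dvd h} \<subseteq> insert 0 ((\<lambda>m. int q * int m) ` {1..n} \<union> (\<lambda>m. - (int q * int m)) ` {1..n})"
    proof
      fix h assume "h \<in> {h\<in>?I. int q dvd h}"
      then have h: "\<bar>h\<bar> \<le> int B" "int q dvd h" by auto
      then obtain m where "h = int q * m" by (elim dvdE)
      with h have m: "h = int q * m" "\<bar>int q * m\<bar> \<le> int B" by auto
      have "int q * \<bar>m\<bar> \<le> int B" using m by (simp add: abs_mult)
      then have "q * nat \<bar>m\<bar> \<le> B" by (metis nat_le_iff nat_mult_distrib nat_int of_nat_0_le_iff abs_ge_zero int_nat_eq of_nat_mult of_nat_le_iff)
      then have "nat \<bar>m\<bar> \<le> n" unfolding n_def using q by (simp add: less_eq_div_iff_mult_less_eq mult.commute)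
      then have nm: "nat \<bar>m\<bar> \<le> n" .
      consider "m = 0" | "m > 0" | "m < 0" by linarith
      then show "h \<in> insert 0 ((\<lambda>m. int q * int m) ` {1..n} \<union> (\<lambda>m. - (int q * int m)) ` {1..n})"
      proof cases
        case 2
        then have "h \<in> (\<lambda>m. int q * int m) ` {1..n}" using m nm by (intro image_eqI[of _ _ "nat m"]) auto
        then show ?thesis by blast
      next
        case 3
        then have "h \<in> (\<lambda>m. - (int q * int m)) ` {1..n}" using m nm by (intro image_eqI[of _ _ "nat (-m)"]) auto
        then show ?thesis by blast
      qed (use m in simp)
    qed
    have inI: "int q * int m \<in> ?I" "int q * (- int m) \<in> ?I" if "m \<in> {1..n}" for m
    proof -
      have "q * m \<le> B" using that unfolding n_def
        by (metis atLeastAtMost_iff div_times_less_eq_dividend mult.commute mult_le_mono1 order_trans)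
      then have "int (q * m) \<le> int B" by linarith
      moreover have "int q * int m \<ge> 0" by simp
      ultimately show "int q * int m \<in> ?I" "int q * (- int m) \<in> ?I"
        unfolding atLeastAtMost_iff of_nat_mult mult_minus_right by linarith+
    qed
    have pos: "gbound N (of_int (int q * int m) * \<beta>) \<le> c * real m powr (-9/10)" if "m \<in> {1..n}" for m
      using A1[of "int m"] that inI[OF that] by (simp add: c_def mult_ac)
    have neg: "gbound N (of_int (- (int q * int m)) * \<beta>) \<le> c * real m powr (-9/10)" if "m \<in> {1..n}" for m
      using A1[of "- int m"] that inI[OF that] by (simp add: c_def mult_ac)
    let ?P = "(\<lambda>m. int q * int m) ` {1..n}" and ?M = "(\<lambda>m. - (int q * int m)) ` {1..n}"
    let ?g = "\<lambda>h. gbound N (real_of_int h * \<beta>)"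
    have "(\<Sum>h\<in>{h\<in>?I. int q dvd h}. ?g h) \<le> sum ?g (insert 0 (?P \<union> ?M))"
      using sub by (intro sum_mono2) auto
    also have "\<dots> \<le> ?g 0 + sum ?g (?P \<union> ?M)" by (subst sum.insert_if) auto
    also have "sum ?g (?P \<union> ?M) \<le> sum ?g ?P + sum ?g ?M"
      using sum_nonneg[of "?P \<inter> ?M" ?g] by (subst sum.union_inter[symmetric]) auto
    also have "sum ?g ?P \<le> (\<Sum>m=1..n. ?g (int q * int m))"
      by (rule order_trans[OF sum_image_le]) auto
    also have "\<dots> \<le> (\<Sum>m=1..n. c * real m powr (-9/10))" by (intro sum_mono pos)
    also have "sum ?g ?M \<le> (\<Sum>m=1..n. ?g (- (int q * int m)))"
      by (rule order_trans[OF sum_image_le]) auto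
    also have "\<dots> \<le> (\<Sum>m=1..n. c * real m powr (-9/10))" by (intro sum_mono neg)
    also have "?g 0 = 2 * N" by (simp add: gbound_def int_dist_eq)
    finally have "(\<Sum>h\<in>{h\<in>?I. int q dvd h}. ?g h) \<le> 2 * N + 2 * (c * (\<Sum>m=1..n. real m powr (-9/10)))"
      by (simp add: sum_distrib_left)
    also have "\<dots> \<le> 2 * N + 2 * (c * (10 * real n powr (1/10)))"
      using sum_powr_le[of n] c0 by (intro add_left_mono mult_left_mono) auto
    also have "\<dots> \<le> 2 * N + 2 * (c * (10 * (B / q) powr (1/10)))"
      using nB c0 by (intro add_left_mono mult_left_mono powr_mono2) auto
    \<comment> \<open>The power \<open>9/10\<close> from the terms and \<open>1/10\<close> from
      their sum combine to exactly one factor \<open>B / q\<close>.\<close>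
    also have "c * (10 * (B / q) powr (1/10)) = 20 * N * (1 + N\<^sup>2 * \<theta>) powr (-9/10) * (B / q)"
    proof -
      have "(q / B) powr (-9/10) = (B / q) powr (9/10)" using B N0 by (simp add: powr_minus powr_divide field_simps)
      moreover have "(B / q) powr (9/10) * (B / q) powr (1/10) = (B / q)"
        using B N0 by (simp flip: powr_add)
      ultimately have "(q / B) powr (-9/10) * (B / q) powr (1/10) = B / q" by simp
      moreover have "c * (10 * (B / q) powr (1/10)) =
          20 * N * (1 + N\<^sup>2 * \<theta>) powr (-9/10) * ((q / B) powr (-9/10) * (B / q) powr (1/10))"
        by (simp add: c_def)
      ultimately show ?thesis by simp
    qed
    also have "20 * N * (1 + N\<^sup>2 * \<theta>) powr (-9/10) * (B / q) \<le> 20 * L * N\<^sup>2 * z powr (-9/10)"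
    proof -
      have "inverse (real q) = q powr (-1)" using N0 by (simp add: powr_minus)
      also have "\<dots> \<le> q powr (-9/10)" using q by (intro powr_mono) auto
      finally have "(1 + N\<^sup>2 * \<theta>) powr (-9/10) * inverse (real q) \<le> (1 + N\<^sup>2 * \<theta>) powr (-9/10) * q powr (-9/10)"
        by (intro mult_left_mono) auto
      also have "\<dots> = z powr (-9/10)" using th0 N0 by (simp add: z_def powr_mult mult_ac)
      finally have "20 * real (N * B) * ((1 + N\<^sup>2 * \<theta>) powr (-9/10) * inverse (real q)) \<le> 20 * real (N * B) * z powr (-9/10)"
        by (rule mult_left_mono) simp
      moreover have "20 * real (N * B) * ((1 + N\<^sup>2 * \<theta>) powr (-9/10) * inverse (real q)) =
          20 * real N * (1 + N\<^sup>2 * \<theta>) powr (-9/10) * (B / q)"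
        unfolding of_nat_mult divide_inverse by (simp only: mult_ac)
      moreover have "20 * real (N * B) * z powr (-9/10) = 20 * L * (real N)\<^sup>2 * z powr (-9/10)"
        unfolding of_nat_mult B(3) power2_eq_square by (simp only: mult_ac)
      ultimately have "20 * real N * (1 + N\<^sup>2 * \<theta>) powr (-9/10) * (B / q) \<le> 20 * L * (real N)\<^sup>2 * z powr (-9/10)"
        by linarith
      then show ?thesis by (simp only: of_nat_mult of_nat_power of_nat_numeral)
    qed
    finally show ?thesis by simp
  qed
  \<comment> \<open>The sum of two reciprocals replaces \<open>1 / min s (q - s)\<close>, so that
    summing over all residues gives the same harmonic sum twice.\<close>
  have B1: "gbound N (of_int h * \<beta>) \<le> 4 * q * (1 / real_of_int (h * a mod int q) + 1 / real_of_int (int q - h * a mod int q))"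
    if h: "h \<in> {h\<in>?I. \<not> int q dvd h}" for h
  proof -
    define s where "s = h * a mod int q"
    have "\<not> int q dvd h * a" using h cop by (simp add: coprime_dvd_mult_left_iff coprime_commute)
    then have "s \<noteq> 0" by (auto simp: s_def)
    moreover have "s \<ge> 0" "s < int q" using q by (auto simp: s_def)
    ultimately have s: "0 < s" "s < int q" by auto
    have "h * a = int q * (h * a div int q) + s" by (simp add: s_def)
    then have "real_of_int (h * a) = real q * of_int (h * a div int q) + of_int s"
      by (metis of_int_add of_int_mult of_int_of_nat_eq)
    then have "of_int (h * a) / real q = of_int s / real q + of_int (h * a div int q)"
      using N0 by (simp add: field_simps)
    then have "of_int h * \<beta> = (of_int s / real q + of_int h * \<delta>) + of_int (h * a div int q)"
      using hb[of h] by simp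
    then have "int_dist (of_int h * \<beta>) = int_dist (of_int s / real q + of_int h * \<delta>)" by simp
    also have "\<dots> \<ge> int_dist (of_int s / real q) - \<bar>of_int h * \<delta>\<bar>" by (rule int_dist_add_ge)
    finally have "int_dist (of_int h * \<beta>) \<ge> min (of_int s) (of_int (int q - s)) / real q - 1 / (2 * q)"
      using int_dist_frac_ge[OF s] habs[of h] h by auto
    moreover have "1 / (2 * q) \<le> (min (of_int s) (of_int (int q - s)) / 2) / real q"
      using s N0 by (simp add: field_simps min_def)
    ultimately have idl: "int_dist (of_int h * \<beta>) \<ge> (min (of_int s) (of_int (int q - s)) / 2) / real q"
      using N0 by (simp add: diff_divide_distrib)
    define m where "m = min (real_of_int s) (of_int (int q - s))"
    have m: "m > 0" using s by (simp add: m_def)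
    have d0: "int_dist (of_int h * \<beta>) \<ge> m / 2 / q" using idl by (simp add: m_def)
    have "0 < m / 2 / q" using m N0 by simp
    then have I0: "int_dist (of_int h * \<beta>) > 0" using d0 by linarith
    have "gbound N (of_int h * \<beta>) \<le> 2 * real N / (real N * int_dist (of_int h * \<beta>))"
      unfolding gbound_def by (rule divide_left_mono) (use N0 I0 in \<open>auto intro!: mult_pos_pos add_pos_pos\<close>)
    also have "\<dots> = 2 / int_dist (of_int h * \<beta>)" using N0 by simp
    also have "\<dots> \<le> 2 / (m / 2 / q)" by (rule divide_left_mono) (use d0 I0 m N0 in auto)
    also have "\<dots> = 4 * q * (1 / m)" by simp
    also have "\<dots> \<le> 4 * q * (1 / real_of_int s + 1 / real_of_int (int q - s))"
      using s by (intro mult_left_mono) (auto simp: m_def min_def)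
    finally show ?thesis by (simp add: s_def)
  qed
  have partB: "(\<Sum>h\<in>{h\<in>?I. \<not> int q dvd h}. gbound N (of_int h * \<beta>)) \<le> 320 * B * q powr (1/10)"
  proof -
    let ?J = "{h\<in>?I. \<not> int q dvd h}"
    let ?k = "\<lambda>s. 4 * q * (1 / real_of_int s + 1 / real_of_int (int q - s))"
    have img: "(\<lambda>h. h * a mod int q) ` ?J \<subseteq> {1..int q - 1}"
    proof clarify
      fix h assume "h \<in> ?I" "\<not> int q dvd h"
      then have "\<not> int q dvd h * a" using cop by (simp add: coprime_dvd_mult_left_iff coprime_commute)
      then have "h * a mod int q \<noteq> 0" by auto
      moreover have "h * a mod int q \<ge> 0" "h * a mod int q < int q" using q by auto
      ultimately show "h * a mod int q \<in> {1..int q - 1}" by auto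
    qed
    have "(\<Sum>h\<in>?J. gbound N (of_int h * \<beta>)) \<le> (\<Sum>h\<in>?J. ?k (h * a mod int q))"
      by (intro sum_mono B1) auto
    also have "\<dots> \<le> (\<Sum>s\<in>{1..int q - 1}. (4 * B / q) * ?k s)"
    proof (rule sum_fibre_le[where k = ?k and f = "\<lambda>h. h * a mod int q" and c = "\<lambda>_. 4 * B / q" and T = "{1..int q - 1}", OF _ _ img])
      show "finite ?J" by (rule finite_subset[of _ ?I]) auto
      fix s assume s: "s \<in> {1..int q - 1}"
      have "card {h\<in>?J. h * a mod int q = s} \<le> card {h\<in>?I. h * a mod int q = s}"
      proof (rule card_mono)
        show "finite {h\<in>?I. h * a mod int q = s}" by (rule finite_subset[of _ ?I]) auto
      qed auto
      also have "\<dots> \<le> 2 * B div q + 1" using cop q by (intro card_cong_le) auto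
      finally have "real (card {h\<in>?J. h * a mod int q = s}) \<le> real (2 * B div q) + 1" by linarith
      also have "real (2 * B div q) \<le> 2 * B / q" using nat_div_le_real[of "2 * B" q] by simp
      \<comment> \<open>The condition \<open>q \<le> 2 * B\<close> absorbs the incomplete
        block.\<close>
      also have "2 * B / q + 1 \<le> 4 * B / q" using B(2) N0 by (simp add: field_simps)
      finally show "real (card {h\<in>?J. h * a mod int q = s}) \<le> 4 * B / q" by simp
      show "0 \<le> ?k s" using s by auto
    qed simp
    also have "\<dots> = 16 * B * ((\<Sum>s\<in>{1..int q - 1}. 1 / real_of_int s) + (\<Sum>s\<in>{1..int q - 1}. 1 / real_of_int (int q - s)))"
      using N0 by (simp add: sum_distrib_left[symmetric] sum.distrib)
    also have "(\<Sum>s\<in>{1..int q - 1}. 1 / real_of_int (int q - s)) = (\<Sum>s\<in>{1..int q - 1}. 1 / real_of_int s)"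
      by (rule sum.reindex_bij_witness[of _ "\<lambda>s. int q - s" "\<lambda>s. int q - s"]) auto
    finally have le: "(\<Sum>h\<in>?J. gbound N (of_int h * \<beta>)) \<le> 16 * B * ((\<Sum>s\<in>{1..int q - 1}. 1 / real_of_int s)
        + (\<Sum>s\<in>{1..int q - 1}. 1 / real_of_int s))" .
    have "(\<Sum>s\<in>{1..int q - 1}. 1 / real_of_int s) = (\<Sum>m=1..q-1. 1 / real m)"
      using q by (intro sum.reindex_bij_witness[of _ int nat]) auto
    also have "\<dots> \<le> (\<Sum>m=1..q-1. real m powr (-9/10))"
    proof (intro sum_mono)
      fix m assume "m \<in> {1..q-1}"
      then have m: "real m \<ge> 1" by auto
      have "1 / real m = m powr (-1)" using m by (simp add: powr_minus divide_inverse)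
      also have "\<dots> \<le> m powr (-9/10)" using m by (intro powr_mono) auto
      finally show "1 / real m \<le> m powr (-9/10)" .
    qed
    also have "\<dots> \<le> 10 * real (q - 1) powr (1/10)" by (rule sum_powr_le)
    also have "\<dots> \<le> 10 * real q powr (1/10)" by (intro mult_left_mono powr_mono2) auto
    finally have "(\<Sum>s\<in>{1..int q - 1}. 1 / real_of_int s) \<le> 10 * real q powr (1/10)" .
    then have "16 * real B * ((\<Sum>s\<in>{1..int q - 1}. 1 / real_of_int s) + (\<Sum>s\<in>{1..int q - 1}. 1 / real_of_int s))
      \<le> 16 * real B * (10 * real q powr (1/10) + 10 * real q powr (1/10))"
      by (intro mult_left_mono add_mono) auto
    with le show ?thesis by simp
  qed
  \<comment> \<open>The left side is smaller than \<open>N\<^sup>2\<close> by almost a factor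
    \<open>N\<close>. Since \<open>q \<le> z \<le> 3 * L * N\<close>, this room can be rewritten as
    the saving \<open>z powr (-9/10)\<close>.\<close>
  have key: "N * q powr (1/10) \<le> 3 * L * N\<^sup>2 * z powr (-9/10)"
  proof -
    have "q powr (1/10) \<le> z powr (1/10)" using z by (intro powr_mono2) auto
    also have "z powr (1/10) = z * z powr (-9/10)" using z by (simp add: powr_mult_base)
    also have "\<dots> \<le> (3 * L * N) * z powr (-9/10)" using zle by (intro mult_right_mono) auto
    finally have "N * q powr (1/10) \<le> N * ((3 * L * N) * z powr (-9/10))" by (intro mult_left_mono) auto
    then show ?thesis by (simp add: power2_eq_square mult_ac)
  qed
  have "2 * N \<le> 2 * L * (N * q powr (1/10))"
  proof -
    have "1 * 1 \<le> L * q powr (1/10)" using N0 q by (intro mult_mono ge_one_powr_ge_zero) auto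
    then have "2 * real N * (1 * 1) \<le> 2 * real N * (L * q powr (1/10))" by (rule mult_left_mono) auto
    then show ?thesis by (simp add: mult_ac)
  qed
  then have "(\<Sum>h\<in>?I. gbound N (of_int h * \<beta>)) \<le> 322 * L * (N * q powr (1/10)) + 40 * L * N\<^sup>2 * z powr (-9/10)"
    using split partA partB B(3) by (simp add: mult_ac)
  also have "\<dots> \<le> 322 * L * (3 * L * N\<^sup>2 * z powr (-9/10)) + 40 * L * N\<^sup>2 * z powr (-9/10)"
    using key by (intro add_right_mono mult_left_mono) auto
  also have "\<dots> \<le> 322 * L * (3 * L * N\<^sup>2 * z powr (-9/10)) + 40 * (L * L) * N\<^sup>2 * z powr (-9/10)"
    using N0 by (intro add_left_mono mult_right_mono mult_left_mono) auto
  also have "\<dots> = 1006 * L\<^sup>2 * N\<^sup>2 * z powr (-9/10)" by (simp add: power2_eq_square algebra_simps)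
  finally show ?thesis by (simp add: B_def z_def)
qed

section \<open>Averaging over the linear equation by orthogonality\<close>

definition wsum :: "int \<Rightarrow> nat \<Rightarrow> real \<Rightarrow> real \<Rightarrow> complex" where
  "wsum l N \<alpha> \<beta> = (\<Sum>n\<in>{1..int N}. ee (of_int l * (\<alpha> * of_int n + \<beta> * (of_int n)\<^sup>2)))"

definition lin_points :: "('s::finite \<Rightarrow> int) \<Rightarrow> nat \<Rightarrow> ('s \<Rightarrow> int) set" where
  "lin_points l N = {u. (\<forall>i. u i \<in> {1..int N}) \<and> (\<Sum>i\<in>UNIV. l i * u i) = 0}"

definition gsum :: "('s::finite \<Rightarrow> int) \<Rightarrow> nat \<Rightarrow> real \<Rightarrow> complex" where
  "gsum l N \<beta> = (\<Sum>u\<in>lin_points l N. ee (\<beta> * of_int (\<Sum>i\<in>UNIV. l i * (u i)\<^sup>2)))"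

text \<open>Differencing yields the frequencies \<open>2 * l * h * \<beta>\<close>. The map
  \<open>h \<mapsto> 2 * l * h\<close> is injective with values of size at most
  \<open>L * N\<close>, and extending the nonnegative sum to that whole range removes the dependence
  on \<open>l\<close>.\<close>

lemma norm_wsum_square_le:
  assumes l: "l \<noteq> 0" "2 * \<bar>l\<bar> \<le> int L"
  shows "(norm (wsum l N \<alpha> \<beta>))\<^sup>2 \<le> (\<Sum>h\<in>{-int (L*N)..int (L*N)}. gbound N (of_int h * \<beta>))"
proof -
  have inj: "inj_on (\<lambda>h. 2 * l * h) {-int N..int N}" using l by (auto simp: inj_on_def)
  have sub: "(\<lambda>h. 2 * l * h) ` {-int N..int N} \<subseteq> {-int (L*N)..int (L*N)}"
  proof clarify
    fix h assume "h \<in> {-int N..int N}"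
    then have "\<bar>2 * l * h\<bar> \<le> int L * int N" unfolding abs_mult using l by (intro mult_mono) auto
    then show "2 * l * h \<in> {-int (L*N)..int (L*N)}" by auto
  qed
  have "(norm (wsum l N \<alpha> \<beta>))\<^sup>2 \<le> (\<Sum>h\<in>{-int N..int N}. gbound N (2 * (of_int l * \<beta>) * of_int h))"
    using weyl_square[of "of_int l * \<alpha>" "of_int l * \<beta>" N] by (simp add: wsum_def distrib_left mult.assoc)
  also have "\<dots> = sum (\<lambda>h. gbound N (of_int h * \<beta>)) ((\<lambda>h. 2 * l * h) ` {-int N..int N})"
    by (subst sum.reindex[OF inj]) (auto intro!: sum.cong simp: mult_ac)
  also have "\<dots> \<le> (\<Sum>h\<in>{-int (L*N)..int (L*N)}. gbound N (of_int h * \<beta>))"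
    using sub by (intro sum_mono2) auto
  finally show ?thesis .
qed

lemma sum_ee_orthogonal:
  assumes "P > 0"
  shows "(\<Sum>k<P. ee (real k * (of_int n / real P))) = (if int P dvd n then of_nat P else 0)"
proof (cases "int P dvd n")
  case True
  then obtain m where "n = int P * m" ..
  then have "real k * (of_int n / real P) = of_int (int k * m)" for k using assms by simp
  then show ?thesis using True by (simp del: of_int_mult)
next
  case False
  define t where "t = of_int n / real P"
  have ne: "ee t \<noteq> 1"
  proof
    assume "ee t = 1"
    then obtain m :: int where "t = of_int m" by (auto simp: ee_eq_1_iff elim: Ints_cases)
    then have "real_of_int n = of_int (m * int P)" using assms by (simp add: t_def field_simps)
    then have "n = m * int P" by (simp only: of_int_eq_iff)
    then show False using False by simp
  qed
  have "real P * t = of_int n" using assms by (simp add: t_def)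
  then have "ee t ^ P = 1" by (simp add: ee_power)
  then have "(\<Sum>k<P. ee t ^ k) = 0" using ne by (simp add: sum_gp_strict)
  then show ?thesis using False by (simp add: ee_power t_def)
qed

lemma abs_sum_lt:
  fixes l u :: "'s::finite \<Rightarrow> int"
  assumes "\<forall>i. u i \<in> {1..int N}" shows "\<bar>\<Sum>i\<in>UNIV. l i * u i\<bar> \<le> int N * (\<Sum>i\<in>UNIV. \<bar>l i\<bar>)"
proof -
  have "\<bar>\<Sum>i\<in>UNIV. l i * u i\<bar> \<le> (\<Sum>i\<in>UNIV. \<bar>l i * u i\<bar>)" by (rule sum_abs)
  also have "\<dots> \<le> (\<Sum>i\<in>UNIV. int N * \<bar>l i\<bar>)"
  proof (intro sum_mono)
    fix i
    have "1 \<le> u i \<and> u i \<le> int N" using assms by auto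
    then have "\<bar>u i\<bar> \<le> int N" by linarith
    then show "\<bar>l i * u i\<bar> \<le> int N * \<bar>l i\<bar>" using mult_left_mono[of "\<bar>u i\<bar>" "int N" "\<bar>l i\<bar>"]
      by (simp add: abs_mult mult.commute)
  qed
  finally show ?thesis by (simp add: sum_distrib_left)
qed

lemma dvd_abs_less_imp_zero: "int P dvd n \<Longrightarrow> \<bar>n\<bar> < int P \<Longrightarrow> n = 0"
  by (metis dvd_imp_le_int abs_of_nat not_less)

lemma finite_int_box: "finite {u::'c::finite \<Rightarrow> int. \<forall>i. u i \<in> {a..b}}"
proof -
  have "{u::'c \<Rightarrow> int. \<forall>i. u i \<in> {a..b}} = PiE UNIV (\<lambda>_. {a..b})" by (auto simp: PiE_UNIV_domain)
  then show ?thesis by (simp add: finite_PiE)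
qed

text \<open>A finite average over \<open>k / P\<close> takes the place of the integral over the
  linear frequency: \<open>P\<close> exceeds every value of the linear form on the box, so
  divisibility by \<open>P\<close> is the same as vanishing.\<close>

lemma gsum_eq:
  fixes l :: "'s::finite \<Rightarrow> int"
  assumes P: "int P > int N * (\<Sum>i\<in>UNIV. \<bar>l i\<bar>)"
  shows "of_nat P * gsum l N \<beta> = (\<Sum>k<P. \<Prod>i\<in>UNIV. wsum (l i) N (real k / real P) \<beta>)"
proof -
  let ?B = "{u::'s\<Rightarrow>int. \<forall>i. u i \<in> {1..int N}}"
  have P0: "P > 0" using P by (metis abs_ge_zero mult_nonneg_nonneg not_less of_nat_0_le_iff of_nat_0_less_iff order_less_le_trans order_le_less_trans sum_nonneg)
  have "(\<Prod>i\<in>UNIV. wsum (l i) N (real k / real P) \<beta>) =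
      (\<Sum>u\<in>?B. ee (\<beta> * of_int (\<Sum>i\<in>UNIV. l i * (u i)\<^sup>2)) * ee (real k * (of_int (\<Sum>i\<in>UNIV. l i * u i) / real P)))" for k
  proof -
    have "(\<Prod>i\<in>UNIV. wsum (l i) N (real k / real P) \<beta>) = (\<Sum>u\<in>PiE UNIV (\<lambda>_. {1..int N}).
        \<Prod>i\<in>UNIV. ee (of_int (l i) * (real k / real P * of_int (u i) + \<beta> * (of_int (u i))\<^sup>2)))"
      unfolding wsum_def by (subst prod_sum_PiE) auto
    also have "\<dots> = (\<Sum>u\<in>?B. ee (\<Sum>i\<in>UNIV. of_int (l i) * (real k / real P * of_int (u i) + \<beta> * (of_int (u i))\<^sup>2)))"
      unfolding ee_sum by (intro sum.cong) (auto simp: PiE_UNIV_domain)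
    also have "\<dots> = (\<Sum>u\<in>?B. ee (\<beta> * of_int (\<Sum>i\<in>UNIV. l i * (u i)\<^sup>2)) * ee (real k * (of_int (\<Sum>i\<in>UNIV. l i * u i) / real P)))"
      unfolding ee_add[symmetric]
      by (intro sum.cong refl arg_cong[of _ _ ee])
         (simp add: sum_distrib_left sum_divide_distrib sum.distrib[symmetric] algebra_simps)
    finally show ?thesis .
  qed
  then have "(\<Sum>k<P. \<Prod>i\<in>UNIV. wsum (l i) N (real k / real P) \<beta>) =
     (\<Sum>u\<in>?B. ee (\<beta> * of_int (\<Sum>i\<in>UNIV. l i * (u i)\<^sup>2)) * (\<Sum>k<P. ee (real k * (of_int (\<Sum>i\<in>UNIV. l i * u i) / real P))))"
    by (simp only: sum_distrib_left) (rule sum.swap)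
  also have "\<dots> = (\<Sum>u\<in>?B. if (\<Sum>i\<in>UNIV. l i * u i) = 0 then of_nat P * ee (\<beta> * of_int (\<Sum>i\<in>UNIV. l i * (u i)\<^sup>2)) else 0)"
  proof (intro sum.cong refl)
    fix u assume u: "u \<in> ?B"
    have "int P dvd (\<Sum>i\<in>UNIV. l i * u i) \<longleftrightarrow> (\<Sum>i\<in>UNIV. l i * u i) = 0"
      using abs_sum_lt[of u N l] u P dvd_abs_less_imp_zero[of P "\<Sum>i\<in>UNIV. l i * u i"] by fastforce
    then show "ee (\<beta> * of_int (\<Sum>i\<in>UNIV. l i * (u i)\<^sup>2)) * (\<Sum>k<P. ee (real k * (of_int (\<Sum>i\<in>UNIV. l i * u i) / real P)))
      = (if (\<Sum>i\<in>UNIV. l i * u i) = 0 then of_nat P * ee (\<beta> * of_int (\<Sum>i\<in>UNIV. l i * (u i)\<^sup>2)) else 0)"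
      unfolding sum_ee_orthogonal[OF P0] by simp
  qed
  also have "\<dots> = (\<Sum>u\<in>lin_points l N. of_nat P * ee (\<beta> * of_int (\<Sum>i\<in>UNIV. l i * (u i)\<^sup>2)))"
    unfolding lin_points_def using finite_int_box[of 1 "int N"]
    by (intro sum.mono_neutral_cong_right) auto
  finally show ?thesis by (simp add: gsum_def sum_distrib_left)
qed

text \<open>Parseval on the points \<open>k / P\<close>: the differences \<open>l * (n - n')\<close>
  are smaller than \<open>P\<close>, so only the diagonal survives.\<close>

lemma wsum_mean_square:
  assumes l: "l \<noteq> 0" and P: "int P > int N * \<bar>l\<bar>" "P > 0"
  shows "(\<Sum>k<P. (norm (wsum l N (real k / real P) \<beta>))\<^sup>2) = real P * real N"
proof -
  let ?g = "\<lambda>k n. ee (of_int l * (real k / real P * of_int n + \<beta> * (of_int n)\<^sup>2))"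
  let ?I = "{1..int N}"
  have "complex_of_real ((norm (wsum l N (real k / real P) \<beta>))\<^sup>2) =
     (\<Sum>n\<in>?I. \<Sum>n'\<in>?I. ee (of_int l * \<beta> * ((of_int n)\<^sup>2 - (of_int n')\<^sup>2)) * ee (real k * (of_int (l * (n - n')) / real P)))" for k
  proof -
    have "complex_of_real ((norm (wsum l N (real k / real P) \<beta>))\<^sup>2) = (\<Sum>n\<in>?I. ?g k n) * cnj (\<Sum>n\<in>?I. ?g k n)"
      unfolding wsum_def by (rule complex_norm_square)
    also have "\<dots> = (\<Sum>n\<in>?I. \<Sum>n'\<in>?I. ?g k n * cnj (?g k n'))" by (simp add: sum_product)
    also have "\<dots> = (\<Sum>n\<in>?I. \<Sum>n'\<in>?I. ee (of_int l * \<beta> * ((of_int n)\<^sup>2 - (of_int n')\<^sup>2)) * ee (real k * (of_int (l * (n - n')) / real P)))"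
      unfolding ee_add[symmetric] ee_diff[symmetric]
      by (intro sum.cong refl arg_cong[of _ _ ee]) (simp add: diff_divide_distrib algebra_simps)
    finally show ?thesis .
  qed
  then have "complex_of_real (\<Sum>k<P. (norm (wsum l N (real k / real P) \<beta>))\<^sup>2) = 
     (\<Sum>k<P. \<Sum>n\<in>?I. \<Sum>n'\<in>?I. ee (of_int l * \<beta> * ((of_int n)\<^sup>2 - (of_int n')\<^sup>2)) * ee (real k * (of_int (l * (n - n')) / real P)))"
    by (simp only: of_real_sum)
  also have "\<dots> = (\<Sum>n\<in>?I. \<Sum>n'\<in>?I. ee (of_int l * \<beta> * ((of_int n)\<^sup>2 - (of_int n')\<^sup>2)) * (\<Sum>k<P. ee (real k * (of_int (l * (n - n')) / real P))))"
    unfolding sum_distrib_left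
    by (subst sum.swap) (intro sum.cong refl sum.swap)
  also have "\<dots> = (\<Sum>n\<in>?I. \<Sum>n'\<in>?I. if n' = n then of_nat P else 0)"
  proof (intro sum.cong refl)
    fix n n' assume n: "n \<in> ?I" "n' \<in> ?I"
    have "\<bar>l * (n - n')\<bar> \<le> \<bar>l\<bar> * int N" unfolding abs_mult using n by (intro mult_left_mono) auto
    then have "\<bar>l * (n - n')\<bar> < int P" using P by (simp add: mult.commute)
    then have "int P dvd l * (n - n') \<longleftrightarrow> n' = n" using l dvd_abs_less_imp_zero[of P "l * (n - n')"] by auto
    then show "ee (of_int l * \<beta> * ((of_int n)\<^sup>2 - (of_int n')\<^sup>2)) * (\<Sum>k<P. ee (real k * (of_int (l * (n - n')) / real P)))
       = (if n' = n then of_nat P else 0)"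
      unfolding sum_ee_orthogonal[OF P(2)] by simp
  qed
  also have "\<dots> = complex_of_real (real P * real N)" by simp
  finally show ?thesis by (simp only: of_real_eq_iff)
qed

text \<open>Two factors are kept for the mean square, by
  \<open>2 * a * b \<le> a\<^sup>2 + b\<^sup>2\<close>, and the others are replaced by
  \<open>w\<close>. Even with \<open>w = N\<close> the result has the order
  \<open>N ^ (s - 1)\<close> expected for the number of points of the linear equation, and any
  saving in \<open>w\<close> counts \<open>s - 2\<close> times.\<close>

lemma norm_gsum_le:
  fixes l :: "'s::finite \<Rightarrow> int"
  assumes l: "\<forall>i. l i \<noteq> 0" and s: "CARD('s) \<ge> 2" and w: "\<And>i \<alpha>. norm (wsum (l i) N \<alpha> \<beta>) \<le> w"
  shows "norm (gsum l N \<beta>) \<le> real N * w ^ (CARD('s) - 2)"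
proof -
  obtain i1 i2 :: 's where i: "i1 \<noteq> i2"
    using s by (metis One_nat_def card_le_Suc0_iff_eq finite_code not_less_eq_eq numeral_2_eq_2 UNIV_I)
  define P where "P = nat (int N * (\<Sum>i\<in>UNIV. \<bar>l i\<bar>)) + 1"
  have sn: "(\<Sum>i\<in>UNIV. \<bar>l i\<bar>) \<ge> 0" by (simp add: sum_nonneg)
  have P: "int P > int N * (\<Sum>i\<in>UNIV. \<bar>l i\<bar>)" "P > 0" using sn by (simp_all add: P_def)
  have Pi: "int P > int N * \<bar>l i\<bar>" for i
  proof -
    have "\<bar>l i\<bar> \<le> (\<Sum>i\<in>UNIV. \<bar>l i\<bar>)" by (intro member_le_sum) auto
    then have "int N * \<bar>l i\<bar> \<le> int N * (\<Sum>i\<in>UNIV. \<bar>l i\<bar>)" by (intro mult_left_mono) auto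
    then show ?thesis using P by simp
  qed
  let ?f = "\<lambda>i k. norm (wsum (l i) N (real k / real P) \<beta>)"
  have w0: "w \<ge> 0" using w[of undefined 0] norm_ge_zero order_trans by blast
  have W0: "w ^ (CARD('s) - 2) \<ge> 0" using w0 by simp
  have pr: "(\<Prod>i\<in>UNIV. ?f i k) \<le> ((?f i1 k)\<^sup>2 + (?f i2 k)\<^sup>2) / 2 * w ^ (CARD('s) - 2)" for k
  proof -
    have "(\<Prod>i\<in>UNIV. ?f i k) = ?f i1 k * (?f i2 k * (\<Prod>i\<in>UNIV - {i1} - {i2}. ?f i k))"
      using i by (subst prod.remove[of _ i1]; simp; subst prod.remove[of _ i2]) auto
    also have "(\<Prod>i\<in>UNIV - {i1} - {i2}. ?f i k) \<le> (\<Prod>i\<in>UNIV - {i1} - {i2}. w)"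
      by (intro prod_mono) (use w in auto)
    also have "\<dots> = w ^ (CARD('s) - 2)" using i by (simp add: card_Diff_singleton numeral_2_eq_2)
    also have "?f i1 k * (?f i2 k * w ^ (CARD('s) - 2)) = (?f i1 k * ?f i2 k) * w ^ (CARD('s) - 2)" by simp
    also have "\<dots> \<le> ((?f i1 k)\<^sup>2 + (?f i2 k)\<^sup>2) / 2 * w ^ (CARD('s) - 2)"
      using sum_squares_bound[of "?f i1 k" "?f i2 k"] W0 by (intro mult_right_mono) auto
    finally show ?thesis by (simp add: mult_left_mono)
  qed
  have "real P * norm (gsum l N \<beta>) = norm (of_nat P * gsum l N \<beta>)" by (simp add: norm_mult)
  also have "\<dots> \<le> (\<Sum>k<P. norm (\<Prod>i\<in>UNIV. wsum (l i) N (real k / real P) \<beta>))"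
    unfolding gsum_eq[OF P(1)] by (rule norm_sum)
  also have "\<dots> \<le> (\<Sum>k<P. ((?f i1 k)\<^sup>2 + (?f i2 k)\<^sup>2) / 2 * w ^ (CARD('s) - 2))"
    unfolding prod_norm[symmetric] by (intro sum_mono pr)
  also have "\<dots> = ((\<Sum>k<P. (?f i1 k)\<^sup>2) + (\<Sum>k<P. (?f i2 k)\<^sup>2)) / 2 * w ^ (CARD('s) - 2)"
    by (simp only: sum_distrib_right[symmetric] sum_divide_distrib[symmetric] sum.distrib)
  also have "\<dots> = real P * (real N * w ^ (CARD('s) - 2))"
    using wsum_mean_square[OF _ Pi P(2), of i1 \<beta>] wsum_mean_square[OF _ Pi P(2), of i2 \<beta>] l by simp
  finally show ?thesis using P by simp
qed

text \<open>Dirichlet approximation with denominators up to \<open>2 * L * N\<close> supplies a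
  rational to which the Weyl bound applies. The square root of the saving
  \<open>z powr (-9/10)\<close> is \<open>z powr (-9/20)\<close>, and at least five such factors
  make \<open>9/4\<close>.\<close>

lemma gsum_power_bound:
  fixes l :: "'s::finite \<Rightarrow> int"
  assumes l: "\<forall>i. l i \<noteq> 0" and L: "\<forall>i. 2 * \<bar>l i\<bar> \<le> int L" and s: "CARD('s) \<ge> 2" and r: "d * (CARD('s) - 2) \<ge> 5"
  shows "\<exists>C>0. \<forall>N\<ge>1. \<forall>\<beta>. \<exists>q\<ge>1. \<exists>a. coprime a (int q) \<and> q \<le> 2 * L * N \<and> \<bar>\<beta> - of_int a / real q\<bar> \<le> 1 / (2 * L * N * q) \<and>
     norm (gsum l N \<beta>) ^ d \<le> C * real N ^ (d * (CARD('s) - 1)) * (q * (1 + N\<^sup>2 * \<bar>\<beta> - of_int a / real q\<bar>)) powr (-9/4)"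
proof -
  define r where "r = d * (CARD('s) - 2)"
  have L1: "L \<ge> 1"
  proof -
    have "\<bar>l undefined\<bar> \<ge> 1" using l by (simp add: int_one_le_iff_zero_less)
    then show ?thesis using L[rule_format, of undefined] by linarith
  qed
  define K where "K = sqrt 1006 * real L"
  have K: "K > 0" using L1 by (simp add: K_def)
  have "\<exists>q\<ge>1. \<exists>a. coprime a (int q) \<and> q \<le> 2 * L * N \<and> \<bar>\<beta> - of_int a / real q\<bar> \<le> 1 / (2 * L * N * q) \<and>
     norm (gsum l N \<beta>) ^ d \<le> K ^ r * real N ^ (d * (CARD('s) - 1)) * (q * (1 + N\<^sup>2 * \<bar>\<beta> - of_int a / real q\<bar>)) powr (-9/4)"
    if N: "N \<ge> 1" for N \<beta>
  proof -
    have "2 * L * N > 0" using N L1 by simp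
    then obtain a k where ak: "coprime a k" "0 < k" "k \<le> int (2 * L * N)" "\<bar>of_int k * \<beta> - of_int a\<bar> < 1 / real (2 * L * N)"
      using Dirichlet_approx_coprime[of "2 * L * N" \<beta>] by metis
    define q where "q = nat k"
    have q: "q \<ge> 1" "k = int q" "q \<le> 2 * L * N" using ak by (auto simp: q_def nat_le_iff)
    define \<theta> where "\<theta> = \<bar>\<beta> - of_int a / real q\<bar>"
    have "real q * \<theta> = \<bar>of_int k * \<beta> - of_int a\<bar>" using q unfolding \<theta>_def
      by (simp add: abs_mult_pos' algebra_simps flip: abs_mult_pos)
    then have "real q * \<theta> \<le> 1 / real (2 * L * N)" using ak by simp
    moreover define c where "c = 1 / real (2 * L * N)"
    ultimately have "\<theta> * real q \<le> c" by (simp add: mult.commute)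
    then have "\<theta> \<le> c / real q" using q by (subst pos_le_divide_eq) auto
    then have th: "\<theta> \<le> 1 / (2 * L * N * q)" by (simp add: c_def)
    have th0: "\<theta> \<ge> 0" by (simp add: \<theta>_def)
    define z where "z = q * (1 + N\<^sup>2 * \<theta>)"
    have "1 * 1 \<le> q * (1 + N\<^sup>2 * \<theta>)" using q th0 by (intro mult_mono) auto
    then have z: "z \<ge> 1" by (simp add: z_def)
    define w where "w = K * N * z powr (-9/20)"
    have w0: "w \<ge> 0" using K by (simp add: w_def)
    have w2: "w\<^sup>2 = 1006 * L\<^sup>2 * N\<^sup>2 * z powr (-9/10)"
      using z by (simp add: w_def K_def power_mult_distrib powr_power)
    have "norm (wsum (l i) N \<alpha> \<beta>) \<le> w" for i \<alpha>
    proof -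
      have "(norm (wsum (l i) N \<alpha> \<beta>))\<^sup>2 \<le> w\<^sup>2" unfolding w2 z_def
        by (rule order_trans[OF norm_wsum_square_le[OF l[rule_format] L[rule_format]]
              W_bound[OF N L1 q(1,3) ak(1)[unfolded q(2)] \<theta>_def th]])
      then show ?thesis using w0 by (rule power2_le_imp_le)
    qed
    then have "norm (gsum l N \<beta>) ^ d \<le> (real N * w ^ (CARD('s) - 2)) ^ d"
      using norm_gsum_le[OF l s, of N \<beta> w] by (intro power_mono) auto
    also have "\<dots> = real N ^ d * w ^ r" by (simp add: power_mult_distrib r_def power_mult[symmetric] mult.commute)
    also have "w ^ r = K ^ r * real N ^ r * z powr (r * (-9/20))"
      using z by (simp add: w_def power_mult_distrib powr_power mult.commute)
    also have "real N ^ d * (K ^ r * real N ^ r * z powr (r * (-9/20))) = K ^ r * real N ^ (d * (CARD('s) - 1)) * z powr (r * (-9/20))"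
    proof -
      have "d * (CARD('s) - 1) = d + r" using s by (simp add: r_def algebra_simps diff_mult_distrib2)
      then show ?thesis by (simp add: power_add)
    qed
    also have "\<dots> \<le> K ^ r * real N ^ (d * (CARD('s) - 1)) * z powr (-9/4)"
    proof (intro mult_left_mono powr_mono z)
      have "r \<ge> 5" using assms(4) by (simp only: r_def)
      then have "real r \<ge> 5" by simp
      then show "real r * (-9/20) \<le> -9/4" by simp
    qed (use K in auto)
    finally show ?thesis using q ak(1) th by (auto simp: z_def \<theta>_def)
  qed
  then show ?thesis using K by (intro exI[of _ "K ^ r"]) auto
qed

subsection \<open>The kernel\<close>

definition sys_points :: "('s::finite \<Rightarrow> int) \<Rightarrow> nat \<Rightarrow> ('s \<times> 'd::finite \<Rightarrow> int) set" where
  "sys_points l N = {x. (\<forall>c. x c \<in> {1..int N}) \<and> (\<forall>j. (\<Sum>i\<in>UNIV. l i * x (i, j)) = 0)}"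

text \<open>Polymorphic in the ring because the same form is evaluated at integer, rational and real
  points.\<close>

definition qform :: "('s::finite \<Rightarrow> int) \<Rightarrow> ('s \<times> 'd::finite \<Rightarrow> 'a::comm_ring_1) \<Rightarrow> 'a" where
  "qform l x = (\<Sum>c\<in>UNIV. of_int (l (fst c)) * (x c)\<^sup>2)"

lemma finite_sys_points [simp]: "finite (sys_points l N)"
  by (rule finite_subset[OF _ finite_int_box[of 1 "int N"]]) (auto simp: sys_points_def)

lemma finite_lin_points [simp]: "finite (lin_points l N)"
  by (rule finite_subset[OF _ finite_int_box[of 1 "int N"]]) (auto simp: lin_points_def)

text \<open>The coordinates are independent under the linear equations and contribute additively to
  the quadratic form, so the sum over all points factors.\<close>

lemma gsum_power:
  "gsum l N \<beta> ^ CARD('d) = (\<Sum>x\<in>sys_points l N. ee (\<beta> * of_int (qform l (x :: 's::finite \<times> 'd::finite \<Rightarrow> int))))"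
proof -
  have "gsum l N \<beta> ^ CARD('d) = (\<Prod>j\<in>(UNIV::'d set). gsum l N \<beta>)" by simp
  also have "\<dots> = (\<Sum>g\<in>PiE UNIV (\<lambda>_. lin_points l N). \<Prod>j\<in>(UNIV::'d set). ee (\<beta> * of_int (\<Sum>i\<in>UNIV. l i * (g j i)\<^sup>2)))"
    unfolding gsum_def by (subst prod_sum_PiE) auto
  also have "\<dots> = (\<Sum>g\<in>PiE UNIV (\<lambda>_. lin_points l N). ee (\<beta> * of_int (qform l (\<lambda>c :: 's \<times> 'd. g (snd c) (fst c) :: int))))"
  proof (intro sum.cong refl)
    fix g :: "'d \<Rightarrow> 's \<Rightarrow> int"
    have "qform l (\<lambda>c :: 's \<times> 'd. g (snd c) (fst c) :: int) = (\<Sum>i\<in>UNIV. \<Sum>j\<in>UNIV. l i * (g j i)\<^sup>2)"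
      unfolding qform_def UNIV_Times_UNIV[symmetric] sum.cartesian_product by (simp add: case_prod_beta)
    also have "\<dots> = (\<Sum>j\<in>UNIV. \<Sum>i\<in>UNIV. l i * (g j i)\<^sup>2)" by (rule sum.swap)
    finally show "(\<Prod>j\<in>UNIV. ee (\<beta> * of_int (\<Sum>i\<in>UNIV. l i * (g j i)\<^sup>2))) = ee (\<beta> * of_int (qform l (\<lambda>c :: 's \<times> 'd. g (snd c) (fst c) :: int)))"
      by (simp add: sum_distrib_left flip: ee_sum)
  qed
  also have "\<dots> = (\<Sum>x\<in>sys_points l N. ee (\<beta> * of_int (qform l (x :: 's \<times> 'd \<Rightarrow> int))))"
    by (rule sum.reindex_bij_witness[of _ "\<lambda>x j i. x (i, j)" "\<lambda>g c. g (snd c) (fst c)"])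
       (auto simp: sys_points_def lin_points_def PiE_UNIV_domain)
  finally show ?thesis .
qed

lemma has_integral_ee: "((\<lambda>\<beta>. ee (\<beta> * of_int n)) has_integral (if n = 0 then 1 else 0)) {0..1::real}"
proof (cases "n = 0")
  case True
  then show ?thesis using has_integral_const_real[of "1::complex" 0 1] by simp
next
  case False
  define c where "c = 2 * pi * \<i> * of_int n"
  have c: "c \<noteq> 0" using False by (simp add: c_def)
  have e: "ee (\<beta> * of_int n) = exp (c * of_real \<beta>)" for \<beta>
    by (simp add: ee_def cis_conv_exp c_def mult_ac)
  have "((\<lambda>z. exp (c * z) / c) has_field_derivative exp (c * of_real \<beta>)) (at (of_real \<beta>))" for \<beta> :: real
    using c by (auto intro!: derivative_eq_intros)
  then have "((\<lambda>\<beta>. exp (c * of_real \<beta>) / c) has_vector_derivative exp (c * of_real \<beta>)) (at \<beta> within {0..1})" for \<beta> :: real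
    by (rule has_vector_derivative_real_field)
  then have "((\<lambda>\<beta>. exp (c * of_real \<beta>)) has_integral (exp (c * of_real 1) / c - exp (c * of_real 0) / c)) {0..1}"
    by (intro fundamental_theorem_of_calculus) auto
  moreover have "exp (c * of_real 1) = 1" using e[of 1] by simp
  ultimately show ?thesis using False by (simp add: e)
qed

text \<open>One minus the Fejer kernel of length \<open>H\<close> in the variable
  \<open>M * \<beta>\<close>, with the square expanded into a double sum. It vanishes at fractions
  whose denominator divides \<open>M\<close>, and integrating against it gives the difference of the
  exact and the weighted count at once.\<close>

definition kern :: "nat \<Rightarrow> nat \<Rightarrow> real \<Rightarrow> complex" where
  "kern M H \<beta> = (\<Sum>m\<in>{..<H}\<times>{..<H}. (1 - ee (\<beta> * of_int (int M * (int (fst m) - int (snd m))))) / (of_nat H)\<^sup>2)"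

text \<open>A Fourier coefficient of the same Fejer kernel, kept as a normalised number of pairs so
  that the integral can be taken term by term; \<open>kcount_eq\<close> gives the closed
  form.\<close>

definition kcount :: "nat \<Rightarrow> nat \<Rightarrow> int \<Rightarrow> real" where
  "kcount M H n = (\<Sum>m\<in>{..<H}\<times>{..<H}. of_bool (n + int M * (int (fst m) - int (snd m)) = 0)) / (real H)\<^sup>2"

lemma norm_kern_le:
  assumes "\<And>m. m \<in> {..<H}\<times>{..<H} \<Longrightarrow> norm (1 - ee (\<beta> * of_int (int M * (int (fst m) - int (snd m))))) \<le> B" and H: "H \<ge> 1"
  shows "norm (kern M H \<beta>) \<le> B"
proof -
  have "norm (kern M H \<beta>) \<le> (\<Sum>m\<in>{..<H}\<times>{..<H}. B / (real H)\<^sup>2)"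
    unfolding kern_def
  proof (intro sum_norm_le)
    fix m assume m: "m \<in> {..<H}\<times>{..<H}"
    show "norm ((1 - ee (\<beta> * of_int (int M * (int (fst m) - int (snd m))))) / (of_nat H)\<^sup>2) \<le> B / (real H)\<^sup>2"
      unfolding norm_divide norm_power norm_of_nat by (intro divide_right_mono assms(1) m) simp
  qed
  also have "\<dots> = B" using H by (simp add: power2_eq_square)
  finally show ?thesis .
qed

lemma norm_kern_le_2: "H \<ge> 1 \<Longrightarrow> norm (kern M H \<beta>) \<le> 2"
  by (rule norm_kern_le) (auto intro: order_trans[OF norm_triangle_ineq4])

text \<open>If \<open>q dvd M\<close>, every frequency \<open>M * k\<close> maps
  \<open>a / q\<close> to an integer, so only the distance from \<beta> to \<open>a / q\<close> is
  felt, magnified at most \<open>M * H\<close> times.\<close>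

lemma norm_kern_le_near:
  assumes H: "H \<ge> 1" and q: "q \<ge> 1" "q dvd M"
  shows "norm (kern M H \<beta>) \<le> 2 * pi * (real M * real H * \<bar>\<beta> - of_int a / real q\<bar>)"
proof (rule norm_kern_le[OF _ H])
  fix m assume m: "m \<in> {..<H}\<times>{..<H}"
  obtain M' where M': "M = q * M'" using q by blast
  define k where "k = int (fst m) - int (snd m)"
  have k: "\<bar>real_of_int k\<bar> \<le> H" using m by (auto simp: k_def)
  have "\<beta> * of_int (int M * k) = (\<beta> - of_int a / real q) * of_int (int M * k) + of_int (a * int M' * k)"
    using q by (simp add: M' field_simps)
  then have "ee (\<beta> * of_int (int M * k)) = ee ((\<beta> - of_int a / real q) * of_int (int M * k))"
    by (simp only: ee_add_int)
  then have "norm (1 - ee (\<beta> * of_int (int M * k))) \<le> 2 * pi * \<bar>(\<beta> - of_int a / real q) * of_int (int M * k)\<bar>"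
    by (simp only: norm_1_minus_ee_le)
  also have "\<bar>(\<beta> - of_int a / real q) * of_int (int M * k)\<bar> = \<bar>\<beta> - of_int a / real q\<bar> * (M * \<bar>real_of_int k\<bar>)"
    by (simp add: abs_mult)
  also have "2 * pi * \<dots> \<le> 2 * pi * (\<bar>\<beta> - of_int a / real q\<bar> * (real M * real H))"
    by (intro mult_left_mono k) auto
  finally show "norm (1 - ee (\<beta> * of_int (int M * (int (fst m) - int (snd m))))) \<le> 2 * pi * (real M * real H * \<bar>\<beta> - of_int a / real q\<bar>)"
    by (simp add: k_def mult_ac)
qed

lemma has_integral_gsum_kern:
  assumes H: "H \<ge> 1"
  shows "((\<lambda>\<beta>. gsum l N \<beta> ^ CARD('d) * kern M H \<beta>) has_integral
     complex_of_real (real (card {x \<in> sys_points l N. qform l (x :: 's::finite \<times> 'd::finite \<Rightarrow> int) = 0})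
       - (\<Sum>x\<in>sys_points l N. kcount M H (qform l (x :: 's \<times> 'd \<Rightarrow> int))))) {0..1}"
proof -
  let ?X = "sys_points l N :: ('s \<times> 'd \<Rightarrow> int) set"
  let ?K = "{..<H}\<times>{..<H}"
  let ?k = "\<lambda>m. int M * (int (fst m) - int (snd m))"
  let ?b = "\<lambda>n::int. (if n = 0 then 1 else 0) :: complex"
  have "((\<lambda>\<beta>. \<Sum>x\<in>?X. \<Sum>m\<in>?K. (ee (\<beta> * of_int (qform l x)) - ee (\<beta> * of_int (qform l x + ?k m))) / (of_nat H)\<^sup>2)
      has_integral (\<Sum>x\<in>?X. \<Sum>m\<in>?K. (?b (qform l x) - ?b (qform l x + ?k m)) / (of_nat H)\<^sup>2)) {0..1}"
    by (intro has_integral_sum has_integral_divide has_integral_diff has_integral_ee) auto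
  moreover have "(\<Sum>x\<in>?X. \<Sum>m\<in>?K. (ee (\<beta> * of_int (qform l x)) - ee (\<beta> * of_int (qform l x + ?k m))) / (of_nat H)\<^sup>2)
      = gsum l N \<beta> ^ CARD('d) * kern M H \<beta>" for \<beta>
    unfolding gsum_power kern_def sum_product
    by (intro sum.cong refl, simp only: of_int_add distrib_left ee_add) (simp add: right_diff_distrib)
  moreover have "(\<Sum>x\<in>?X. \<Sum>m\<in>?K. (?b (qform l x) - ?b (qform l x + ?k m)) / (of_nat H)\<^sup>2) =
     complex_of_real (real (card {x \<in> ?X. qform l x = 0}) - (\<Sum>x\<in>?X. kcount M H (qform l x)))"
  proof -
    have "(\<Sum>m\<in>?K. (?b n - ?b (n + ?k m)) / (of_nat H)\<^sup>2) = of_real (of_bool (n = 0) - kcount M H n)" for n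
    proof -
      have "(\<Sum>m\<in>?K. (?b n - ?b (n + ?k m)) / (of_nat H)\<^sup>2) = (\<Sum>m\<in>?K. ?b n / (of_nat H)\<^sup>2) - (\<Sum>m\<in>?K. ?b (n + ?k m)) / (of_nat H)\<^sup>2"
        by (simp only: diff_divide_distrib sum_subtractf sum_divide_distrib)
      moreover have "(\<Sum>m\<in>?K. ?b n / (of_nat H)\<^sup>2) = ?b n" using H by (simp add: power2_eq_square)
      moreover have "(\<Sum>m\<in>?K. ?b (n + ?k m)) = of_real (\<Sum>m\<in>?K. of_bool (n + ?k m = 0))"
        unfolding of_real_sum by (intro sum.cong) auto
      ultimately show ?thesis by (simp add: kcount_def)
    qed
    then have "(\<Sum>x\<in>?X. \<Sum>m\<in>?K. (?b (qform l x) - ?b (qform l x + ?k m)) / (of_nat H)\<^sup>2) =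
      of_real ((\<Sum>x\<in>?X. of_bool (qform l x = 0)) - (\<Sum>x\<in>?X. kcount M H (qform l x)))"
      by (simp only: of_real_sum[symmetric] sum_subtractf)
    moreover have "(\<Sum>x\<in>?X. of_bool (qform l x = 0)) = real (card {x \<in> ?X. qform l x = 0})"
      by (simp add: of_bool_def sum.If_cases Int_def)
    ultimately show ?thesis by simp
  qed
  ultimately show ?thesis by simp
qed

text \<open>The majorant is chosen for its explicit primitive; its mass is at most
  \<open>pi / n\<close> wherever the centre \<open>c\<close> lies.\<close>

lemma integral_arctan_kernel:
  assumes n: "n > (0::real)"
  shows "(\<lambda>\<beta>. inverse (1 + (n * (\<beta> - c))\<^sup>2)) integrable_on {0..1}"
    and "integral {0..1} (\<lambda>\<beta>. inverse (1 + (n * (\<beta> - c))\<^sup>2)) \<le> pi / n"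
proof -
  have "((\<lambda>\<beta>. arctan (n * (\<beta> - c)) / n) has_real_derivative inverse (1 + (n * (\<beta> - c))\<^sup>2)) (at \<beta> within {0..1})" for \<beta>
    using n by (auto intro!: derivative_eq_intros)
  then have h: "((\<lambda>\<beta>. inverse (1 + (n * (\<beta> - c))\<^sup>2)) has_integral (arctan (n * (1 - c)) / n - arctan (n * (0 - c)) / n)) {0..1}"
    by (intro fundamental_theorem_of_calculus) (auto simp: has_real_derivative_iff_has_vector_derivative)
  then show "(\<lambda>\<beta>. inverse (1 + (n * (\<beta> - c))\<^sup>2)) integrable_on {0..1}" by (rule has_integral_integrable)
  have "arctan (n * (1 - c)) / n - arctan (n * (0 - c)) / n \<le> pi / n"
    using n arctan_ubound[of "n * (1 - c)"] arctan_lbound[of "n * (0 - c)"]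
    by (simp add: diff_divide_distrib[symmetric] divide_right_mono)
  then show "integral {0..1} (\<lambda>\<beta>. inverse (1 + (n * (\<beta> - c))\<^sup>2)) \<le> pi / n"
    using integral_unique[OF h] by simp
qed

lemma powr_tail_bound: assumes "t \<ge> 0" shows "(1 + t) powr (-2) \<le> inverse (1 + (t::real)\<^sup>2)"
proof -
  have "(1 + t) powr (-2) = inverse ((1 + t)\<^sup>2)" using assms by (simp add: powr_minus powr_numeral)
  also have "\<dots> \<le> inverse (1 + t\<^sup>2)" using assms
    by (intro le_imp_inverse_le) (auto simp: power2_eq_square algebra_simps add_pos_nonneg)
  finally show ?thesis .
qed

text \<open>At each \<beta> the integrand is dominated by one of finitely many explicit functions,
  one for each fraction \<open>a / q\<close>, hence by their sum. No dissection into arcs is made,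
  and the choice of \<open>a / q\<close> for given \<beta> need not be measurable. The number of
  numerators turns \<open>q powr (-9/4)\<close> into \<open>q powr (-5/4)\<close>; denominators
  dividing \<open>M\<close> gain \<open>T powr (-1/4)\<close>, and the others form a tail once
  \<open>M\<close> is divisible by all small \<open>q\<close>.\<close>

lemma kernel_error:
  fixes l :: "'s::finite \<Rightarrow> int"
  assumes l: "\<forall>i. l i \<noteq> 0" and L: "\<forall>i. 2 * \<bar>l i\<bar> \<le> int L" and s: "CARD('s) \<ge> 2" and r: "CARD('d::finite) * (CARD('s) - 2) \<ge> 5"
  shows "\<exists>C>0. \<forall>N\<ge>1. \<forall>M\<ge>1. \<forall>H\<ge>1. \<forall>T>0. real M * real H * T \<le> (real N)\<^sup>2 \<longrightarrow>
    \<bar>real (card {x \<in> sys_points l N. qform l (x :: 's \<times> 'd \<Rightarrow> int) = 0})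
       - (\<Sum>x\<in>sys_points l N. kcount M H (qform l (x :: 's \<times> 'd \<Rightarrow> int)))\<bar>
    \<le> C * (real N ^ (CARD('d) * (CARD('s) - 1)) / (real N)\<^sup>2) *
       (T powr (-1/4) * (\<Sum>q\<in>{1..2*L*N}. real q powr (-5/4)) + (\<Sum>q\<in>{q\<in>{1..2*L*N}. \<not> q dvd M}. real q powr (-5/4)))"
proof -
  let ?E = "CARD('d) * (CARD('s) - 1)"
  from gsum_power_bound[OF l L s r] obtain C where C: "C > 0" and
    CB: "\<forall>N\<ge>1. \<forall>\<beta>. \<exists>q\<ge>1. \<exists>a. coprime a (int q) \<and> q \<le> 2 * L * N \<and> \<bar>\<beta> - of_int a / real q\<bar> \<le> 1 / (2 * real L * real N * real q) \<and>
     norm (gsum l N \<beta>) ^ CARD('d) \<le> C * real N ^ ?E * (real q * (1 + (real N)\<^sup>2 * \<bar>\<beta> - of_int a / real q\<bar>)) powr (-9/4)"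
    by (elim exE conjE)
  have L1: "L \<ge> 1"
  proof -
    have "\<bar>l undefined\<bar> \<ge> 1" using l by (simp add: int_one_le_iff_zero_less)
    then show ?thesis using L[rule_format, of undefined] by linarith
  qed
  show ?thesis
  proof (intro exI[of _ "8 * pi * C"] conjI allI impI)
    show "8 * pi * C > 0" using C by simp
    fix N M H :: nat and T :: real
    assume N: "N \<ge> 1" and M: "M \<ge> 1" and H: "H \<ge> 1" and T: "T > 0" and MHT: "real M * real H * T \<le> (real N)\<^sup>2"
    \<comment> \<open>The contribution of the kernel: a negative power of \<open>T\<close> at
      denominators dividing \<open>M\<close>, the trivial bound 2 elsewhere.\<close>
    define \<kappa> where "\<kappa> q = (if q dvd M then 4 * T powr (-1/4) else 2)" for q
    have k0: "\<kappa> q \<ge> 0" for q by (simp add: \<kappa>_def)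
    let ?D = "real (card {x \<in> sys_points l N. qform l (x :: 's \<times> 'd \<Rightarrow> int) = 0})
       - (\<Sum>x\<in>sys_points l N. kcount M H (qform l (x :: 's \<times> 'd \<Rightarrow> int)))"
    define A where "A = Sigma {1..2*L*N} (\<lambda>q. {0..q})"
    have finA: "finite A" by (simp add: A_def)
    define \<phi> where "\<phi> p \<beta> = C * real N ^ ?E * (real (fst p) powr (-9/4) * \<kappa> (fst p)) * inverse (1 + ((real N)\<^sup>2 * (\<beta> - real (snd p) / real (fst p)))\<^sup>2)"
      for p \<beta>
    have \<phi>0: "\<phi> p \<beta> \<ge> 0" for p \<beta> unfolding \<phi>_def using C k0
      by (intro mult_nonneg_nonneg) (auto intro: add_nonneg_nonneg)
    have N2: "(real N)\<^sup>2 > 0" using N by simp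
    have \<phi>i: "\<phi> p integrable_on {0..1}" for p unfolding \<phi>_def
      using integral_arctan_kernel(1)[OF N2] by (intro integrable_on_mult_right)
    have pt: "norm (gsum l N \<beta> ^ CARD('d) * kern M H \<beta>) \<le> (\<Sum>p\<in>A. \<phi> p \<beta>)" if \<beta>: "\<beta> \<in> {0..1}" for \<beta>
    proof -
      obtain q a where q: "q \<ge> 1" "q \<le> 2 * L * N" and th: "\<bar>\<beta> - of_int a / real q\<bar> \<le> 1 / (2 * real L * real N * real q)"
        and bd: "norm (gsum l N \<beta>) ^ CARD('d) \<le> C * real N ^ ?E * (real q * (1 + (real N)\<^sup>2 * \<bar>\<beta> - of_int a / real q\<bar>)) powr (-9/4)"
        using CB[rule_format, OF N, of \<beta>] by (elim exE conjE)
      \<comment> \<open>The approximation gives \<open>\<bar>\<beta> * q - a\<bar> < 1\<close>, so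
        for \<beta> in the unit interval only numerators from 0 to \<open>q\<close> occur and the
        index set \<open>A\<close> is large enough.\<close>
      have a: "0 \<le> a" "a \<le> int q"
      proof -
        have "L * N \<ge> 1" using L1 N by simp
        then have "real (L * N) \<ge> 1" by linarith
        have "\<beta> * q - of_int a = (\<beta> - of_int a / real q) * q" using q by (simp add: field_simps)
        then have "\<bar>\<beta> * q - of_int a\<bar> = \<bar>\<beta> - of_int a / real q\<bar> * q" by (simp add: abs_mult)
        also have "\<dots> \<le> 1 / (2 * real L * real N * real q) * q" using th by (intro mult_right_mono) auto
        also have "\<dots> = 1 / (2 * real (L * N))" using q by simp
        also have "\<dots> < 1" using \<open>real (L * N) \<ge> 1\<close> by (simp add: divide_less_eq)
        finally have "\<bar>\<beta> * q - of_int a\<bar> < 1" .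
        moreover have "0 \<le> \<beta> * q" "\<beta> * q \<le> 1 * q" using \<beta> mult_right_mono[of \<beta> 1 "real q"] by auto
        ultimately have "- 1 < real_of_int a" "real_of_int a < of_int (int q) + 1" by auto
        then show "0 \<le> a" "a \<le> int q" by linarith+
      qed
      define t where "t = (real N)\<^sup>2 * \<bar>\<beta> - of_int a / real q\<bar>"
      have t0: "t \<ge> 0" by (simp add: t_def)
      have kb: "(1 + t) powr (-9/4) * norm (kern M H \<beta>) \<le> \<kappa> q * inverse (1 + t\<^sup>2)"
      proof (cases "q dvd M")
        case False
        have "(1 + t) powr (-9/4) \<le> (1 + t) powr (-2)" using t0 by (intro powr_mono) auto
        also have "\<dots> \<le> inverse (1 + t\<^sup>2)" using t0 by (rule powr_tail_bound)
        finally have "(1 + t) powr (-9/4) * norm (kern M H \<beta>) \<le> inverse (1 + t\<^sup>2) * 2"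
          using norm_kern_le_2[OF H, of M \<beta>] by (intro mult_mono) auto
        then show ?thesis using False by (simp add: \<kappa>_def)
      next
        case True
        define y where "y = pi * t / T"
        have y0: "y \<ge> 0" using t0 T by (simp add: y_def)
        have "norm (kern M H \<beta>) \<le> 2 * pi * (real M * real H * \<bar>\<beta> - of_int a / real q\<bar>)"
          using norm_kern_le_near[OF H q(1) True] .
        also have "\<dots> \<le> 2 * y"
        proof -
          have "real M * real H \<le> (real N)\<^sup>2 / T" using MHT T by (simp add: pos_le_divide_eq)
          then have "real M * real H * \<bar>\<beta> - of_int a / real q\<bar> \<le> (real N)\<^sup>2 / T * \<bar>\<beta> - of_int a / real q\<bar>"
            by (intro mult_right_mono) auto
          then have "2 * pi * (real M * real H * \<bar>\<beta> - of_int a / real q\<bar>) \<le> 2 * pi * ((real N)\<^sup>2 / T * \<bar>\<beta> - of_int a / real q\<bar>)"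
            by (intro mult_left_mono) auto
          then show ?thesis by (simp add: y_def t_def)
        qed
        finally have k1: "norm (kern M H \<beta>) \<le> 2 * y" .
        \<comment> \<open>Interpolation between the bounds 2 and \<open>2 * y\<close>. The exponent
          \<open>1/4\<close> is the decay in \<open>t\<close> that is left after
          \<open>(1 + t) powr (-2)\<close> has been set aside for integrability.\<close>
        have k2: "norm (kern M H \<beta>) \<le> 2 * y powr (1/4)"
        proof (cases "y \<ge> 1")
          case True
          then have "1 \<le> y powr (1/4)" by (intro ge_one_powr_ge_zero) auto
          then show ?thesis using norm_kern_le_2[OF H, of M \<beta>] by linarith
        next
          case False
          have "y \<le> y powr (1/4)"
          proof (cases "y = 0")
            case f: False
            have "y powr 1 \<le> y powr (1/4)" using False y0 f by (intro powr_mono') auto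
            then show ?thesis using y0 by simp
          qed simp
          then show ?thesis using k1 by linarith
        qed
        also have "y powr (1/4) = pi powr (1/4) * t powr (1/4) * T powr (-1/4)"
        proof -
          have "y powr (1/4) = (pi * t) powr (1/4) / T powr (1/4)" using t0 T by (simp add: y_def powr_divide)
          moreover have "(pi * t) powr (1/4) = pi powr (1/4) * t powr (1/4)" using t0 by (simp add: powr_mult)
          moreover have "T powr (-1/4) = 1 / T powr (1/4)" using powr_minus_divide[of T "1/4"] by simp
          ultimately show ?thesis by simp
        qed
        also have "2 * (pi powr (1/4) * t powr (1/4) * T powr (-1/4)) \<le> 2 * (2 * (1 + t) powr (1/4) * T powr (-1/4))"
        proof -
          have "pi powr (1/4) \<le> 16 powr (1/4)" using pi_less_4 by (intro powr_mono2) auto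
          also have "(16::real) powr (1/4) = (2 powr 4) powr (1/4)" by simp
          also have "\<dots> = 2" by (subst powr_powr) simp
          finally have "pi powr (1/4) \<le> 2" .
          moreover have "t powr (1/4) \<le> (1 + t) powr (1/4)" using t0 by (intro powr_mono2) auto
          ultimately show ?thesis by (intro mult_left_mono mult_right_mono mult_mono) auto
        qed
        finally have "norm (kern M H \<beta>) \<le> 4 * T powr (-1/4) * (1 + t) powr (1/4)" by (simp add: mult_ac)
        then have "(1 + t) powr (-9/4) * norm (kern M H \<beta>) \<le> (1 + t) powr (-9/4) * (4 * T powr (-1/4) * (1 + t) powr (1/4))"
          by (intro mult_left_mono) auto
        also have "\<dots> = 4 * T powr (-1/4) * ((1 + t) powr (-9/4) * (1 + t) powr (1/4))" by simp
        also have "(1 + t) powr (-9/4) * (1 + t) powr (1/4) = (1 + t) powr (-2)"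
          by (subst powr_add[symmetric]) simp
        also have "4 * T powr (-1/4) * (1 + t) powr (-2) \<le> 4 * T powr (-1/4) * inverse (1 + t\<^sup>2)"
          using powr_tail_bound[OF t0] by (intro mult_left_mono) auto
        finally show ?thesis using True by (simp add: \<kappa>_def)
      qed
      have "norm (gsum l N \<beta> ^ CARD('d) * kern M H \<beta>) \<le> C * real N ^ ?E * (real q * (1 + t)) powr (-9/4) * norm (kern M H \<beta>)"
        using bd unfolding norm_mult norm_power t_def by (intro mult_right_mono) auto
      also have "\<dots> = C * real N ^ ?E * real q powr (-9/4) * ((1 + t) powr (-9/4) * norm (kern M H \<beta>))"
        using t0 by (simp add: powr_mult)
      also have "\<dots> \<le> C * real N ^ ?E * real q powr (-9/4) * (\<kappa> q * inverse (1 + t\<^sup>2))"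
        using kb C by (intro mult_left_mono) auto
      also have "\<dots> = \<phi> (q, nat a) \<beta>"
        using a by (simp add: \<phi>_def t_def power_mult_distrib)
      also have "\<dots> \<le> (\<Sum>p\<in>A. \<phi> p \<beta>)"
        using a q finA by (intro member_le_sum \<phi>0) (auto simp: A_def nat_le_iff)
      finally show ?thesis .
    qed
    have hi: "((\<lambda>\<beta>. gsum l N \<beta> ^ CARD('d) * kern M H \<beta>) has_integral complex_of_real ?D) {0..1}"
      by (rule has_integral_gsum_kern[OF H])
    have "\<bar>?D\<bar> = norm (integral {0..1} (\<lambda>\<beta>. gsum l N \<beta> ^ CARD('d) * kern M H \<beta>))"
      unfolding integral_unique[OF hi] by (simp only: norm_of_real)
    also have "\<dots> \<le> integral {0..1} (\<lambda>\<beta>. \<Sum>p\<in>A. \<phi> p \<beta>)"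
      using finA \<phi>i by (intro integral_norm_bound_integral has_integral_integrable[OF hi] integrable_sum pt) auto
    also have "\<dots> = (\<Sum>p\<in>A. integral {0..1} (\<phi> p))" using finA \<phi>i by (intro integral_sum) auto
    also have "\<dots> \<le> (\<Sum>p\<in>A. C * real N ^ ?E * (real (fst p) powr (-9/4) * \<kappa> (fst p)) * (pi / (real N)\<^sup>2))"
    proof (intro sum_mono)
      fix p
      show "integral {0..1} (\<phi> p) \<le> C * real N ^ ?E * (real (fst p) powr (-9/4) * \<kappa> (fst p)) * (pi / (real N)\<^sup>2)"
        unfolding \<phi>_def integral_mult_right using C k0 integral_arctan_kernel(2)[OF N2]
        by (intro mult_left_mono) auto
    qed
    also have "\<dots> = (\<Sum>q\<in>{1..2*L*N}. \<Sum>a\<in>{0..q}. C * real N ^ ?E * (real q powr (-9/4) * \<kappa> q) * (pi / (real N)\<^sup>2))"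
      unfolding A_def by (subst sum.Sigma) (auto simp: case_prod_beta)
    also have "\<dots> \<le> (\<Sum>q\<in>{1..2*L*N}. (2 * C * pi * real N ^ ?E / (real N)\<^sup>2) * (real q powr (-5/4) * \<kappa> q))"
    proof (intro sum_mono)
      fix q assume "q \<in> {1..2*L*N}"
      then have q: "q \<ge> 1" by simp
      let ?c = "C * real N ^ ?E * pi / (real N)\<^sup>2 * \<kappa> q"
      have c0: "?c \<ge> 0" using C k0 by simp
      have "(\<Sum>a\<in>{0..q}. C * real N ^ ?E * (real q powr (-9/4) * \<kappa> q) * (pi / (real N)\<^sup>2)) = ?c * ((real q + 1) * real q powr (-9/4))"
        by simp
      also have "\<dots> \<le> ?c * ((2 * real q) * real q powr (-9/4))" using q
        by (intro mult_left_mono c0 mult_right_mono) auto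
      also have "(2 * real q) * real q powr (-9/4) = 2 * real q powr (-5/4)"
        using q powr_mult_base[of "real q" "-9/4"] by simp
      finally show "(\<Sum>a\<in>{0..q}. C * real N ^ ?E * (real q powr (-9/4) * \<kappa> q) * (pi / (real N)\<^sup>2)) \<le>
        (2 * C * pi * real N ^ ?E / (real N)\<^sup>2) * (real q powr (-5/4) * \<kappa> q)" by (simp add: mult_ac)
    qed
    also have "\<dots> = (2 * C * pi * real N ^ ?E / (real N)\<^sup>2) * (\<Sum>q\<in>{1..2*L*N}. real q powr (-5/4) * \<kappa> q)"
      by (simp only: sum_distrib_left)
    finally have D: "\<bar>?D\<bar> \<le> (2 * C * pi * real N ^ ?E / (real N)\<^sup>2) * (\<Sum>q\<in>{1..2*L*N}. real q powr (-5/4) * \<kappa> q)" .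
    let ?S = "T powr (-1/4) * (\<Sum>q\<in>{1..2*L*N}. real q powr (-5/4)) + (\<Sum>q\<in>{q\<in>{1..2*L*N}. \<not> q dvd M}. real q powr (-5/4))"
    have "(\<Sum>q\<in>{1..2*L*N}. real q powr (-5/4) * \<kappa> q) \<le>
      (\<Sum>q\<in>{1..2*L*N}. 4 * (T powr (-1/4) * real q powr (-5/4) + (if \<not> q dvd M then real q powr (-5/4) else 0)))"
      by (intro sum_mono) (auto simp: \<kappa>_def)
    also have "\<dots> = 4 * ?S"
      by (simp only: sum.distrib sum_distrib_left[symmetric] sum.inter_filter finite_atLeastAtMost)
    finally have S: "(\<Sum>q\<in>{1..2*L*N}. real q powr (-5/4) * \<kappa> q) \<le> 4 * ?S" .
    have "(2 * C * pi * real N ^ ?E / (real N)\<^sup>2) * (\<Sum>q\<in>{1..2*L*N}. real q powr (-5/4) * \<kappa> q)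
        \<le> (2 * C * pi * real N ^ ?E / (real N)\<^sup>2) * (4 * ?S)"
      using C by (intro mult_left_mono S) auto
    also have "\<dots> = 8 * pi * C * (real N ^ ?E / (real N)\<^sup>2) * ?S" by simp
    finally show "\<bar>?D\<bar> \<le> 8 * pi * C * (real N ^ ?E / (real N)\<^sup>2) * ?S" using D by linarith
  qed
qed

subsection \<open>Riemann sums with periodic weights\<close>

definition ibox :: "nat \<Rightarrow> ('n::finite \<Rightarrow> int) set" where
  "ibox m = {y. \<forall>c. 0 \<le> y c \<and> y c < int m}"

definition pbox :: "nat \<Rightarrow> ('n::finite \<Rightarrow> int) set" where
  "pbox N = {y. \<forall>c. 1 \<le> y c \<and> y c \<le> int N}"

definition vreal :: "('n::finite \<Rightarrow> int) \<Rightarrow> real ^ 'n" where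
  "vreal y = (\<chi> c. of_int (y c))"

lemma ibox_eq_PiE: "ibox m = PiE UNIV (\<lambda>_. {0..<int m})"
  by (auto simp: ibox_def PiE_UNIV_domain)

lemma pbox_eq_PiE: "pbox m = PiE UNIV (\<lambda>_. {1..int m})"
  by (auto simp: pbox_def PiE_UNIV_domain)

lemma finite_ibox [simp]: "finite (ibox m)" and card_ibox: "card (ibox m :: ('n::finite \<Rightarrow> int) set) = m ^ CARD('n)"
  unfolding ibox_eq_PiE by (simp_all add: finite_PiE card_PiE)

lemma finite_pbox [simp]: "finite (pbox m)" and card_pbox: "card (pbox m :: ('n::finite \<Rightarrow> int) set) = m ^ CARD('n)"
  unfolding pbox_eq_PiE by (simp_all add: finite_PiE card_PiE)

text \<open>The cell is squeezed between the open and the closed box with the same corners, which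
  have equal volume.\<close>

lemma floor_cell:
  fixes z :: "'n::finite \<Rightarrow> int"
  assumes a: "a > 0"
  defines "cell \<equiv> {r::real^'n. \<forall>k. \<lfloor>r $ k * a\<rfloor> = z k}"
  shows "cell \<in> sets borel" "emeasure lborel cell < \<infinity>" "measure lborel cell = (1 / a) ^ CARD('n)"
proof -
  let ?l = "(\<chi> k. of_int (z k) / a) :: real^'n" and ?u = "(\<chi> k. (of_int (z k) + 1) / a) :: real^'n"
  have fl: "\<lfloor>x * a\<rfloor> = k \<longleftrightarrow> of_int k / a \<le> x \<and> x < (of_int k + 1) / a" for x :: real and k
    using a by (simp add: floor_eq_iff pos_divide_le_eq pos_less_divide_eq)
  have cell: "cell = {r. \<forall>k. ?l $ k \<le> r $ k \<and> r $ k < ?u $ k}"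
    unfolding cell_def fl by simp
  have "cell = (\<Inter>k. {r. ?l $ k \<le> r $ k} \<inter> {r. r $ k < ?u $ k})" unfolding cell by auto
  moreover have "{r::real^'n. ?l $ k \<le> r $ k} \<in> sets borel" "{r::real^'n. r $ k < ?u $ k} \<in> sets borel" for k
    by (auto intro!: borel_closed borel_open closed_Collect_le open_Collect_less continuous_intros)
  ultimately show meas: "cell \<in> sets borel" by (auto intro!: sets.finite_INT)
  have sub: "box ?l ?u \<subseteq> cell" "cell \<subseteq> cbox ?l ?u" unfolding cell by (auto simp: mem_box_cart less_imp_le)
  have le: "?l $ k \<le> ?u $ k" for k using a by (simp add: divide_right_mono)
  have "cbox ?l ?u \<noteq> {}" using le unfolding interval_ne_empty_cart by blast
  then have c: "measure lborel (cbox ?l ?u) = (1 / a) ^ CARD('n)"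
    by (simp add: content_cbox_cart diff_divide_distrib[symmetric])
  have "measure lborel (box ?l ?u) = measure lborel (cbox ?l ?u)"
    by (simp only: measure_lborel_box_eq measure_lborel_cbox_eq)
  moreover have fin: "cbox ?l ?u \<in> fmeasurable lborel" "box ?l ?u \<in> fmeasurable lborel"
    by (simp_all add: fmeasurable_cbox fmeasurable_box)
  moreover have cm: "cell \<in> fmeasurable lborel" using fmeasurableI2[OF fin(1) sub(2)] meas by simp
  then show "emeasure lborel cell < \<infinity>" by (simp add: fmeasurable_def)
  have "measure lborel (box ?l ?u) \<le> measure lborel cell" "measure lborel cell \<le> measure lborel (cbox ?l ?u)"
    using sub cm fin by (auto intro!: measure_mono_fmeasurable dest: fmeasurableD)
  ultimately show "measure lborel cell = (1 / a) ^ CARD('n)" using c by simp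
qed

lemma cell_point_eq:
  fixes c f m n r :: real
  assumes "m > 0" "n > 0" shows "(c + m * (r * (n / m) - f)) / n = r + (c - m * f) / n"
  using assms by (simp add: field_simps)

text \<open>The sum is an exact integral of a step function: \<open>\<rho> N r\<close> is the point
  of the class \<open>c\<close> attached to the cell of side \<open>m / N\<close> containing
  \<open>r\<close>, and dominated convergence applies. The summand may change with \<open>N\<close>,
  as the width of the tent does; \<open>lim\<close> therefore asks for convergence along every
  sequence of arguments tending to \<open>r\<close>, for almost all \<open>r\<close>.\<close>

lemma riemann_sum_class:
  fixes F :: "nat \<Rightarrow> real ^ 'n::finite \<Rightarrow> real" and c :: "'n \<Rightarrow> int"
  assumes m: "m > 0" and c: "c \<in> ibox m"
    and bound: "\<And>N r. \<bar>F N r\<bar> \<le> B"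
    and supp: "\<And>N r. F N r \<noteq> 0 \<Longrightarrow> \<forall>k. 0 < r $ k \<and> r $ k \<le> 1"
    and meas: "G \<in> borel_measurable borel"
    and lim: "AE r in lborel. \<forall>\<rho>. \<rho> \<longlonglongrightarrow> r \<longrightarrow> (\<lambda>N. F (Suc N) (\<rho> N)) \<longlonglongrightarrow> G r"
  shows "(\<lambda>N. (\<Sum>y\<in>{y\<in>pbox (Suc N). (\<lambda>k. y k mod int m) = c}. F (Suc N) (vreal y /\<^sub>R real (Suc N))) / real (Suc N) ^ CARD('n))
    \<longlonglongrightarrow> integral\<^sup>L lborel G / real m ^ CARD('n)"
proof -
  define \<rho> where "\<rho> N r = ((\<chi> k. (of_int (c k) + real m * of_int \<lfloor>r $ k * (real N / real m)\<rfloor>) / real N) :: real^'n)" for N and r :: "real^'n"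
  \<comment> \<open>Indices of the cells whose attached point lies in \<open>pbox N\<close>; at all
    other cells the step function vanishes by the support condition.\<close>
  define Z where "Z N = {z::'n\<Rightarrow>int. \<forall>k. 1 \<le> c k + int m * z k \<and> c k + int m * z k \<le> int N}" for N
  define cell where "cell N z = {r::real^'n. \<forall>k. \<lfloor>r $ k * (real N / real m)\<rfloor> = z k}" for N and z :: "'n \<Rightarrow> int"
  define pt where "pt N z = vreal (\<lambda>k. c k + int m * z k) /\<^sub>R real N" for N z
  have ck: "0 \<le> c k" "c k < int m" for k using c by (auto simp: ibox_def)
  have bij: "bij_betw (\<lambda>z k. c k + int m * z k) (Z N) {y\<in>pbox N. (\<lambda>k. y k mod int m) = c}" for N
  proof (rule bij_betw_byWitness[where f' = "\<lambda>y k. y k div int m"])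
    show "\<forall>z\<in>Z N. (\<lambda>k. (c k + int m * z k) div int m) = z"
      using m ck by (auto simp: fun_eq_iff)
    show "\<forall>y\<in>{y\<in>pbox N. (\<lambda>k. y k mod int m) = c}. (\<lambda>k. c k + int m * (y k div int m)) = y"
    proof (clarify, rule ext)
      fix y k assume "c = (\<lambda>k. y k mod int m)"
      then show "y k mod int m + int m * (y k div int m) = y k" by simp
    qed
    show "(\<lambda>z k. c k + int m * z k) ` Z N \<subseteq> {y\<in>pbox N. (\<lambda>k. y k mod int m) = c}"
      using m ck by (auto simp: Z_def pbox_def fun_eq_iff)
    have e: "c k + int m * (y k div int m) = y k" if "(\<lambda>k. y k mod int m) = c" for y k
      using fun_cong[OF that, of k] mod_mult_div_eq[of "y k" "int m"] by simp
    show "(\<lambda>y k. y k div int m) ` {y\<in>pbox N. (\<lambda>k. y k mod int m) = c} \<subseteq> Z N"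
      by (auto simp: Z_def pbox_def e)
  qed
  have finZ: "finite (Z N)" for N using bij_betw_finite[OF bij[of N]] by simp
  have S_eq: "F N (\<rho> N r) = (\<Sum>z\<in>Z N. F N (pt N z) * indicator (cell N z) r)" if N: "N > 0" for N r
  proof -
    define z where "z k = \<lfloor>r $ k * (real N / real m)\<rfloor>" for k
    have pz: "\<rho> N r = pt N z" by (simp add: \<rho>_def pt_def z_def vreal_def vec_eq_iff divide_inverse mult.commute)
    have "r \<in> cell N z' \<longleftrightarrow> z = z'" for z' by (simp add: cell_def z_def fun_eq_iff)
    then have ind: "indicator (cell N z') r = (if z = z' then 1 else (0::real))" for z'
      by (simp add: indicator_def)
    have "F N (pt N z) = 0" if "z \<notin> Z N"
    proof (rule ccontr)
      assume "F N (pt N z) \<noteq> 0"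
      then have "\<forall>k. 0 < pt N z $ k \<and> pt N z $ k \<le> 1" by (rule supp)
      then have "\<forall>k. 0 < real_of_int (c k + int m * z k) \<and> real_of_int (c k + int m * z k) \<le> real N"
        using N by (simp add: pt_def vreal_def field_simps)
      then have "\<forall>k. 1 \<le> c k + int m * z k \<and> c k + int m * z k \<le> int N" by (smt (verit) of_int_le_iff of_int_of_nat_eq of_int_0_less_iff)
      then show False using that by (simp add: Z_def)
    qed
    then show ?thesis unfolding pz ind using finZ[of N] by (simp add: if_distrib[of "\<lambda>x. _ * x"] cong: if_cong)
  qed
  have cellm: "cell N z \<in> sets borel" "emeasure lborel (cell N z) < \<infinity>" "measure lborel (cell N z) = (real m / real N) ^ CARD('n)" if "N > 0" for N z
    using floor_cell[of "real N / real m" z] that m unfolding cell_def by auto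
  have integ: "integral\<^sup>L lborel (\<lambda>r. F N (\<rho> N r)) = (real m / real N) ^ CARD('n) * (\<Sum>y\<in>{y\<in>pbox N. (\<lambda>k. y k mod int m) = c}. F N (vreal y /\<^sub>R real N))"
    if N: "N > 0" for N
  proof -
    have "integral\<^sup>L lborel (\<lambda>r. F N (\<rho> N r)) = (\<Sum>z\<in>Z N. F N (pt N z) * measure lborel (cell N z))"
      unfolding S_eq[OF N] using cellm[OF N] by (subst Bochner_Integration.integral_sum) auto
    also have "\<dots> = (real m / real N) ^ CARD('n) * (\<Sum>z\<in>Z N. F N (pt N z))"
      unfolding cellm(3)[OF N] by (simp add: sum_distrib_left mult.commute)
    also have "(\<Sum>z\<in>Z N. F N (pt N z)) = (\<Sum>y\<in>{y\<in>pbox N. (\<lambda>k. y k mod int m) = c}. F N (vreal y /\<^sub>R real N))"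
      unfolding pt_def by (rule sum.reindex_bij_betw[OF bij])
    finally show ?thesis .
  qed
  have "(\<lambda>N. integral\<^sup>L lborel (\<lambda>r. F (Suc N) (\<rho> (Suc N) r))) \<longlonglongrightarrow> integral\<^sup>L lborel G"
  \<comment> \<open>The attached point differs from \<open>r\<close> by at most \<open>m\<close> in
    each coordinate, so if it lies in the unit cube then \<open>r\<close> lies in this fixed
    cube.\<close>
  proof (rule integral_dominated_convergence[where w = "\<lambda>r. B * indicator (cbox (\<chi> k. - (real m + 1)) (\<chi> k. real m + 1)) r"])
    show "G \<in> borel_measurable lborel" using meas by simp
    show "(\<lambda>r. F (Suc N) (\<rho> (Suc N) r)) \<in> borel_measurable lborel" for N
      unfolding S_eq[OF zero_less_Suc] using cellm(1)[OF zero_less_Suc, of N] by measurable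
    show "integrable lborel (\<lambda>r. B * indicator (cbox (\<chi> k. - (real m + 1)) (\<chi> k. real m + 1)) r)"
      by (intro integrable_mult_right integrable_real_indicator emeasure_bounded_finite bounded_cbox) simp
    have conv: "(\<lambda>N. \<rho> (Suc N) r) \<longlonglongrightarrow> r" for r
    proof (rule vec_tendstoI)
      fix k
      show "(\<lambda>N. \<rho> (Suc N) r $ k) \<longlonglongrightarrow> r $ k"
      proof (rule LIMSEQ_I)
        fix e :: real assume "e > 0"
        obtain M where M: "2 * real m / e < real M" using reals_Archimedean2 by blast
        have "norm (\<rho> (Suc N) r $ k - r $ k) < e" if "N \<ge> M" for N
        proof -
          let ?n = "real (Suc N)"
          define f where "f = frac (r $ k * (?n / real m))"
          have f: "0 \<le> f" "f < 1" by (auto simp: f_def frac_lt_1)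
          have "of_int \<lfloor>r $ k * (?n / real m)\<rfloor> = r $ k * (?n / real m) - f" by (simp add: f_def frac_def)
          then have "\<rho> (Suc N) r $ k = (of_int (c k) + real m * (r $ k * (?n / real m) - f)) / ?n"
            unfolding \<rho>_def by simp
          also have "\<dots> = r $ k + (of_int (c k) - real m * f) / ?n" using m by (intro cell_point_eq) auto
          finally have d: "\<rho> (Suc N) r $ k - r $ k = (of_int (c k) - real m * f) / ?n" by simp
          have "real m * f \<le> real m * 1" using f by (intro mult_left_mono) auto
          moreover have "0 \<le> real m * f" using f by simp
          moreover have "0 \<le> real_of_int (c k)" "real_of_int (c k) \<le> real m" using ck[of k] by linarith+
          ultimately have "\<bar>of_int (c k) - real m * f\<bar> \<le> 2 * real m" by linarith
          then have "norm (\<rho> (Suc N) r $ k - r $ k) \<le> 2 * real m / ?n"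
            unfolding d by (simp add: divide_right_mono)
          also have "\<dots> < e"
          proof -
            have "2 * real m / e < ?n" using M that by simp
            then show ?thesis using \<open>e > 0\<close> by (simp add: field_simps)
          qed
          finally show ?thesis .
        qed
        then show "\<exists>no. \<forall>n\<ge>no. norm (\<rho> (Suc n) r $ k - r $ k) < e" by blast
      qed
    qed
    show "AE r in lborel. (\<lambda>N. F (Suc N) (\<rho> (Suc N) r)) \<longlonglongrightarrow> G r"
      using lim by eventually_elim (use conv in blast)
    show "AE r in lborel. norm (F (Suc N) (\<rho> (Suc N) r)) \<le> B * indicator (cbox (\<chi> k. - (real m + 1)) (\<chi> k. real m + 1)) r" for N
    proof (rule AE_I2)
      fix r
      show "norm (F (Suc N) (\<rho> (Suc N) r)) \<le> B * indicator (cbox (\<chi> k. - (real m + 1)) (\<chi> k. real m + 1)) r"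
      proof (cases "F (Suc N) (\<rho> (Suc N) r) = 0")
        case True
        moreover have "B \<ge> 0" using bound[of 0 0] by (meson abs_ge_zero order_trans)
        ultimately show ?thesis by simp
      next
        case False
        have "- (real m + 1) \<le> r $ k \<and> r $ k \<le> real m + 1" for k
        proof -
          let ?n = "real (Suc N)"
          define f where "f = frac (r $ k * (?n / real m))"
          have f: "0 \<le> f" "f < 1" by (auto simp: f_def frac_lt_1)
          have "of_int \<lfloor>r $ k * (?n / real m)\<rfloor> = r $ k * (?n / real m) - f" by (simp add: f_def frac_def)
          then have "\<rho> (Suc N) r $ k = (of_int (c k) + real m * (r $ k * (?n / real m) - f)) / ?n"
            unfolding \<rho>_def by simp
          also have "\<dots> = r $ k + (of_int (c k) - real m * f) / ?n" using m by (intro cell_point_eq) auto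
          finally have d: "\<rho> (Suc N) r $ k = r $ k + (of_int (c k) - real m * f) / ?n" .
          have "real m * f \<le> real m * 1" using f by (intro mult_left_mono) auto
          moreover have "0 \<le> real m * f" using f by simp
          moreover have "0 \<le> real_of_int (c k)" "real_of_int (c k) \<le> real m" using ck[of k] by linarith+
          ultimately have "\<bar>of_int (c k) - real m * f\<bar> \<le> real m" by linarith
          moreover have "real m / ?n \<le> real m" by (simp add: divide_le_eq mult_le_cancel_left1)
          ultimately have "\<bar>(of_int (c k) - real m * f) / ?n\<bar> \<le> real m"
            by (simp add: abs_divide) (meson divide_right_mono of_nat_0_le_iff order_trans add_nonneg_nonneg zero_le_one)
          moreover have "0 < \<rho> (Suc N) r $ k" "\<rho> (Suc N) r $ k \<le> 1" using supp[OF False] by auto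
          moreover have "- (a + 1) \<le> y \<and> y \<le> a + 1" if "\<bar>x\<bar> \<le> a" "0 < y + x" "y + x \<le> 1" for a x y :: real
            using that by auto
          ultimately show ?thesis unfolding d by blast
        qed
        then have "r \<in> cbox (\<chi> k. - (real m + 1)) (\<chi> k. real m + 1)" by (simp add: mem_box_cart)
        then show ?thesis using bound by simp
      qed
    qed
  qed
  then have "(\<lambda>N. (real m / real (Suc N)) ^ CARD('n) * (\<Sum>y\<in>{y\<in>pbox (Suc N). (\<lambda>k. y k mod int m) = c}. F (Suc N) (vreal y /\<^sub>R real (Suc N))) / real m ^ CARD('n))
      \<longlonglongrightarrow> integral\<^sup>L lborel G / real m ^ CARD('n)"
    unfolding integ[OF zero_less_Suc] using m by (intro tendsto_divide tendsto_const) auto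
  moreover have "(real m / real (Suc N)) ^ CARD('n) * S / real m ^ CARD('n) = S / real (Suc N) ^ CARD('n)" for N S
    using m by (simp add: power_divide)
  ultimately show ?thesis by (simp only:)
qed

lemma riemann_sum_periodic:
  fixes F :: "nat \<Rightarrow> real ^ 'n::finite \<Rightarrow> real" and h :: "('n \<Rightarrow> int) \<Rightarrow> real"
  assumes m: "m > 0" and per: "\<And>y. h (\<lambda>k. y k mod int m) = h y"
    and bound: "\<And>N r. \<bar>F N r\<bar> \<le> B"
    and supp: "\<And>N r. F N r \<noteq> 0 \<Longrightarrow> \<forall>k. 0 < r $ k \<and> r $ k \<le> 1"
    and meas: "G \<in> borel_measurable borel"
    and lim: "AE r in lborel. \<forall>\<rho>. \<rho> \<longlonglongrightarrow> r \<longrightarrow> (\<lambda>N. F (Suc N) (\<rho> N)) \<longlonglongrightarrow> G r"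
  shows "(\<lambda>N. (\<Sum>y\<in>pbox (Suc N). h y * F (Suc N) (vreal y /\<^sub>R real (Suc N))) / real (Suc N) ^ CARD('n))
    \<longlonglongrightarrow> (\<Sum>c\<in>ibox m. h c) / real m ^ CARD('n) * integral\<^sup>L lborel G"
proof -
  have eq: "(\<Sum>y\<in>pbox (Suc N). h y * F (Suc N) (vreal y /\<^sub>R real (Suc N))) / real (Suc N) ^ CARD('n)
    = (\<Sum>c\<in>ibox m. h c * ((\<Sum>y\<in>{y\<in>pbox (Suc N). (\<lambda>k. y k mod int m) = c}. F (Suc N) (vreal y /\<^sub>R real (Suc N))) / real (Suc N) ^ CARD('n)))" for N
  proof -
    have "(\<Sum>y\<in>pbox (Suc N). h y * F (Suc N) (vreal y /\<^sub>R real (Suc N)))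
      = (\<Sum>c\<in>ibox m. \<Sum>y\<in>{y\<in>pbox (Suc N). (\<lambda>k. y k mod int m) = c}. h y * F (Suc N) (vreal y /\<^sub>R real (Suc N)))"
      by (rule sum.group[symmetric], simp, simp) (use m in \<open>auto simp: ibox_def\<close>)
    also have "\<dots> = (\<Sum>c\<in>ibox m. \<Sum>y\<in>{y\<in>pbox (Suc N). (\<lambda>k. y k mod int m) = c}. h c * F (Suc N) (vreal y /\<^sub>R real (Suc N)))"
    proof (intro sum.cong refl)
      fix c y :: "'n \<Rightarrow> int" assume "y \<in> {y\<in>pbox (Suc N). (\<lambda>k. y k mod int m) = c}"
      then have "h y = h c" using per[of y] by simp
      then show "h y * F (Suc N) (vreal y /\<^sub>R real (Suc N)) = h c * F (Suc N) (vreal y /\<^sub>R real (Suc N))" by simp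
    qed
    finally show ?thesis by (simp add: sum_distrib_left sum_divide_distrib)
  qed
  have "(\<lambda>N. (\<Sum>c\<in>ibox m. h c * ((\<Sum>y\<in>{y\<in>pbox (Suc N). (\<lambda>k. y k mod int m) = c}. F (Suc N) (vreal y /\<^sub>R real (Suc N))) / real (Suc N) ^ CARD('n))))
    \<longlonglongrightarrow> (\<Sum>c\<in>ibox m. h c * (integral\<^sup>L lborel G / real m ^ CARD('n)))"
    by (intro tendsto_sum tendsto_mult tendsto_const riemann_sum_class[OF m _ bound supp meas lim])
  then show ?thesis unfolding eq by (simp add: sum_distrib_right sum_divide_distrib)
qed

section \<open>Elimination of one variable from the linear equations\<close>

definition bform :: "('s::finite \<Rightarrow> int) \<Rightarrow> ('s \<times> 'd::finite \<Rightarrow> 'a::comm_ring_1) \<Rightarrow> ('s \<times> 'd \<Rightarrow> 'a) \<Rightarrow> 'a" where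
  "bform l x z = (\<Sum>c\<in>UNIV. of_int (l (fst c)) * x c * z c)"

text \<open>Solves the linear equations for row \<open>i0\<close>, multiplied by \<open>l i0\<close>
  to stay inside the ring. The entries of \<open>y\<close> in row \<open>i0\<close> are ignored but
  kept as dummy variables, so that points, residues and real vectors share one index type.\<close>

definition cmpl :: "('s::finite \<Rightarrow> int) \<Rightarrow> 's \<Rightarrow> ('s \<times> 'd::finite \<Rightarrow> 'a::comm_ring_1) \<Rightarrow> 's \<times> 'd \<Rightarrow> 'a" where
  "cmpl l i0 y c = (if fst c = i0 then - (\<Sum>i\<in>UNIV - {i0}. of_int (l i) * y (i, snd c)) else of_int (l i0) * y c)"

lemma sum_pairs: "(\<Sum>c\<in>UNIV. f c) = (\<Sum>j\<in>UNIV. \<Sum>i\<in>UNIV. f (i, j))"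
  for f :: "'s::finite \<times> 'd::finite \<Rightarrow> 'a::comm_monoid_add"
proof -
  have "(\<Sum>c\<in>UNIV. f c) = (\<Sum>i\<in>UNIV. \<Sum>j\<in>UNIV. f (i, j))" by (simp add: sum.cartesian_product)
  also have "\<dots> = (\<Sum>j\<in>UNIV. \<Sum>i\<in>UNIV. f (i, j))" by (rule sum.swap)
  finally show ?thesis .
qed

lemma lin_cmpl: "(\<Sum>i\<in>UNIV. of_int (l i) * cmpl l i0 y (i, j)) = (0 :: 'a::comm_ring_1)"
  by (subst sum.remove[of _ i0]) (auto simp: cmpl_def sum_distrib_left mult_ac)

lemma cmpl_of_lin:
  fixes x :: "'s::finite \<times> 'd::finite \<Rightarrow> 'a::comm_ring_1"
  assumes "\<And>j. (\<Sum>i\<in>UNIV. of_int (l i) * x (i, j)) = 0"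
  shows "cmpl l i0 x c = of_int (l i0) * x c"
proof (cases "fst c = i0")
  case True
  have "of_int (l i0) * x (i0, snd c) + (\<Sum>i\<in>UNIV - {i0}. of_int (l i) * x (i, snd c)) = 0"
    using assms[of "snd c"] by (subst (asm) sum.remove[of _ i0]) auto
  then have "- (\<Sum>i\<in>UNIV - {i0}. of_int (l i) * x (i, snd c)) = of_int (l i0) * x (i0, snd c)"
    by (subst neg_eq_iff_add_eq_0) (simp add: add.commute)
  then show ?thesis using True by (cases c) (simp add: cmpl_def)
qed (simp add: cmpl_def)

lemma cmpl_add: "cmpl l i0 (\<lambda>c. y c + t * z c) c = cmpl l i0 y c + t * cmpl l i0 z c"
  by (simp add: cmpl_def algebra_simps sum.distrib sum_distrib_left)

lemma cmpl_cong_dvd: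
  fixes y y' :: "'s::finite \<times> 'd::finite \<Rightarrow> int"
  assumes "\<And>c. m dvd y c - y' c"
  shows "m dvd cmpl l i0 y c - cmpl l i0 y' c"
proof -
  have "cmpl l i0 y c - cmpl l i0 y' c = cmpl l i0 (\<lambda>c. y c - y' c) c"
    using cmpl_add[of l i0 y "-1" y' c] by simp
  also have "m dvd \<dots>" unfolding cmpl_def using assms by (auto intro!: dvd_sum)
  finally show ?thesis .
qed

lemma qform_add: "qform l (\<lambda>c. x c + t * z c) = qform l x + t * (2 * bform l x z) + t\<^sup>2 * qform l z"
  unfolding qform_def bform_def by (simp add: power2_eq_square algebra_simps sum.distrib sum_distrib_left)

lemma qform_scale: "qform l (\<lambda>c. t * x c) = t\<^sup>2 * qform l x"
  unfolding qform_def by (simp add: power_mult_distrib sum_distrib_left mult_ac)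

lemma bform_cong_dvd:
  fixes x x' :: "'s::finite \<times> 'd::finite \<Rightarrow> int"
  assumes "\<And>c. m dvd x c - x' c" shows "m dvd bform l x z - bform l x' z"
proof -
  have "bform l x z - bform l x' z = (\<Sum>c\<in>UNIV. l (fst c) * (x c - x' c) * z c)"
    unfolding bform_def sum_subtractf[symmetric] by (simp add: algebra_simps)
  also have "m dvd \<dots>" using assms by (auto intro!: dvd_sum)
  finally show ?thesis .
qed

lemma qform_cong_dvd:
  fixes x x' :: "'s::finite \<times> 'd::finite \<Rightarrow> int"
  assumes "\<And>c. m dvd x c - x' c" shows "m dvd qform l x - qform l x'"
proof -
  have "qform l x - qform l x' = (\<Sum>c\<in>UNIV. l (fst c) * (x c + x' c) * (x c - x' c))"
    unfolding qform_def sum_subtractf[symmetric] by (simp add: algebra_simps power2_eq_square)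
  also have "m dvd \<dots>" using assms by (auto intro!: dvd_sum)
  finally show ?thesis .
qed

section \<open>Complete sums modulo \<open>m\<close> and Gauss sums\<close>

lemma sum_ibox_coprime:
  fixes f g :: "('n::finite \<Rightarrow> int) \<Rightarrow> real"
  assumes m: "m1 > 0" "m2 > 0" "coprime m1 m2"
    and f: "\<And>y. f (\<lambda>k. y k mod int m1) = f y" and g: "\<And>y. g (\<lambda>k. y k mod int m2) = g y"
  shows "(\<Sum>y\<in>ibox (m1 * m2). f y * g y) = (\<Sum>y\<in>ibox m1. f y) * (\<Sum>y\<in>ibox m2. g y)"
proof -
  let ?\<phi> = "\<lambda>y::'n\<Rightarrow>int. ((\<lambda>k. y k mod int m1), (\<lambda>k. y k mod int m2))"
  have inj: "inj_on ?\<phi> (ibox (m1 * m2))"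
  proof (rule inj_onI, rule ext)
    fix y y' :: "'n \<Rightarrow> int" and k
    assume y: "y \<in> ibox (m1 * m2)" "y' \<in> ibox (m1 * m2)" and eq: "?\<phi> y = ?\<phi> y'"
    have "y k mod int m1 = y' k mod int m1" "y k mod int m2 = y' k mod int m2" using eq by (auto simp: fun_eq_iff)
    then have "int m1 dvd y k - y' k" "int m2 dvd y k - y' k" by (simp_all add: mod_eq_dvd_iff)
    then have "int m1 * int m2 dvd y k - y' k" using m by (intro divides_mult) auto
    then have "y k mod int (m1 * m2) = y' k mod int (m1 * m2)" by (simp add: mod_eq_dvd_iff)
    then show "y k = y' k" using y by (simp add: ibox_def)
  qed
  have sub: "?\<phi> ` ibox (m1 * m2) \<subseteq> ibox m1 \<times> ibox m2" using m by (auto simp: ibox_def)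
  have "card (?\<phi> ` ibox (m1 * m2)) = card (ibox m1 \<times> ibox m2 :: (('n \<Rightarrow> int) \<times> ('n \<Rightarrow> int)) set)"
    by (simp add: card_image[OF inj] card_ibox power_mult_distrib card_cartesian_product)
  then have bij: "bij_betw ?\<phi> (ibox (m1 * m2)) (ibox m1 \<times> ibox m2)"
    using inj card_subset_eq[OF _ sub] by (simp add: bij_betw_def)
  have "(\<Sum>y\<in>ibox (m1 * m2). f y * g y) = (\<Sum>y\<in>ibox (m1 * m2). (\<lambda>(a, b). f a * g b) (?\<phi> y))"
    by (simp add: f g)
  also have "\<dots> = (\<Sum>(a, b)\<in>ibox m1 \<times> ibox m2. f a * g b)" by (rule sum.reindex_bij_betw[OF bij])
  finally show ?thesis by (simp add: sum_product sum.cartesian_product)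
qed

lemma bij_betw_shift_mod:
  assumes m: "m > 0"
  shows "bij_betw (\<lambda>y k. (y k + w k) mod int m) (ibox m) (ibox m :: ('n::finite \<Rightarrow> int) set)"
proof -
  have inj: "inj_on (\<lambda>y k. (y k + w k) mod int m) (ibox m :: ('n \<Rightarrow> int) set)"
  proof (rule inj_onI, rule ext)
    fix y y' :: "'n \<Rightarrow> int" and k
    assume y: "y \<in> ibox m" "y' \<in> ibox m" and eq: "(\<lambda>k. (y k + w k) mod int m) = (\<lambda>k. (y' k + w k) mod int m)"
    have "int m dvd (y k + w k) - (y' k + w k)" using fun_cong[OF eq, of k] by (simp only: mod_eq_dvd_iff)
    then have "y k mod int m = y' k mod int m" by (simp add: mod_eq_dvd_iff)
    then show "y k = y' k" using y by (simp add: ibox_def)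
  qed
  moreover have "(\<lambda>y k. (y k + w k) mod int m) ` ibox m \<subseteq> ibox m" using m by (auto simp: ibox_def)
  ultimately show ?thesis by (simp add: bij_betw_def endo_inj_surj)
qed

lemma sum_ibox_shift:
  fixes f :: "('n::finite \<Rightarrow> int) \<Rightarrow> 'a::comm_monoid_add"
  assumes m: "m > 0" and f: "\<And>y. f (\<lambda>k. y k mod int m) = f y"
  shows "(\<Sum>y\<in>ibox m. f (\<lambda>k. y k + w k)) = (\<Sum>y\<in>ibox m. f y)"
proof -
  have "(\<Sum>y\<in>ibox m. f (\<lambda>k. y k + w k)) = (\<Sum>y\<in>ibox m. f (\<lambda>k. (y k + w k) mod int m))"
    by (intro sum.cong refl) (rule f[symmetric])
  also have "\<dots> = (\<Sum>y\<in>ibox m. f y)" by (rule sum.reindex_bij_betw[OF bij_betw_shift_mod[OF m]])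
  finally show ?thesis .
qed

lemma sum_ibox_orthogonal:
  fixes D :: "'n::finite \<Rightarrow> int"
  assumes m: "m > 0"
  shows "(\<Sum>y\<in>ibox m. ee (of_int (\<Sum>c\<in>UNIV. y c * D c) / real m)) = (if \<forall>c. int m dvd D c then of_nat (m ^ CARD('n)) else 0)"
proof -
  have "(\<Sum>y\<in>ibox m. ee (of_int (\<Sum>c\<in>UNIV. y c * D c) / real m)) = (\<Sum>y\<in>PiE UNIV (\<lambda>_. {0..<int m}). \<Prod>c\<in>UNIV. ee (of_int (y c) * (of_int (D c) / real m)))"
    unfolding ibox_eq_PiE ee_sum[symmetric] by (simp add: sum_divide_distrib)
  also have "\<dots> = (\<Prod>c\<in>UNIV. \<Sum>t\<in>{0..<int m}. ee (of_int t * (of_int (D c) / real m)))"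
    by (rule prod_sum_PiE[symmetric]) auto
  also have "\<dots> = (\<Prod>c\<in>UNIV. if int m dvd D c then of_nat m else 0)"
  proof (rule prod.cong[OF refl])
    fix c
    have "(\<Sum>t\<in>{0..<int m}. ee (of_int t * (of_int (D c) / real m))) = (\<Sum>k<m. ee (real k * (of_int (D c) / real m)))"
      by (rule sum.reindex_bij_witness[of _ int nat]) auto
    then show "(\<Sum>t\<in>{0..<int m}. ee (of_int t * (of_int (D c) / real m))) = (if int m dvd D c then of_nat m else 0)"
      by (simp only: sum_ee_orthogonal[OF m])
  qed
  also have "\<dots> = (if \<forall>c. int m dvd D c then of_nat (m ^ CARD('n)) else 0)"
    by (auto simp: prod_zero_iff)
  finally show ?thesis .
qed

text \<open>Coefficients, as a linear form in \<open>y\<close>, of the polarised quadratic form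
  after elimination. They vanish in row \<open>i0\<close>, as they must for dummy variables.\<close>

definition dcoef :: "('s::finite \<Rightarrow> int) \<Rightarrow> 's \<Rightarrow> ('s \<times> 'd::finite \<Rightarrow> int) \<Rightarrow> 's \<times> 'd \<Rightarrow> int" where
  "dcoef l i0 h c = 2 * l i0 * l (fst c) * (cmpl l i0 h c - cmpl l i0 h (i0, snd c))"

lemma bform_cmpl:
  fixes y h :: "'s::finite \<times> 'd::finite \<Rightarrow> int"
  shows "2 * bform l (cmpl l i0 y) (cmpl l i0 h) = (\<Sum>c\<in>UNIV. y c * dcoef l i0 h c)"
proof -
  have "2 * (\<Sum>i\<in>UNIV. l i * cmpl l i0 y (i, j) * cmpl l i0 h (i, j)) = (\<Sum>i\<in>UNIV. y (i, j) * dcoef l i0 h (i, j))" for j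
  proof -
    have "2 * (\<Sum>i\<in>UNIV. l i * cmpl l i0 y (i, j) * cmpl l i0 h (i, j)) =
        2 * (l i0 * cmpl l i0 y (i0, j) * cmpl l i0 h (i0, j) + (\<Sum>i\<in>UNIV - {i0}. l i * cmpl l i0 y (i, j) * cmpl l i0 h (i, j)))"
      by (subst sum.remove[of _ i0]) auto
    also have "(\<Sum>i\<in>UNIV - {i0}. l i * cmpl l i0 y (i, j) * cmpl l i0 h (i, j)) = (\<Sum>i\<in>UNIV - {i0}. l i * (l i0 * y (i, j)) * cmpl l i0 h (i, j))"
      by (intro sum.cong refl) (simp add: cmpl_def[of l i0 y])
    also have "l i0 * cmpl l i0 y (i0, j) * cmpl l i0 h (i0, j) = (\<Sum>i\<in>UNIV - {i0}. - (l i0 * l i * y (i, j) * cmpl l i0 h (i0, j)))"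
      by (simp add: cmpl_def[of l i0 y] sum_distrib_left sum_distrib_right sum_negf mult_ac)
    also have "2 * ((\<Sum>i\<in>UNIV - {i0}. - (l i0 * l i * y (i, j) * cmpl l i0 h (i0, j))) + (\<Sum>i\<in>UNIV - {i0}. l i * (l i0 * y (i, j)) * cmpl l i0 h (i, j)))
        = (\<Sum>i\<in>UNIV - {i0}. y (i, j) * dcoef l i0 h (i, j))"
      unfolding sum.distrib[symmetric] sum_distrib_left by (intro sum.cong refl) (simp add: dcoef_def algebra_simps)
    also have "\<dots> = (\<Sum>i\<in>UNIV. y (i, j) * dcoef l i0 h (i, j))"
      by (rule sum.mono_neutral_left) (auto simp: dcoef_def)
    finally show ?thesis .
  qed
  then show ?thesis unfolding bform_def sum_pairs by (simp add: sum_distrib_left)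
qed

text \<open>Translates of \<open>Z\<close> by vectors \<open>w\<close> with entries in
  \<open>[0, q)\<close> that vanish in rows \<open>i0\<close> and \<open>i1\<close> are disjoint mod
  \<open>m\<close>: in each column, row \<open>i1\<close> reveals the common residue of
  \<open>h\<close> mod \<open>q\<close>, and subtracting it reveals \<open>w\<close>. There are
  \<open>q ^ (d * (s - 2))\<close> such vectors.\<close>

lemma card_fibre_le:
  fixes i0 i1 :: "'s::finite"
  assumes q: "q > 0" "q dvd m" "m > 0" and i: "i0 \<noteq> i1"
  defines "Z \<equiv> {h \<in> ibox m. \<forall>i i' (j::'d::finite). i \<noteq> i0 \<longrightarrow> i' \<noteq> i0 \<longrightarrow> int q dvd h (i, j) - h (i', j)}"
  shows "card Z * q ^ (CARD('d) * (CARD('s) - 2)) \<le> m ^ CARD('s \<times> 'd)"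
proof -
  define W where "W = (PiE UNIV (\<lambda>c. if fst c \<in> {i0, i1} then {0} else {0..<int q}) :: ('s \<times> 'd \<Rightarrow> int) set)"
  have Wm: "w c \<in> (if fst c \<in> {i0, i1} then {0} else {0..<int q})" if "w \<in> W" for w and c :: "'s \<times> 'd"
    using that unfolding W_def by (rule PiE_mem) simp
  have W: "w c = 0" if "w \<in> W" "fst c \<in> {i0, i1}" for w and c :: "'s \<times> 'd" using Wm[OF that(1), of c] that(2) by simp
  have W': "0 \<le> w c \<and> w c < int q" if "w \<in> W" for w and c :: "'s \<times> 'd"
    using Wm[OF that, of c] q by (auto split: if_splits)
  have "card W = (\<Prod>c\<in>(UNIV :: ('s \<times> 'd) set). card (if fst c \<in> {i0, i1} then {0} else {0..<int q}))"
    unfolding W_def by (rule card_PiE) auto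
  also have "\<dots> = (\<Prod>c\<in>(UNIV :: ('s \<times> 'd) set). if fst c \<in> {i0, i1} then 1 else q)" by (intro prod.cong) auto
  also have "\<dots> = q ^ card {c :: 's \<times> 'd. fst c \<notin> {i0, i1}}"
    by (simp add: prod.If_cases Collect_neg_eq[symmetric] Compl_eq)
  also have "{c :: 's \<times> 'd. fst c \<notin> {i0, i1}} = (UNIV - {i0, i1}) \<times> UNIV" by auto
  also have "card \<dots> = CARD('d) * (CARD('s) - 2)" using i
    by (simp add: card_cartesian_product card_Diff_subset mult.commute)
  finally have cW: "card W = q ^ (CARD('d) * (CARD('s) - 2))" .
  have finW: "finite W" unfolding W_def by (intro finite_PiE) auto
  have finZ: "finite Z" unfolding Z_def by simp
  have Zd: "int q dvd h (i, j) - h (i1, j)" if "h \<in> Z" "i \<noteq> i0" for h i j using that i by (auto simp: Z_def)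
  let ?\<phi> = "\<lambda>(h, w) c. (h c + w c) mod int m"
  have "inj_on ?\<phi> (Z \<times> W)"
  proof (rule inj_onI, clarify)
    fix h w h' w' assume m: "h \<in> Z" "w \<in> W" "h' \<in> Z" "w' \<in> W" and eq: "(\<lambda>c. (h c + w c) mod int m) = (\<lambda>c. (h' c + w' c) mod int m)"
    have dm: "int m dvd (h c + w c) - (h' c + w' c)" for c using fun_cong[OF eq, of c] by (simp only: mod_eq_dvd_iff)
    have dq: "int q dvd (h c + w c) - (h' c + w' c)" for c using dm[of c] q(2) by (meson dvd_trans int_dvd_int_iff)
    have ww: "w = w'"
    proof
      fix c :: "'s \<times> 'd" obtain i j where c: "c = (i, j)" by (cases c)
      show "w c = w' c"
      proof (cases "i = i0")
        case True
        then show ?thesis using W[OF m(2), of c] W[OF m(4), of c] c by simp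
      next
        case False
        have "int q dvd h (i1, j) - h' (i1, j)" using dq[of "(i1, j)"] W[OF m(2), of "(i1,j)"] W[OF m(4), of "(i1,j)"] by simp
        then have "int q dvd ((h c + w c) - (h' c + w' c)) - (h (i, j) - h (i1, j)) + (h' (i, j) - h' (i1, j)) - (h (i1, j) - h' (i1, j))"
          by (rule dvd_diff[OF dvd_add[OF dvd_diff[OF dq[of c] Zd[OF m(1) False, of j]] Zd[OF m(3) False, of j]]])
        then have "int q dvd w c - w' c" by (simp add: c algebra_simps)
        then have "w c mod int q = w' c mod int q" by (simp only: mod_eq_dvd_iff)
        then show ?thesis using W'[OF m(2), of c] W'[OF m(4), of c] by simp
      qed
    qed
    have "h = h'"
    proof
      fix c :: "'s \<times> 'd"
      have "int m dvd h c - h' c" using dm[of c] ww by simp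
      then have "h c mod int m = h' c mod int m" by (simp only: mod_eq_dvd_iff)
      moreover have "0 \<le> h c \<and> h c < int m" "0 \<le> h' c \<and> h' c < int m"
        using m unfolding Z_def ibox_def by blast+
      ultimately show "h c = h' c" by simp
    qed
    then show "h = h' \<and> w = w'" using ww by simp
  qed
  moreover have "?\<phi> ` (Z \<times> W) \<subseteq> ibox m" using q by (auto simp: ibox_def)
  ultimately have "card (Z \<times> W) \<le> card (ibox m :: ('s \<times> 'd \<Rightarrow> int) set)" by (intro card_inj_on_le) auto
  then show ?thesis by (simp add: card_cartesian_product cW card_ibox)
qed

text \<open>Differencing a complete sum is exact: orthogonality in \<open>y\<close> leaves only
  those \<open>h\<close> for which \<open>m\<close> divides every \<open>b * dcoef l i0 h c\<close>.
  Here \<open>q\<close> is the reduced denominator of \<open>b / m\<close> and the coefficients are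
  units, so in each column the entries of \<open>h\<close> outside row \<open>i0\<close> agree mod
  \<open>q\<close>, and \<open>card_fibre_le\<close> counts such \<open>h\<close>.\<close>

lemma gauss_sum_bound:
  fixes l :: "'s::finite \<Rightarrow> int"
  assumes m: "m > 0" and b: "q = m div gcd b m" and cop: "\<And>i. coprime (int m) (2 * l i)" and i: "i0 \<noteq> i1"
  defines "S \<equiv> (\<Sum>y\<in>ibox m. ee (of_int (int b * qform l (cmpl l i0 (y :: 's \<times> 'd::finite \<Rightarrow> int))) / real m))"
  shows "(norm S)\<^sup>2 * real q ^ (CARD('d) * (CARD('s) - 2)) \<le> (real m ^ CARD('s \<times> 'd))\<^sup>2"
proof -
  let ?Q = "\<lambda>y :: 's \<times> 'd \<Rightarrow> int. qform l (cmpl l i0 y)"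
  let ?e = "\<lambda>y. ee (of_int (int b * ?Q y) / real m)"
  have g: "gcd b m > 0" using m by simp
  have mq: "m = q * gcd b m" using b by simp
  have q: "q > 0" "q dvd m" using mq m by (auto intro: gr0I dvdI)
  have per: "?e (\<lambda>k. y k mod int m) = ?e y" for y
  proof -
    have "int m dvd ?Q (\<lambda>k. y k mod int m) - ?Q y"
      by (intro qform_cong_dvd cmpl_cong_dvd) (simp add: mod_eq_dvd_iff[symmetric])
    then obtain t where t: "?Q (\<lambda>k. y k mod int m) - ?Q y = int m * t" ..
    then have "?Q (\<lambda>k. y k mod int m) = ?Q y + int m * t" by simp
    then have "of_int (int b * ?Q (\<lambda>k. y k mod int m)) / real m = of_int (int b * ?Q y) / real m + of_int (int b * t)"
      using m by (simp add: field_simps)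
    then show ?thesis by (simp only: ee_add_int)
  qed
  have diffQ: "?Q (\<lambda>k. h k + y k) - ?Q y = ?Q h + (\<Sum>c\<in>UNIV. y c * dcoef l i0 h c)" for h y
  proof -
    have "cmpl l i0 (\<lambda>k. y k + 1 * h k) = (\<lambda>c. cmpl l i0 y c + 1 * cmpl l i0 h c)" by (rule ext) (rule cmpl_add)
    then have "?Q (\<lambda>k. h k + y k) = qform l (\<lambda>c. cmpl l i0 y c + 1 * cmpl l i0 h c)" by (simp add: add.commute)
    then show ?thesis unfolding qform_add bform_cmpl by simp
  qed
  let ?Z = "{h \<in> ibox m. \<forall>c. int m dvd int b * dcoef l i0 (h :: 's \<times> 'd \<Rightarrow> int) c}"
  have "complex_of_real ((norm S)\<^sup>2) = (\<Sum>y\<in>ibox m. ?e y) * cnj (\<Sum>y\<in>ibox m. ?e y)"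
    unfolding S_def by (rule complex_norm_square)
  also have "\<dots> = (\<Sum>y\<in>ibox m. (\<Sum>h\<in>ibox m. ?e (\<lambda>k. h k + y k)) * cnj (?e y))"
    using sum_ibox_shift[OF m, of ?e, OF per] by (simp add: sum_distrib_left cnj_sum)
  also have "\<dots> = (\<Sum>h\<in>ibox m. \<Sum>y\<in>ibox m. ?e (\<lambda>k. h k + y k) * cnj (?e y))"
    unfolding sum_distrib_right by (rule sum.swap)
  also have "\<dots> = (\<Sum>h\<in>ibox m. ?e h * (\<Sum>y\<in>ibox m. ee (of_int (\<Sum>c\<in>UNIV. y c * (int b * dcoef l i0 h c)) / real m)))"
  proof (intro sum.cong refl)
    fix h
    have "?e (\<lambda>k. h k + y k) * cnj (?e y) = ?e h * ee (of_int (\<Sum>c\<in>UNIV. y c * (int b * dcoef l i0 h c)) / real m)" for y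
    proof -
      have "?e (\<lambda>k. h k + y k) * cnj (?e y) = ee (of_int (int b * (?Q (\<lambda>k. h k + y k) - ?Q y)) / real m)"
        unfolding ee_diff[symmetric] by (simp add: right_diff_distrib diff_divide_distrib)
      also have "int b * (?Q (\<lambda>k. h k + y k) - ?Q y) = int b * ?Q h + (\<Sum>c\<in>UNIV. y c * (int b * dcoef l i0 h c))"
        unfolding diffQ by (simp add: distrib_left sum_distrib_left mult_ac)
      finally show ?thesis by (simp only: of_int_add add_divide_distrib ee_add)
    qed
    then show "(\<Sum>y\<in>ibox m. ?e (\<lambda>k. h k + y k) * cnj (?e y)) = ?e h * (\<Sum>y\<in>ibox m. ee (of_int (\<Sum>c\<in>UNIV. y c * (int b * dcoef l i0 h c)) / real m))"
      by (simp only: sum_distrib_left)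
  qed
  also have "\<dots> = (\<Sum>h\<in>ibox m. if \<forall>c. int m dvd int b * dcoef l i0 h c then ?e h * of_nat (m ^ CARD('s \<times> 'd)) else 0)"
    unfolding sum_ibox_orthogonal[OF m] by (intro sum.cong refl) simp
  also have "\<dots> = (\<Sum>h\<in>?Z. ?e h * of_nat (m ^ CARD('s \<times> 'd)))"
    by (subst sum.inter_filter) auto
  finally have eq: "complex_of_real ((norm S)\<^sup>2) = (\<Sum>h\<in>?Z. ?e h * of_nat (m ^ CARD('s \<times> 'd)))" .
  have "(norm S)\<^sup>2 = norm (complex_of_real ((norm S)\<^sup>2))" by (simp only: norm_of_real abs_of_nonneg zero_le_power2)
  also have "\<dots> \<le> (\<Sum>h\<in>?Z. real m ^ CARD('s \<times> 'd))"
    unfolding eq by (rule order_trans[OF norm_sum], rule sum_mono)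
      (simp only: norm_mult norm_ee norm_power norm_of_nat of_nat_power mult_1 order_refl)
  also have "\<dots> = real (card ?Z) * real m ^ CARD('s \<times> 'd)" by (rule sum_constant)
  finally have 1: "(norm S)\<^sup>2 \<le> real (card ?Z) * real m ^ CARD('s \<times> 'd)" .
  let ?Y = "{h \<in> ibox m. \<forall>i i' (j::'d). i \<noteq> i0 \<longrightarrow> i' \<noteq> i0 \<longrightarrow> int q dvd h (i, j) - h (i', j)}"
  have copq: "coprime (int q) (2 * l i)" for i
    using cop[of i] q(2) by (meson coprime_divisors dvd_refl int_dvd_int_iff)
  have copq2: "coprime (int q) (l i)" for i using copq[of i] by (simp add: coprime_mult_right_iff)
  have "?Z \<subseteq> ?Y"
  proof
    fix h assume h: "h \<in> ?Z"
    \<comment> \<open>Removing \<open>gcd b m\<close> leaves a cofactor \<open>b'\<close> of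
      \<open>b\<close> prime to \<open>q\<close>; after that \<open>2 * l i0\<close> and
      \<open>l i\<close> are cancelled as units mod \<open>q\<close>.\<close>
    have d: "int q dvd cmpl l i0 h (i, j) - cmpl l i0 h (i0, j)" for i j
    proof -
      have "int m dvd int b * dcoef l i0 h (i, j)" using h by blast
      moreover define g where "g = gcd b m"
      ultimately have "int q * int g dvd int b * dcoef l i0 h (i, j)" using mq by (metis of_nat_mult)
      moreover obtain b' where b': "b = g * b'" unfolding g_def by (meson dvd_def gcd_dvd1)
      moreover have g0: "g > 0" using m by (simp add: g_def)
      ultimately have "int g * int q dvd int g * (int b' * dcoef l i0 h (i, j))" by (simp add: mult_ac)
      then have "int q dvd int b' * dcoef l i0 h (i, j)" using g0 by simp
      moreover have "coprime q b'"
      proof -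
        have "coprime (b div gcd b m) (m div gcd b m)" using m by (intro div_gcd_coprime) auto
        moreover have "b div g = b'" using g0 by (subst b') simp
        then have "b div gcd b m = b'" by (simp only: g_def)
        ultimately show ?thesis using b by (simp add: coprime_commute)
      qed
      ultimately have "int q dvd dcoef l i0 h (i, j)" by (simp add: coprime_dvd_mult_right_iff)
      then have "int q dvd (2 * l i0) * (l i * (cmpl l i0 h (i, j) - cmpl l i0 h (i0, j)))" by (simp add: dcoef_def mult_ac)
      then show ?thesis using copq[of i0] copq2[of i] coprime_dvd_mult_right_iff by blast
    qed
    have "int q dvd h (i, j) - h (i', j)" if "i \<noteq> i0" "i' \<noteq> i0" for i i' j
    proof -
      have "int q dvd (cmpl l i0 h (i, j) - cmpl l i0 h (i0, j)) - (cmpl l i0 h (i', j) - cmpl l i0 h (i0, j))"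
        by (intro dvd_diff d)
      then have "int q dvd l i0 * (h (i, j) - h (i', j))" using that by (simp add: cmpl_def algebra_simps)
      then show ?thesis using copq2[of i0] coprime_dvd_mult_right_iff by blast
    qed
    then show "h \<in> ?Y" using h by auto
  qed
  then have "card ?Z \<le> card ?Y" by (intro card_mono) auto
  then have "card ?Z * q ^ (CARD('d) * (CARD('s) - 2)) \<le> card ?Y * q ^ (CARD('d) * (CARD('s) - 2))" by (rule mult_right_mono) simp
  also have "\<dots> \<le> m ^ CARD('s \<times> 'd)" by (rule card_fibre_le[OF q m i])
  finally have "real (card ?Z * q ^ (CARD('d) * (CARD('s) - 2))) \<le> real (m ^ CARD('s \<times> 'd))"
    by (rule of_nat_mono)
  then have 2: "real (card ?Z) * real q ^ (CARD('d) * (CARD('s) - 2)) \<le> real m ^ CARD('s \<times> 'd)"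
    by (simp only: of_nat_mult of_nat_power)
  have "(norm S)\<^sup>2 * real q ^ (CARD('d) * (CARD('s) - 2)) \<le> (real (card ?Z) * real m ^ CARD('s \<times> 'd)) * real q ^ (CARD('d) * (CARD('s) - 2))"
    using 1 by (rule mult_right_mono) simp
  also have "\<dots> = (real (card ?Z) * real q ^ (CARD('d) * (CARD('s) - 2))) * real m ^ CARD('s \<times> 'd)" by (simp only: mult_ac)
  also have "\<dots> \<le> real m ^ CARD('s \<times> 'd) * real m ^ CARD('s \<times> 'd)" using 2 by (rule mult_right_mono) simp
  finally show ?thesis by (simp only: power2_eq_square)
qed

text \<open>All primes outside a finite set are treated at once, without an Euler product. The
  frequency \<open>b = 0\<close> gives the expected count. Those \<open>b\<close> with reduced
  denominator \<open>q\<close> cost \<open>q powr (-5/2)\<close> each, because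
  \<open>d * (s - 2) \<ge> 5\<close>, and there are at most \<open>q\<close> of them. Every such
  \<open>q\<close> exceeds \<open>P0\<close>, so the error is a tail of the series with exponent
  \<open>-3/2\<close>, at most half of the main term.\<close>

lemma complete_sum_lower:
  fixes l :: "'s::finite \<Rightarrow> int" and i0 i1 :: 's
  assumes m: "m > 0" and cop: "\<And>i. coprime (int m) (2 * l i)" and i: "i0 \<noteq> i1"
    and r: "CARD('d::finite) * (CARD('s) - 2) \<ge> 5"
    and big: "\<And>q. q dvd m \<Longrightarrow> q > 1 \<Longrightarrow> q > P0"
    and tail: "(\<Sum>q\<in>{P0<..m}. real q powr (-3/2)) \<le> 1 / 2"
  shows "real m * (\<Sum>y\<in>ibox m. of_bool (int m dvd qform l (cmpl l i0 (y :: 's \<times> 'd \<Rightarrow> int)))) \<ge> real m ^ CARD('s \<times> 'd) / 2"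
proof -
  let ?Q = "\<lambda>y :: 's \<times> 'd \<Rightarrow> int. qform l (cmpl l i0 y)"
  let ?n = "CARD('s \<times> 'd)"
  define S where "S b = (\<Sum>y\<in>ibox m. ee (of_int (int b * ?Q y) / real m))" for b
  define q where "q b = m div gcd b m" for b
  have gm: "gcd b m > 0" "gcd b m dvd m" for b using m by auto
  have mq: "m = q b * gcd b m" for b by (simp add: q_def)
  have q0: "q b > 0" "q b dvd m" for b using mq[of b] m by (auto intro: gr0I dvdI)
  have "complex_of_real (real m * (\<Sum>y\<in>ibox m. of_bool (int m dvd ?Q y))) = (\<Sum>y\<in>ibox m. \<Sum>b<m. ee (real b * (of_int (?Q y) / real m)))"
    unfolding sum_ee_orthogonal[OF m] sum_distrib_left of_real_sum by (intro sum.cong) auto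
  also have "\<dots> = (\<Sum>b<m. S b)" unfolding S_def by (subst sum.swap) simp
  also have "\<dots> = S 0 + (\<Sum>b\<in>{1..<m}. S b)"
  proof -
    have "{..<m} = insert 0 {1..<m}" using m by auto
    then show ?thesis by simp
  qed
  also have "S 0 = of_nat (m ^ ?n)" by (simp add: S_def card_ibox)
  finally have eq: "complex_of_real (real m * (\<Sum>y\<in>ibox m. of_bool (int m dvd ?Q y)) - real m ^ ?n) = (\<Sum>b\<in>{1..<m}. S b)"
    by simp
  have Sb: "norm (S b) \<le> real m ^ ?n * real (q b) powr (-5/2)" for b
  proof -
    have q1: "real (q b) \<ge> 1" using q0[of b] by simp
    have "(norm (S b) * real (q b) powr (5/2))\<^sup>2 = (norm (S b))\<^sup>2 * real (q b) ^ 5"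
      using q1 by (simp add: power_mult_distrib powr_power powr_numeral)
    also have "\<dots> \<le> (norm (S b))\<^sup>2 * real (q b) ^ (CARD('d) * (CARD('s) - 2))"
      by (intro mult_left_mono power_increasing r q1) simp
    also have "\<dots> \<le> (real m ^ ?n)\<^sup>2"
      unfolding S_def by (rule gauss_sum_bound[OF m q_def cop i])
    finally have "norm (S b) * real (q b) powr (5/2) \<le> real m ^ ?n" by (rule power2_le_imp_le) simp
    then show ?thesis using q1 by (simp add: powr_minus field_simps)
  qed
  have img: "q ` {1..<m} \<subseteq> {P0<..m}"
    proof clarify
      fix b assume b: "b \<in> {1..<m}"
      have "gcd b m \<le> b" using b by (intro dvd_imp_le) auto
      moreover have "b < m" using b by simp
      ultimately have "gcd b m < m" by (rule le_less_trans)
      then have "q b \<noteq> 1" using mq[of b] by (metis mult_1 less_irrefl)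
      then have "q b > 1" using q0[of b] by linarith
      then show "q b \<in> {P0<..m}" using big[OF q0(2)] dvd_imp_le[OF q0(2) m] by auto
    qed
  \<comment> \<open>All these \<open>b\<close> are multiples of \<open>m div s\<close> below
    \<open>m\<close>, and the quotient identifies them.\<close>
  have cnt: "real (card {b \<in> {1..<m}. q b = s}) \<le> real s" for s
  proof -
    let ?A = "{b \<in> {1..<m}. q b = s}"
    have "inj_on (\<lambda>b. b div (m div s)) ?A" "(\<lambda>b. b div (m div s)) ` ?A \<subseteq> {..<s}"
    proof -
      have e: "m div s = gcd b m" if "b \<in> ?A" for b
        using that mq[of b] q0[of b] by (metis (mono_tags, lifting) mem_Collect_eq nonzero_mult_div_cancel_left less_numeral_extra(3))
      show "inj_on (\<lambda>b. b div (m div s)) ?A"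
      proof (rule inj_onI)
        fix a b assume ab: "a \<in> ?A" "b \<in> ?A" "a div (m div s) = b div (m div s)"
        have "a = a div gcd a m * gcd a m" "b = b div gcd b m * gcd b m" by simp_all
        then show "a = b" using ab(3) e[OF ab(1)] e[OF ab(2)] by metis
      qed
      show "(\<lambda>b. b div (m div s)) ` ?A \<subseteq> {..<s}"
      proof (rule image_subsetI)
        fix b assume b: "b \<in> ?A"
        have "b < q b * gcd b m" using mq[of b] b by simp
        then have "b div gcd b m < q b" by (simp add: less_mult_imp_div_less)
        then show "b div (m div s) \<in> {..<s}" using e[OF b] b by simp
      qed
    qed
    from card_inj_on_le[OF this] show ?thesis by simp
  qed
  have "(\<Sum>b\<in>{1..<m}. real (q b) powr (-5/2)) \<le> (\<Sum>s\<in>{P0<..m}. real s * real s powr (-5/2))"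
    by (rule sum_fibre_le[where k = "\<lambda>s. real s powr (-5/2)" and c = real, OF _ _ img _ cnt]) auto
  also have "\<dots> = (\<Sum>s\<in>{P0<..m}. real s powr (-3/2))"
    by (intro sum.cong refl) (simp add: powr_mult_base)
  also have "\<dots> \<le> 1 / 2" by (rule tail)
  finally have half: "(\<Sum>b\<in>{1..<m}. real (q b) powr (-5/2)) \<le> 1 / 2" .
  have "\<bar>real m * (\<Sum>y\<in>ibox m. of_bool (int m dvd ?Q y)) - real m ^ ?n\<bar> = norm (\<Sum>b\<in>{1..<m}. S b)"
    unfolding eq[symmetric] by (simp only: norm_of_real)
  also have "\<dots> \<le> (\<Sum>b\<in>{1..<m}. real m ^ ?n * real (q b) powr (-5/2))"
    by (intro sum_norm_le Sb)
  also have "\<dots> = real m ^ ?n * (\<Sum>b\<in>{1..<m}. real (q b) powr (-5/2))" by (simp only: sum_distrib_left)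
  also have "\<dots> \<le> real m ^ ?n * (1 / 2)" using half by (intro mult_left_mono) auto
  finally show ?thesis by linarith
qed

subsection \<open>Lower bounds for the local densities\<close>

text \<open>Expresses that elimination leads to an integer point on which the form is divisible by
  \<open>M\<close>. As \<open>cmpl\<close> carries a factor \<open>l i0\<close>, integrality is
  divisibility by \<open>l i0\<close> and the form picks up its square.\<close>

definition hcond :: "('s::finite \<Rightarrow> int) \<Rightarrow> 's \<Rightarrow> nat \<Rightarrow> ('s \<times> 'd::finite \<Rightarrow> int) \<Rightarrow> bool" where
  "hcond l i0 M y \<longleftrightarrow> (\<forall>c. l i0 dvd cmpl l i0 y c) \<and> int M * (l i0)\<^sup>2 dvd qform l (cmpl l i0 y)"

lemma dvd_iff_of_dvd_diff: "(a :: int) dvd x - y \<Longrightarrow> a dvd x \<longleftrightarrow> a dvd y"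
  using dvd_add_right_iff[of a "x - y" y] by simp

lemma hcond_mod:
  assumes "int m = int M * (l i0)\<^sup>2"
  shows "hcond l i0 M (\<lambda>k. y k mod int m) \<longleftrightarrow> hcond l i0 M y"
proof -
  have d: "int m dvd cmpl l i0 (\<lambda>k. y k mod int m) c - cmpl l i0 y c" for c
    by (intro cmpl_cong_dvd) (simp add: mod_eq_dvd_iff[symmetric])
  have "l i0 dvd int m" using assms by (simp add: power2_eq_square)
  then have "l i0 dvd cmpl l i0 (\<lambda>k. y k mod int m) c \<longleftrightarrow> l i0 dvd cmpl l i0 y c" for c
    by (rule dvd_iff_of_dvd_diff[OF dvd_trans[OF _ d[of c]]])
  moreover have "int m dvd qform l (cmpl l i0 (\<lambda>k. y k mod int m)) - qform l (cmpl l i0 y)"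
    by (intro qform_cong_dvd d)
  then have "int m dvd qform l (cmpl l i0 (\<lambda>k. y k mod int m)) \<longleftrightarrow> int m dvd qform l (cmpl l i0 y)"
    by (rule dvd_iff_of_dvd_diff)
  ultimately show ?thesis unfolding hcond_def assms[symmetric] by simp
qed

text \<open>The factor \<open>M2\<close> is prime to \<open>l i0\<close>, so the scaling hidden in
  \<open>cmpl\<close> is invisible there and the integrality condition stays with
  \<open>M1\<close>.\<close>

lemma hcond_mult:
  assumes "coprime (int M2) (int M1 * (l i0)\<^sup>2)"
  shows "hcond l i0 (M1 * M2) y \<longleftrightarrow> hcond l i0 M1 y \<and> int M2 dvd qform l (cmpl l i0 y)"
proof -
  have "int (M1 * M2) * (l i0)\<^sup>2 = (int M1 * (l i0)\<^sup>2) * int M2" by simp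
  then have "int (M1 * M2) * (l i0)\<^sup>2 dvd z \<longleftrightarrow> int M1 * (l i0)\<^sup>2 dvd z \<and> int M2 dvd z" for z
  proof -
    have c: "coprime (int M1 * (l i0)\<^sup>2) (int M2)" using assms by (simp only: coprime_commute)
    show ?thesis unfolding \<open>int (M1 * M2) * (l i0)\<^sup>2 = _\<close>
    proof (intro iffI conjI)
      assume h: "int M1 * (l i0)\<^sup>2 * int M2 dvd z"
      show "int M1 * (l i0)\<^sup>2 dvd z" by (rule dvd_mult_left[OF h])
      show "int M2 dvd z" by (rule dvd_mult_right[OF h])
    qed (rule divides_mult[OF conjunct1 conjunct2 c])
  qed
  then show ?thesis unfolding hcond_def by blast
qed

text \<open>A form of Hensel's lemma without iteration: the difference of two values is
  \<open>(b + a * (u + v)) * (u - v)\<close> with a unit as first factor, so the polynomial is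
  injective on residues mod \<open>M\<close>, hence surjective, hence has a root.\<close>

lemma quadratic_root_mod:
  fixes M :: nat and a b c :: int
  assumes M: "M > 0" and cop: "\<And>u. coprime (b + a * u) (int M)"
  shows "\<exists>u\<in>{0..<int M}. int M dvd c + u * b + a * u\<^sup>2"
proof -
  let ?f = "\<lambda>u. (c + u * b + a * u\<^sup>2) mod int M"
  have inj: "inj_on ?f {0..<int M}"
  proof (rule inj_onI)
    fix u v assume uv: "u \<in> {0..<int M}" "v \<in> {0..<int M}" "?f u = ?f v"
    have "int M dvd (c + u * b + a * u\<^sup>2) - (c + v * b + a * v\<^sup>2)" using uv(3) by (simp only: mod_eq_dvd_iff)
    also have "(c + u * b + a * u\<^sup>2) - (c + v * b + a * v\<^sup>2) = (b + a * (u + v)) * (u - v)"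
      by (simp add: algebra_simps power2_eq_square)
    finally have "int M dvd u - v" using cop[of "u + v"] by (simp add: coprime_dvd_mult_right_iff coprime_commute)
    then have "u mod int M = v mod int M" by (simp only: mod_eq_dvd_iff)
    then show "u = v" using uv by simp
  qed
  have "?f ` {0..<int M} \<subseteq> {0..<int M}" using M by auto
  then have "?f ` {0..<int M} = {0..<int M}" using inj by (intro endo_inj_surj) auto
  moreover have "0 \<in> {0..<int M}" using M by simp
  ultimately obtain u where "u \<in> {0..<int M}" "?f u = 0" by (metis (no_types, lifting) imageE)
  then show ?thesis by (auto simp: mod_eq_0_iff_dvd)
qed

text \<open>Any \<open>y\<close> close to the approximate zero \<open>x\<close> is moved to a zero
  mod \<open>M\<close> along \<gamma>. Steps of size \<open>V * P\<close> balance the terms: all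
  three coefficients of the resulting quadratic polynomial in \<open>u\<close> are divisible by
  \<open>V\<^sup>2 * P\<close>. In the quotient the linear coefficient is congruent to
  \<open>b\<close> mod \<open>P\<close> and the quadratic one is divisible by \<open>P\<close>, so
  the hypothesis of \<open>quadratic_root_mod\<close> holds for every modulus dividing a power of
  \<open>P\<close>.\<close>

lemma hensel_shift:
  fixes x \<gamma> y :: "'s::finite \<times> 'd::finite \<Rightarrow> int" and V P M K :: nat
  assumes l0: "l i0 \<noteq> 0" and x: "\<And>j. (\<Sum>i\<in>UNIV. l i * x (i, j)) = 0" and g: "\<And>j. (\<Sum>i\<in>UNIV. l i * \<gamma> (i, j)) = 0"
    and b: "2 * bform l x \<gamma> = int V * b" "coprime b (int P)" and Q: "int (V\<^sup>2 * P) dvd qform l x"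
    and M: "M > 0" "M dvd P ^ K"
    and y: "\<And>c. \<bar>l i0\<bar> * int (V\<^sup>2 * P) dvd y c - x c"
  shows "\<exists>u\<in>{0..<int M}. hcond l i0 M (\<lambda>c. y c + (u * int (V * P)) * \<gamma> c)"
proof -
  define e where "e = int (V\<^sup>2 * P)"
  have cx: "cmpl l i0 x c = l i0 * x c" and cg: "cmpl l i0 \<gamma> c = l i0 * \<gamma> c" for c
    using cmpl_of_lin[of l x i0 c] cmpl_of_lin[of l \<gamma> i0 c] x g by auto
  have d: "l i0 * e dvd cmpl l i0 y c - l i0 * x c" for c
  proof -
    have "l i0 * e dvd cmpl l i0 y c - cmpl l i0 x c"
    proof (rule cmpl_cong_dvd)
      fix c
      have "\<bar>l i0 * e\<bar> dvd y c - x c" using y[of c] by (simp only: abs_mult e_def abs_of_nat)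
      then show "l i0 * e dvd y c - x c" by simp
    qed
    then show ?thesis by (simp add: cx)
  qed
  have "\<forall>c. \<exists>t. cmpl l i0 y c = l i0 * (x c + e * t)"
  proof
    fix c obtain t where "cmpl l i0 y c - l i0 * x c = l i0 * e * t" using d[of c] by (elim dvdE)
    then have "cmpl l i0 y c = l i0 * (x c + e * t)" by (simp add: algebra_simps)
    then show "\<exists>t. cmpl l i0 y c = l i0 * (x c + e * t)" by blast
  qed
  then obtain t where t: "\<And>c. cmpl l i0 y c = l i0 * (x c + e * t c)" by metis
  define X where "X = (\<lambda>c. x c + e * t c)"
  have dX: "e dvd X c - x c" for c by (simp add: X_def)
  obtain c where c: "qform l X = e * c"
  proof -
    have "e dvd qform l X - qform l x" by (intro qform_cong_dvd dX)
    then have "e dvd qform l X" using Q by (simp only: e_def dvd_iff_of_dvd_diff)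
    then show ?thesis using that by (elim dvdE)
  qed
  obtain k where k: "bform l X \<gamma> - bform l x \<gamma> = e * k"
    using bform_cong_dvd[of e X x l \<gamma>, OF dX] by (elim dvdE)
  define b' where "b' = b + int (V * P) * (2 * k)"
  have bX: "2 * bform l X \<gamma> = int V * b'"
    using k b(1) by (simp add: b'_def e_def power2_eq_square algebra_simps)
  have "coprime (b' + int P * qform l \<gamma> * u) (int M)" for u
  proof -
    have e: "b' + int P * qform l \<gamma> * u = (int V * (2 * k) + qform l \<gamma> * u) * int P + b"
      by (simp add: b'_def algebra_simps)
    have "gcd (int P) (b' + int P * qform l \<gamma> * u) = gcd (int P) b" unfolding e by (rule gcd_add_mult)
    also have "\<dots> = 1" using b(2) by (simp only: gcd.commute[of "int P" b] coprime_iff_gcd_eq_1)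
    finally have "coprime (b' + int P * qform l \<gamma> * u) (int P)"
      by (simp only: gcd.commute[of "int P"] coprime_iff_gcd_eq_1)
    then have "coprime (b' + int P * qform l \<gamma> * u) (int (P ^ K))" by simp
    moreover have "int M dvd int (P ^ K)" using M(2) by (simp only: int_dvd_int_iff)
    ultimately show ?thesis by (rule coprime_divisors[OF dvd_refl, rotated])
  qed
  from quadratic_root_mod[OF M(1) this]
  obtain u where u: "u \<in> {0..<int M}" "int M dvd c + u * b' + int P * qform l \<gamma> * u\<^sup>2" by blast
  let ?w = "\<lambda>c. y c + (u * int (V * P)) * \<gamma> c"
  have cw: "cmpl l i0 ?w = (\<lambda>c. l i0 * (X c + (u * int (V * P)) * \<gamma> c))"
    by (rule ext, simp only: cmpl_add t cg X_def) (simp add: algebra_simps)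
  have "qform l (\<lambda>c. X c + (u * int (V * P)) * \<gamma> c) = e * (c + u * b' + int P * qform l \<gamma> * u\<^sup>2)"
    unfolding qform_add bX c by (simp add: e_def power2_eq_square algebra_simps)
  then have "int M dvd qform l (\<lambda>c. X c + (u * int (V * P)) * \<gamma> c)" using u(2) by simp
  then have "hcond l i0 M ?w" unfolding hcond_def cw qform_scale by (simp add: mult.commute mult_dvd_mono)
  then show ?thesis using u by blast
qed

lemma card_residue_class_ge:
  fixes x :: "'n::finite \<Rightarrow> int"
  assumes "m > 0" "E > 0" "E dvd m"
  shows "(m div E) ^ CARD('n) \<le> card {y \<in> ibox m. \<forall>c. int E dvd y c - x c}"
proof -
  let ?f = "\<lambda>z c. x c mod int E + int E * z c"
  have mE: "int (m div E) * int E = int m" using assms by (metis dvd_div_mult_self of_nat_mult)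
  have "inj_on ?f (ibox (m div E))" using assms by (auto simp: inj_on_def fun_eq_iff)
  moreover have "?f ` ibox (m div E) \<subseteq> {y \<in> ibox m. \<forall>c. int E dvd y c - x c}"
  proof clarify
    fix z :: "'n \<Rightarrow> int" assume z: "z \<in> ibox (m div E)"
    have "0 \<le> ?f z c \<and> ?f z c < int m" for c
    proof -
      have zc: "0 \<le> z c" "z c + 1 \<le> int (m div E)" using z by (auto simp: ibox_def dest: spec[of _ c])
      then have "int E * (z c + 1) \<le> int E * int (m div E)" by (intro mult_left_mono) auto
      moreover have "0 \<le> x c mod int E" "x c mod int E < int E" using assms by auto
      moreover have "0 \<le> int E * z c" using zc by simp
      ultimately show ?thesis using mE by (simp add: algebra_simps)
    qed
    moreover have "int E dvd ?f z c - x c" for c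
    proof -
      have "?f z c - x c = int E * (z c - x c div int E)" by (simp add: algebra_simps minus_mod_eq_mult_div[symmetric])
      then show ?thesis by simp
    qed
    ultimately show "?f z \<in> ibox m \<and> (\<forall>c. int E dvd ?f z c - x c)" by (simp add: ibox_def)
  qed
  ultimately have "card (ibox (m div E) :: ('n \<Rightarrow> int) set) \<le> card {y \<in> ibox m. \<forall>c. int E dvd y c - x c}"
    by (intro card_inj_on_le) auto
  then show ?thesis by (simp add: card_ibox)
qed

text \<open>Double counting of pairs \<open>(y, u)\<close>: each \<open>y\<close> in one residue
  class mod \<open>E\<close> has a shift \<open>u\<close>, among \<open>M\<close> candidates, that
  satisfies \<open>hcond\<close>, while for fixed \<open>u\<close> the shift permutes the residues
  mod \<open>m\<close>. Relative to the number of residues mod \<open>m\<close>, the bound depends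
  on \<open>E\<close> alone and not on \<open>M\<close>.\<close>

lemma local_density_lower:
  fixes x \<gamma> :: "'s::finite \<times> 'd::finite \<Rightarrow> int" and V P M K :: nat
  assumes l0: "l i0 \<noteq> 0" and x: "\<And>j. (\<Sum>i\<in>UNIV. l i * x (i, j)) = 0" and g: "\<And>j. (\<Sum>i\<in>UNIV. l i * \<gamma> (i, j)) = 0"
    and b: "2 * bform l x \<gamma> = int V * b" "coprime b (int P)" and Q: "int (V\<^sup>2 * P) dvd qform l x"
    and M: "M > 0" "M dvd P ^ K" and m: "int m = int M * (l i0)\<^sup>2"
    and E: "int E = \<bar>l i0\<bar> * int (V\<^sup>2 * P)" "E > 0" "E dvd m"
  shows "real M * (\<Sum>y\<in>ibox m. of_bool (hcond l i0 M (y :: 's \<times> 'd \<Rightarrow> int))) \<ge> (real m / real E) ^ CARD('s \<times> 'd)"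
proof -
  have m0: "m > 0" using m M l0 by (metis of_nat_0_less_iff mult_pos_pos zero_less_power2)
  let ?A = "{y \<in> ibox m. \<forall>c. int E dvd y c - x c}"
  have fin: "finite ?A" by simp
  have "(real m / real E) ^ CARD('s \<times> 'd) = real ((m div E) ^ CARD('s \<times> 'd))"
    using E(3) by (simp add: real_of_nat_div)
  also have "\<dots> \<le> real (card ?A)" using card_residue_class_ge[OF m0 E(2,3), of x] by simp
  also have "\<dots> = (\<Sum>y\<in>?A. 1)" by simp
  also have "\<dots> \<le> (\<Sum>y\<in>?A. \<Sum>u\<in>{0..<int M}. of_bool (hcond l i0 M (\<lambda>c. y c + (u * int (V * P)) * \<gamma> c)))"
  proof (intro sum_mono)
    fix y assume "y \<in> ?A"
    then have yE: "int E dvd y c - x c" for c by blast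
    have "\<And>c. \<bar>l i0\<bar> * int (V\<^sup>2 * P) dvd y c - x c" unfolding E(1)[symmetric] by (rule yE)
    from hensel_shift[where V = V and P = P, OF l0 x g b Q M this]
    obtain u where u: "u \<in> {0..<int M}" "hcond l i0 M (\<lambda>c. y c + (u * int (V * P)) * \<gamma> c)" by blast
    have "(1::real) = of_bool (hcond l i0 M (\<lambda>c. y c + (u * int (V * P)) * \<gamma> c))" using u by simp
    also have "\<dots> \<le> (\<Sum>u\<in>{0..<int M}. of_bool (hcond l i0 M (\<lambda>c. y c + (u * int (V * P)) * \<gamma> c)))"
      using u(1) by (intro member_le_sum) auto
    finally show "1 \<le> (\<Sum>u\<in>{0..<int M}. of_bool (hcond l i0 M (\<lambda>c. y c + (u * int (V * P)) * \<gamma> c)) :: real)" .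
  qed
  also have "\<dots> \<le> (\<Sum>y\<in>ibox m. \<Sum>u\<in>{0..<int M}. of_bool (hcond l i0 M (\<lambda>c. y c + (u * int (V * P)) * \<gamma> c)))"
    by (intro sum_mono2) (auto intro: sum_nonneg)
  also have "\<dots> = (\<Sum>u\<in>{0..<int M}. \<Sum>y\<in>ibox m. of_bool (hcond l i0 M (\<lambda>c. y c + (u * int (V * P)) * \<gamma> c)))"
    by (rule sum.swap)
  also have "\<dots> = (\<Sum>u\<in>{0..<int M}. \<Sum>y\<in>ibox m. of_bool (hcond l i0 M (y :: 's \<times> 'd \<Rightarrow> int)))"
  proof (rule sum.cong[OF refl])
    fix u
    show "(\<Sum>y\<in>ibox m. of_bool (hcond l i0 M (\<lambda>c. y c + (u * int (V * P)) * \<gamma> c))) = (\<Sum>y\<in>ibox m. of_bool (hcond l i0 M (y :: 's \<times> 'd \<Rightarrow> int)) :: real)"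
      by (rule sum_ibox_shift[where f = "\<lambda>y :: 's \<times> 'd \<Rightarrow> int. of_bool (hcond l i0 M y)" and w = "\<lambda>c. (u * int (V * P)) * \<gamma> c", OF m0]) (simp add: hcond_mod[of m M l i0, OF m])
  qed
  also have "\<dots> = real M * (\<Sum>y\<in>ibox m. of_bool (hcond l i0 M (y :: 's \<times> 'd \<Rightarrow> int)))" by simp
  finally show ?thesis .
qed

section \<open>From \<open>p\<close>-adic solutions to integer points satisfying a Hensel
  condition\<close>

lemma hom_add_pow_int:
  assumes "ring_hom_ring R S h" "x \<in> carrier R"
  shows "h (add_pow R (k::int) x) = add_pow S k (h x)"
proof -
  interpret ring_hom_ring R S h by fact
  interpret A: group_hom "add_monoid R" "add_monoid S" h by (rule a_group_hom)
  show ?thesis unfolding add_pow_def by (rule A.hom_int_pow) (use assms(2) in simp)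
qed

lemma padic_Cauchy_ring_simps:
  "carrier (padic_Cauchy_ring p) = {X. padic_Cauchy p X}"
  "mult (padic_Cauchy_ring p) X Y = (\<lambda>n. X n * Y n)"
  "one (padic_Cauchy_ring p) = (\<lambda>_. 1)"
  "zero (padic_Cauchy_ring p) = (\<lambda>_. 0)"
  "add (padic_Cauchy_ring p) X Y = (\<lambda>n. X n + Y n)"
  by (simp_all add: padic_Cauchy_ring_def)

lemma padic_add_pow:
  assumes p: "prime p" and X: "padic_Cauchy p X"
  shows "add_pow (padic_Cauchy_ring p) (k::int) X = (\<lambda>n. of_int k * X n)"
proof -
  interpret R: cring "padic_Cauchy_ring p" by (rule cring_padic_Cauchy_ring[OF p])
  have nat: "add_pow (padic_Cauchy_ring p) (m::nat) X = (\<lambda>n. of_nat m * X n)" for m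
    by (induction m) (simp_all add: add_pow_def padic_Cauchy_ring_simps algebra_simps)
  show ?thesis
  proof (cases "k \<ge> 0")
    case True
    then have "add_pow (padic_Cauchy_ring p) k X = add_pow (padic_Cauchy_ring p) (nat k) X"
      unfolding add_pow_def int_pow_def2 by simp
    then show ?thesis using nat[of "nat k"] True by simp
  next
    case False
    then have "add_pow (padic_Cauchy_ring p) k X = \<ominus>\<^bsub>padic_Cauchy_ring p\<^esub> add_pow (padic_Cauchy_ring p) (nat (- k)) X"
      unfolding add_pow_def int_pow_def2 a_inv_def by simp
    also have "\<dots> = (\<lambda>n. of_int k * X n)"
    proof (rule R.minus_equality)
      have c: "padic_Cauchy p (\<lambda>n. of_int k * X n)" for k using padic_Cauchy_mult[OF p padic_Cauchy_const X] .
      show "(\<lambda>n. of_int k * X n) \<in> carrier (padic_Cauchy_ring p)" using c by (simp add: padic_Cauchy_ring_simps)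
      show "add_pow (padic_Cauchy_ring p) (nat (- k)) X \<in> carrier (padic_Cauchy_ring p)"
        using c[of "- k"] False unfolding nat by (simp add: padic_Cauchy_ring_simps)
      show "(\<lambda>n. of_int k * X n) \<oplus>\<^bsub>padic_Cauchy_ring p\<^esub> add_pow (padic_Cauchy_ring p) (nat (- k)) X = \<zero>\<^bsub>padic_Cauchy_ring p\<^esub>"
        using False unfolding nat by (simp add: padic_Cauchy_ring_simps)
    qed
    finally show ?thesis .
  qed
qed

lemma padic_Cauchy_sum:
  "prime p \<Longrightarrow> (\<And>i. i \<in> A \<Longrightarrow> padic_Cauchy p (f i)) \<Longrightarrow> padic_Cauchy p (\<lambda>n. \<Sum>i\<in>A. f i n)"
  by (induction A rule: infinite_finite_induct) (simp_all add: padic_Cauchy_const padic_Cauchy_add)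

lemma padic_null_sum:
  "prime p \<Longrightarrow> (\<And>i. i \<in> A \<Longrightarrow> f i \<in> padic_null p) \<Longrightarrow> (\<lambda>n. \<Sum>i\<in>A. f i n) \<in> padic_null p"
  by (induction A rule: infinite_finite_induct) (auto simp: padic_null_add, simp_all add: padic_null_def)

lemma padic_finsum:
  assumes p: "prime p" and A: "finite A" and f: "\<And>i. i \<in> A \<Longrightarrow> padic_Cauchy p (f i)"
  shows "finsum (padic_Cauchy_ring p) f A = (\<lambda>n. \<Sum>i\<in>A. f i n)"
proof -
  interpret R: cring "padic_Cauchy_ring p" by (rule cring_padic_Cauchy_ring[OF p])
  show ?thesis using A f
  proof (induction A rule: finite_induct)
    case (insert i A)
    have "f \<in> A \<rightarrow> carrier (padic_Cauchy_ring p)" "f i \<in> carrier (padic_Cauchy_ring p)"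
      using insert.prems by (auto simp: padic_Cauchy_ring_simps)
    then have "finsum (padic_Cauchy_ring p) f (insert i A) = f i \<oplus>\<^bsub>padic_Cauchy_ring p\<^esub> finsum (padic_Cauchy_ring p) f A"
      using insert.hyps by (intro R.finsum_insert)
    also have "finsum (padic_Cauchy_ring p) f A = (\<lambda>n. \<Sum>i\<in>A. f i n)" using insert.prems by (intro insert.IH) auto
    finally show ?case using insert.hyps by (simp add: padic_Cauchy_ring_simps)
  qed (simp add: padic_Cauchy_ring_simps)
qed

text \<open>If all variables coincide, the gradient of the quadratic form is the combination of the
  \<open>d\<close> linear gradients with coefficients \<open>2 * \<xi> j\<close>. The contrapositive
  is the form in which nonsingularity enters: two variables differ in some coordinate.\<close>

lemma padic_linear_dependence_rank:
  fixes x :: "'s::finite \<times> 'd::finite \<Rightarrow> padic"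
  assumes p: "prime p" and K: "K = padic_field p" and xc: "\<And>c. x c \<in> carrier K"
    and eq: "\<And>i i' j. x (i, j) = x (i', j)"
  shows "matrix_rank_over K (lin_quad_jacobian_over K lam x) \<le> CARD('d)"
proof -
  interpret K: field K unfolding K by (rule field_padic_field[OF p])
  let ?A = "lin_quad_jacobian_over K lam x"
  let ?V = "K.func_space (UNIV :: ('s \<times> 'd) set)"
  interpret V: vectorspace K ?V
    unfolding vectorspace_def by (intro conjI K.func_space_is_module K.field_axioms)
  have Vs: "carrier ?V = UNIV \<rightarrow>\<^sub>E carrier K" "add ?V f g = (\<lambda>v. f v \<oplus>\<^bsub>K\<^esub> g v)" "smult ?V c f = (\<lambda>v. c \<otimes>\<^bsub>K\<^esub> f v)"
    "zero ?V = (\<lambda>v. \<zero>\<^bsub>K\<^esub>)" for f g c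
    by (simp_all add: K.func_space_def restrict_def)
  define B where "B = ?A ` range Some"
  have BV: "B \<subseteq> carrier ?V" "?A None \<in> carrier ?V"
    using xc by (auto simp: B_def Vs lin_quad_jacobian_over_def)
  have fB: "finite B" by (simp add: B_def)
  have sub: "submodule K (V.span B) ?V" by (rule V.span_is_submodule[OF BV(1)])
  have inB: "B \<subseteq> V.span B" by (rule V.in_own_span[OF BV(1)])
  define \<xi> where "\<xi> j = x (undefined, j)" for j
  have x\<xi>: "x c = \<xi> (snd c)" for c using eq[of "fst c" "snd c" undefined] by (simp add: \<xi>_def)
  have \<xi>c: "\<xi> j \<in> carrier K" for j using xc by (simp add: \<xi>_def)
  \<comment> \<open>The part of the quadratic gradient supported on the coordinates in
    \<open>J\<close>; one coordinate is added at a time, each being a multiple of one linear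
    gradient.\<close>
  let ?r = "\<lambda>J c. if snd c \<in> J then add_pow K (2 * lam $ fst c) (\<xi> (snd c)) else \<zero>\<^bsub>K\<^esub>"
  have rJ: "?r J \<in> V.span B" if "finite J" for J using that
  proof (induction J rule: finite_induct)
    case empty
    show ?case using submodule.zero_closed[OF sub] by (simp add: Vs)
  next
    case (insert j J)
    define a where "a = add_pow K (2::int) (\<xi> j)"
    have ac: "a \<in> carrier K" using \<xi>c by (simp add: a_def)
    have "smult ?V a (?A (Some j)) \<in> V.span B"
      using inB by (intro submodule.smult_closed[OF sub] ac) (auto simp: B_def)
    then have "add ?V (?r J) (smult ?V a (?A (Some j))) \<in> V.span B"
      by (intro submodule.m_closed[OF sub] insert.IH)
    also have "add ?V (?r J) (smult ?V a (?A (Some j))) = ?r (insert j J)"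
    proof
      fix c :: "'s \<times> 'd"
      have e: "a \<otimes>\<^bsub>K\<^esub> add_pow K (k::int) \<one>\<^bsub>K\<^esub> = add_pow K (2 * k) (\<xi> j)" for k
      proof -
        have "a \<otimes>\<^bsub>K\<^esub> add_pow K k \<one>\<^bsub>K\<^esub> = add_pow K k a" using ac by (simp add: K.add_pow_rdistr_int)
        also have "\<dots> = add_pow K (2 * k) (\<xi> j)" unfolding a_def using \<xi>c K.add.int_pow_pow by simp
        finally show ?thesis .
      qed
      show "add ?V (?r J) (smult ?V a (?A (Some j))) c = ?r (insert j J) c"
        unfolding Vs lin_quad_jacobian_over_def using insert.hyps ac \<xi>c by (auto simp: e)
    qed
    finally show ?case .
  qed
  have "?A None = ?r UNIV"
    by (rule ext) (simp add: lin_quad_jacobian_over_def x\<xi>)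
  also have "?r UNIV \<in> V.span B" by (rule rJ) simp
  finally have AN: "?A None \<in> V.span B" .
  have "range ?A \<subseteq> V.span B"
  proof (rule image_subsetI)
    fix r show "?A r \<in> V.span B"
    proof (cases r)
      case (Some j)
      then have "?A r \<in> B" by (simp add: B_def)
      then show ?thesis using inB by (rule subsetD[rotated])
    qed (use AN in simp)
  qed
  then have "V.span (range ?A) \<subseteq> V.span B" by (rule V.span_is_subset[OF _ sub])
  moreover have "V.span B \<subseteq> V.span (range ?A)" by (rule V.span_is_monotone) (auto simp: B_def)
  ultimately have sp: "V.span (range ?A) = V.span B" by simp
  have "subspace K (V.span B) ?V" by (rule V.span_is_subspace[OF BV(1)])
  then interpret W: vectorspace K "?V\<lparr>carrier := V.span B\<rparr>" by (rule V.subspace_is_vs)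
  have "W.span B = V.span B" by (rule V.span_li_not_depend(1)[OF inB sub])
  then have "W.dim \<le> card B" using fB inB by (intro W.gen_ge_dim) auto
  also have "card B \<le> card (range (Some :: 'd \<Rightarrow> 'd option))" unfolding B_def by (rule card_image_le) simp
  also have "\<dots> = CARD('d)" by (simp add: card_image)
  finally show ?thesis unfolding matrix_rank_over_def Let_def sp .
qed

text \<open>Passing to representatives turns each equation in the completion into membership in the
  null ideal, where only arithmetic of rational sequences is left. The last clause is what remains
  of nonsingularity.\<close>

lemma padic_solution_sequences:
  fixes x :: "'s::finite \<times> 'd::finite \<Rightarrow> padic"
  assumes p: "prime p" and ns: "nonsingular_padic_solution p lam x"
  shows "\<exists>X :: 's \<times> 'd \<Rightarrow> nat \<Rightarrow> rat. (\<forall>c. padic_Cauchy p (X c)) \<and>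
    (\<forall>j. (\<lambda>n. \<Sum>i\<in>UNIV. of_int (lam $ i) * X (i, j) n) \<in> padic_null p) \<and>
    (\<lambda>n. qform (($) lam) (\<lambda>c. X c n)) \<in> padic_null p \<and>
    (\<exists>i i' j. (\<lambda>n. X (i, j) n - X (i', j) n) \<notin> padic_null p)"
proof -
  let ?R = "padic_Cauchy_ring p" and ?K = "padic_field p" and ?I = "padic_null p"
  interpret R: cring ?R by (rule cring_padic_Cauchy_ring[OF p])
  interpret I: ideal ?I ?R by (rule ideal_padic_null[OF p])
  interpret H: ring_hom_cring ?R ?K "a_r_coset ?R ?I"
    unfolding padic_field_def by (rule I.rcos_ring_hom_cring[OF R.cring_axioms])
  have Hr: "ring_hom_ring ?R ?K (a_r_coset ?R ?I)" unfolding padic_field_def by (rule I.rcos_ring_hom_ring)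
  let ?\<pi> = "a_r_coset ?R ?I"
  have xc: "x c \<in> carrier ?K" for c using ns unfolding nonsingular_padic_solution_def by blast
  have sys: "lin_quad_system_over ?K lam x r = \<zero>\<^bsub>?K\<^esub>" for r
    using ns unfolding nonsingular_padic_solution_def by blast
  have "x c \<in> (\<Union>Y\<in>carrier ?R. {?\<pi> Y})" for c
    using xc[of c] unfolding padic_field_def FactRing_def A_RCOSETS_def' by (simp only: partial_object.select_convs)
  then have "\<exists>Y\<in>carrier ?R. x c = ?\<pi> Y" for c by blast
  then obtain X where X: "\<And>c. X c \<in> carrier ?R" "\<And>c. x c = ?\<pi> (X c)" by metis
  have XC: "padic_Cauchy p (X c)" for c using X(1)[of c] by (simp add: padic_Cauchy_ring_simps)
  have zero: "\<zero>\<^bsub>?K\<^esub> = ?I" unfolding padic_field_def FactRing_def by (simp only: ring.select_convs)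
  have null: "Y \<in> ?I" if "Y \<in> carrier ?R" "?\<pi> Y = \<zero>\<^bsub>?K\<^esub>" for Y
  proof -
    have "Y \<in> ?\<pi> Y" using that(1) by (rule I.a_rcos_self)
    then show ?thesis using that(2) by (simp only: zero)
  qed
  have cC: "padic_Cauchy p (\<lambda>n. of_int k * Y n)" if "padic_Cauchy p Y" for k Y
    using padic_Cauchy_mult[OF p padic_Cauchy_const that] .
  have lin: "(\<lambda>n. \<Sum>i\<in>UNIV. of_int (lam $ i) * X (i, j) n) \<in> ?I" for j
  proof (rule null)
    show c: "(\<lambda>n. \<Sum>i\<in>UNIV. of_int (lam $ i) * X (i, j) n) \<in> carrier ?R"
      unfolding padic_Cauchy_ring_simps mem_Collect_eq by (intro padic_Cauchy_sum[OF p] cC XC)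
    have e1: "(\<lambda>n. \<Sum>i\<in>UNIV. of_int (lam $ i) * X (i, j) n) = finsum ?R (\<lambda>i. add_pow ?R (lam $ i) (X (i, j))) UNIV"
      unfolding padic_add_pow[OF p XC] by (rule padic_finsum[OF p finite cC[OF XC], symmetric])
    have "?\<pi> (\<lambda>n. \<Sum>i\<in>UNIV. of_int (lam $ i) * X (i, j) n) = ?\<pi> (finsum ?R (\<lambda>i. add_pow ?R (lam $ i) (X (i, j))) UNIV)"
      by (rule arg_cong[OF e1])
    also have "\<dots> = finsum ?K (?\<pi> \<circ> (\<lambda>i. add_pow ?R (lam $ i) (X (i, j)))) UNIV"
      using X(1) by (intro H.hom_finsum) auto
    also have "?\<pi> \<circ> (\<lambda>i. add_pow ?R (lam $ i) (X (i, j))) = (\<lambda>i. add_pow ?K (lam $ i) (x (i, j)))"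
      by (simp add: fun_eq_iff hom_add_pow_int[OF Hr X(1)] X(2))
    also have "finsum ?K \<dots> UNIV = \<zero>\<^bsub>?K\<^esub>"
      using sys[of "Some j"] by (simp only: lin_quad_system_over_def option.case)
    finally show "?\<pi> (\<lambda>n. \<Sum>i\<in>UNIV. of_int (lam $ i) * X (i, j) n) = \<zero>\<^bsub>?K\<^esub>" .
  qed
  have quad: "(\<lambda>n. \<Sum>i\<in>UNIV. of_int (lam $ i) * (\<Sum>j\<in>UNIV. (X (i, j) n)\<^sup>2)) \<in> ?I"
  proof (rule null)
    have sq: "padic_Cauchy p (\<lambda>n. (X c n)\<^sup>2)" for c using padic_Cauchy_mult[OF p XC XC] by (simp add: power2_eq_square)
    have sqs: "padic_Cauchy p (\<lambda>n. \<Sum>j\<in>UNIV. (X (i, j) n)\<^sup>2)" for i by (intro padic_Cauchy_sum[OF p] sq)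
    show c: "(\<lambda>n. \<Sum>i\<in>UNIV. of_int (lam $ i) * (\<Sum>j\<in>UNIV. (X (i, j) n)\<^sup>2)) \<in> carrier ?R"
      unfolding padic_Cauchy_ring_simps mem_Collect_eq by (intro padic_Cauchy_sum[OF p] cC sqs)
    have sqR: "X c [^]\<^bsub>?R\<^esub> (2::nat) = (\<lambda>n. (X c n)\<^sup>2)" for c
      unfolding numeral_2_eq_2 by (simp add: padic_Cauchy_ring_simps)
    have in2: "X c [^]\<^bsub>?R\<^esub> (2::nat) \<in> carrier ?R" for c by (rule R.nat_pow_closed[OF X(1)])
    have fs: "finsum ?R (\<lambda>j. X (i, j) [^]\<^bsub>?R\<^esub> (2::nat)) UNIV = (\<lambda>n. \<Sum>j\<in>UNIV. (X (i, j) n)\<^sup>2)" for i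
      unfolding sqR by (rule padic_finsum[OF p finite sq])
    have fsc: "finsum ?R (\<lambda>j. X (i, j) [^]\<^bsub>?R\<^esub> (2::nat)) UNIV \<in> carrier ?R" for i
      using in2 by (intro R.finsum_closed) auto
    have e1: "(\<lambda>n. \<Sum>i\<in>UNIV. of_int (lam $ i) * (\<Sum>j\<in>UNIV. (X (i, j) n)\<^sup>2)) =
        finsum ?R (\<lambda>i. add_pow ?R (lam $ i) (finsum ?R (\<lambda>j. X (i, j) [^]\<^bsub>?R\<^esub> (2::nat)) UNIV)) UNIV"
      unfolding fs padic_add_pow[OF p sqs] by (rule padic_finsum[OF p finite cC[OF sqs], symmetric])
    have "?\<pi> (\<lambda>n. \<Sum>i\<in>UNIV. of_int (lam $ i) * (\<Sum>j\<in>UNIV. (X (i, j) n)\<^sup>2)) =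
        ?\<pi> (finsum ?R (\<lambda>i. add_pow ?R (lam $ i) (finsum ?R (\<lambda>j. X (i, j) [^]\<^bsub>?R\<^esub> (2::nat)) UNIV)) UNIV)"
      by (rule arg_cong[OF e1])
    also have "\<dots> = finsum ?K (?\<pi> \<circ> (\<lambda>i. add_pow ?R (lam $ i) (finsum ?R (\<lambda>j. X (i, j) [^]\<^bsub>?R\<^esub> (2::nat)) UNIV))) UNIV"
      using fsc by (intro H.hom_finsum) auto
    also have "?\<pi> \<circ> (\<lambda>i. add_pow ?R (lam $ i) (finsum ?R (\<lambda>j. X (i, j) [^]\<^bsub>?R\<^esub> (2::nat)) UNIV))
        = (\<lambda>i. add_pow ?K (lam $ i) (finsum ?K (\<lambda>j. x (i, j) [^]\<^bsub>?K\<^esub> (2::nat)) UNIV))"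
    proof
      fix i
      have "?\<pi> (finsum ?R (\<lambda>j. X (i, j) [^]\<^bsub>?R\<^esub> (2::nat)) UNIV) = finsum ?K (?\<pi> \<circ> (\<lambda>j. X (i, j) [^]\<^bsub>?R\<^esub> (2::nat))) UNIV"
        using in2 by (intro H.hom_finsum) auto
      also have "?\<pi> \<circ> (\<lambda>j. X (i, j) [^]\<^bsub>?R\<^esub> (2::nat)) = (\<lambda>j. x (i, j) [^]\<^bsub>?K\<^esub> (2::nat))"
        using X(1) by (simp add: fun_eq_iff X(2) numeral_2_eq_2)
      finally show "(?\<pi> \<circ> (\<lambda>i. add_pow ?R (lam $ i) (finsum ?R (\<lambda>j. X (i, j) [^]\<^bsub>?R\<^esub> (2::nat)) UNIV))) i
        = add_pow ?K (lam $ i) (finsum ?K (\<lambda>j. x (i, j) [^]\<^bsub>?K\<^esub> (2::nat)) UNIV)"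
        by (simp add: hom_add_pow_int[OF Hr fsc])
    qed
    also have "finsum ?K \<dots> UNIV = \<zero>\<^bsub>?K\<^esub>"
      using sys[of None] by (simp only: lin_quad_system_over_def option.case)
    finally show "?\<pi> (\<lambda>n. \<Sum>i\<in>UNIV. of_int (lam $ i) * (\<Sum>j\<in>UNIV. (X (i, j) n)\<^sup>2)) = \<zero>\<^bsub>?K\<^esub>" .
  qed
  have q: "(\<Sum>i\<in>UNIV. of_int (lam $ i) * (\<Sum>j\<in>UNIV. (X (i, j) n)\<^sup>2)) = qform (($) lam) (\<lambda>c. X c n)" for n
    unfolding qform_def sum_pairs sum_distrib_left by (subst sum.swap) simp
  have "\<exists>i i' j. (\<lambda>n. X (i, j) n - X (i', j) n) \<notin> ?I"
  proof (rule ccontr)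
    assume "\<not> ?thesis"
    then have d: "(\<lambda>n. X (i, j) n - X (i', j) n) \<in> ?I" for i i' j by blast
    have "x (i, j) = x (i', j)" for i i' j
    proof -
      have "X (i, j) = (\<lambda>n. X (i, j) n - X (i', j) n) \<oplus>\<^bsub>?R\<^esub> X (i', j)" by (simp add: padic_Cauchy_ring_simps)
      moreover have "(\<lambda>n. X (i, j) n - X (i', j) n) \<oplus>\<^bsub>?R\<^esub> X (i', j) \<in> ?\<pi> (X (i', j))"
        by (rule R.a_rcosI[OF d I.a_subset X(1)])
      ultimately have "X (i, j) \<in> ?\<pi> (X (i', j))" by simp
      from R.a_repr_independence[OF this X(1) I.a_subgroup] show ?thesis unfolding X(2) by simp
    qed
    from padic_linear_dependence_rank[where x = x and lam = lam, OF p refl xc this]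
    moreover have "matrix_rank_over ?K (lin_quad_jacobian_over ?K lam x) = CARD('d) + 1"
      using ns unfolding nonsingular_padic_solution_def by (elim conjE)
    ultimately show False by linarith
  qed
  then show ?thesis using XC lin quad unfolding q by blast
qed

lemma common_denominator:
  fixes f :: "'n::finite \<Rightarrow> rat"
  shows "\<exists>D>0. \<exists>z. \<forall>c. of_int (z c) = of_int D * f c"
proof -
  have "\<exists>D>0. \<forall>c\<in>A. \<exists>z. of_int z = of_int D * f c" if "finite A" for A using that
  proof (induction A rule: finite_induct)
    case empty
    show ?case by (rule exI[of _ 1]) simp
  next
    case (insert a A)
    then obtain D where D: "D > 0" "\<forall>c\<in>A. \<exists>z. of_int z = of_int D * f c" by blast
    obtain u v where uv: "quotient_of (f a) = (u, v)" by (cases "quotient_of (f a)")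
    have v: "v > 0" using uv quotient_of_denom_pos by blast
    have fa: "f a = of_int u / of_int v" using quotient_of_div[OF uv] .
    have "\<exists>z. of_int z = of_int (D * v) * f c" if c: "c \<in> insert a A" for c
    proof (cases "c = a")
      case True
      have "of_int (D * u) = of_int (D * v) * f c" using v by (simp add: True fa)
      then show ?thesis by blast
    next
      case False
      then obtain z where "of_int z = of_int D * f c" using D(2) c by blast
      then have "of_int (z * v) = of_int (D * v) * f c" by simp
      then show ?thesis by blast
    qed
    moreover have "D * v > 0" using D v by simp
    ultimately show ?case by blast
  qed
  from this[of UNIV] obtain D where D: "D > 0" "\<forall>c. \<exists>z. of_int z = of_int D * f c" by auto
  from choice[OF D(2)] obtain z where "\<forall>c. of_int (z c) = of_int D * f c" by (elim exE)
  then show ?thesis using D(1) by blast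
qed

lemma of_int_qform: "of_int (qform l z) = qform l (\<lambda>c. of_int (z c))"
  by (simp add: qform_def)

lemma padic_null_scale:
  assumes "prime p" "X \<in> padic_null p" "padic_Cauchy p Y" shows "(\<lambda>n. Y n * X n) \<in> padic_null p"
  using padic_null_mult[OF assms] by (simp only: mult.commute)

lemma padic_null_zero: "(\<lambda>n. 0) \<in> padic_null p"
  by (simp add: padic_null_def)

text \<open>The strict inequality is Hensel's criterion for the direction used in
  \<open>local_datum_prime\<close>. The rational approximations satisfy the linear equations up to
  null sequences; moving the error into row \<open>i0\<close> makes them exact and alters the form
  and the chosen difference only by null sequences. Far along the sequence the form is small while
  the difference stays away from 0. Both sides of the inequality are homogeneous of degree 2, so
  denominators can be cleared.\<close>

lemma padic_integer_point:
  fixes x :: "'s::finite \<times> 'd::finite \<Rightarrow> padic"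
  assumes p: "prime p" and nz: "\<forall>i. lam $ i \<noteq> 0" and ns: "nonsingular_padic_solution p lam x"
  defines "l \<equiv> ($) lam"
  shows "\<exists>(z :: 's \<times> 'd \<Rightarrow> int) i i' j. (\<forall>j. (\<Sum>i\<in>UNIV. l i * z (i, j)) = 0) \<and> z (i, j) \<noteq> z (i', j) \<and>
    padic_abs p (of_int (qform l z)) < (padic_abs p (of_int (2 * l i * l i' * (z (i, j) - z (i', j)))))\<^sup>2"
proof -
  obtain X :: "'s \<times> 'd \<Rightarrow> nat \<Rightarrow> rat" and i i' j where XC: "\<And>c. padic_Cauchy p (X c)"
    and lin: "\<And>j. (\<lambda>n. \<Sum>i\<in>UNIV. of_int (l i) * X (i, j) n) \<in> padic_null p"
    and quad: "(\<lambda>n. qform l (\<lambda>c. X c n)) \<in> padic_null p"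
    and ne: "(\<lambda>n. X (i, j) n - X (i', j) n) \<notin> padic_null p"
    using padic_solution_sequences[OF p ns] unfolding l_def by (elim exE conjE) (drule spec, assumption | blast)+
  define i0 :: 's where "i0 = undefined"
  have l0: "l k \<noteq> 0" for k using nz by (simp add: l_def)
  \<comment> \<open>The defect of the linear equation, divided by \<open>l i0\<close> so that
    subtracting it in row \<open>i0\<close> cancels it exactly.\<close>
  define E where "E j n = (\<Sum>i\<in>UNIV. of_int (l i) * X (i, j) n) * inverse (of_int (l i0))" for j n
  have EN: "(\<lambda>n. E j n) \<in> padic_null p" for j
    unfolding E_def by (rule padic_null_mult[OF p lin padic_Cauchy_const])
  define Z where "Z n c = (if fst c = i0 then E (snd c) n else 0)" for n and c :: "'s \<times> 'd"
  have ZN: "(\<lambda>n. Z n c) \<in> padic_null p" for c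
    by (cases "fst c = i0") (simp_all add: Z_def EN padic_null_zero)
  define r where "r n c = X c n + (-1) * Z n c" for n c
  have rlin: "(\<Sum>k\<in>UNIV. of_int (l k) * r n (k, j)) = 0" for n j
  proof -
    have "(\<Sum>k\<in>UNIV. of_int (l k) * r n (k, j)) = (\<Sum>k\<in>UNIV. of_int (l k) * X (k, j) n) - (\<Sum>k\<in>UNIV. if k = i0 then of_int (l k) * E j n else 0)"
      unfolding sum_subtractf[symmetric] by (intro sum.cong refl) (simp add: r_def Z_def right_diff_distrib)
    also have "(\<Sum>k\<in>UNIV. if k = i0 then of_int (l k) * E j n else 0) = of_int (l i0) * E j n" by simp
    finally show ?thesis using l0[of i0] by (simp add: E_def)
  qed
  have Qr: "(\<lambda>n. qform l (r n)) \<in> padic_null p"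
  proof -
    have b: "(\<lambda>n. bform l (\<lambda>c. X c n) (Z n)) \<in> padic_null p"
      unfolding bform_def by (intro padic_null_sum padic_null_scale p ZN padic_Cauchy_mult padic_Cauchy_const XC)
    have q: "(\<lambda>n. qform l (Z n)) \<in> padic_null p"
      unfolding qform_def power2_eq_square
      by (intro padic_null_sum padic_null_scale p ZN padic_null_Cauchy padic_Cauchy_const)
    have "(\<lambda>n. qform l (\<lambda>c. X c n) + (-1) * (2 * bform l (\<lambda>c. X c n) (Z n)) + (-1)\<^sup>2 * qform l (Z n)) \<in> padic_null p"
      by (intro padic_null_add padic_null_scale p quad b q padic_Cauchy_const)
    moreover have "qform l (r n) = qform l (\<lambda>c. X c n) + (-1) * (2 * bform l (\<lambda>c. X c n) (Z n)) + (-1)\<^sup>2 * qform l (Z n)" for n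
      unfolding r_def by (rule qform_add)
    ultimately show ?thesis by simp
  qed
  define D where "D n = r n (i, j) - r n (i', j)" for n
  have rC: "padic_Cauchy p (\<lambda>n. r n c)" for c
    unfolding r_def by (intro padic_Cauchy_add padic_Cauchy_mult padic_Cauchy_const p XC padic_null_Cauchy ZN)
  have DC: "padic_Cauchy p D"
    unfolding D_def diff_conv_add_uminus by (intro padic_Cauchy_add padic_Cauchy_uminus p rC)
  have DN: "D \<notin> padic_null p"
  proof
    assume "D \<in> padic_null p"
    then have "(\<lambda>n. D n + (Z n (i, j) + (-1) * Z n (i', j))) \<in> padic_null p"
      by (intro padic_null_add padic_null_scale p ZN padic_Cauchy_const)
    moreover have "D n + (Z n (i, j) + (-1) * Z n (i', j)) = X (i, j) n - X (i', j) n" for n by (simp add: D_def r_def)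
    ultimately show False using ne by simp
  qed
  obtain e M where e: "e > 0" and M: "\<And>n. n \<ge> M \<Longrightarrow> padic_abs p (D n) \<ge> e"
    using padic_not_null_away_from_0[OF p DC DN] by blast
  define w where "w = 2 * l i * l i'"
  have w0: "padic_abs p (of_int w) > 0" using l0 by (intro padic_abs_pos p) (simp add: w_def)
  have "(padic_abs p (of_int w) * e)\<^sup>2 > 0" using w0 e by simp
  moreover have "(\<lambda>n. padic_abs p (qform l (r n))) \<longlonglongrightarrow> 0"
    using Qr by (simp only: padic_null_def mem_Collect_eq)
  ultimately obtain M' where "\<forall>n\<ge>M'. norm (padic_abs p (qform l (r n)) - 0) < (padic_abs p (of_int w) * e)\<^sup>2"
    using LIMSEQ_D by blast
  then have M': "padic_abs p (qform l (r n)) < (padic_abs p (of_int w) * e)\<^sup>2" if "n \<ge> M'" for n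
    using that by simp
  define n where "n = max M M'"
  have 1: "padic_abs p (qform l (r n)) < (padic_abs p (of_int w * D n))\<^sup>2"
  proof -
    have "padic_abs p (qform l (r n)) < (padic_abs p (of_int w) * e)\<^sup>2" by (rule M') (simp add: n_def)
    also have "\<dots> \<le> (padic_abs p (of_int w) * padic_abs p (D n))\<^sup>2"
      using M[of n] e w0 by (intro power_mono mult_left_mono) (auto simp: n_def)
    finally show ?thesis by (simp only: padic_abs_mult[OF p])
  qed
  obtain N z where N: "N > 0" and z: "\<And>c. of_int (z c) = of_int N * r n c"
    using common_denominator[of "r n"] by blast
  have Npos: "padic_abs p (of_int N) > 0" using N by (intro padic_abs_pos p) simp
  have zl: "(\<Sum>k\<in>UNIV. l k * z (k, j)) = 0" for j
  proof -
    have "rat_of_int (\<Sum>k\<in>UNIV. l k * z (k, j)) = of_int N * (\<Sum>k\<in>UNIV. of_int (l k) * r n (k, j))"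
      by (simp add: z sum_distrib_left mult_ac)
    then show ?thesis unfolding rlin by (simp only: mult_zero_right of_int_eq_0_iff)
  qed
  have zq: "of_int (qform l z) = (of_int N)\<^sup>2 * qform l (r n)"
    unfolding of_int_qform z by (rule qform_scale)
  have zD: "of_int (z (i, j) - z (i', j)) = of_int N * D n"
    by (simp add: z D_def right_diff_distrib)
  have "D n \<noteq> 0" using M[of n] e by (auto simp: n_def)
  then have "rat_of_int (z (i, j) - z (i', j)) \<noteq> 0" unfolding zD using N by simp
  then have zne: "z (i, j) \<noteq> z (i', j)" by auto
  have "padic_abs p (of_int (qform l z)) = (padic_abs p (of_int N))\<^sup>2 * padic_abs p (qform l (r n))"
    unfolding zq power2_eq_square padic_abs_mult[OF p] ..
  also have "\<dots> < (padic_abs p (of_int N))\<^sup>2 * (padic_abs p (of_int w * D n))\<^sup>2"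
    using 1 Npos by (intro mult_strict_left_mono) auto
  also have "\<dots> = (padic_abs p (of_int w * (of_int N * D n)))\<^sup>2"
    by (simp only: padic_abs_mult[OF p] power_mult_distrib mult_ac)
  also have "of_int w * (of_int N * D n) = of_int (2 * l i * l i' * (z (i, j) - z (i', j)))"
    unfolding zD[symmetric] w_def by (simp only: of_int_mult)
  finally show ?thesis using zl zne by blast
qed

text \<open>What is needed to lift at all primes dividing \<open>P\<close> simultaneously: an
  approximate zero \<open>x\<close>, a direction \<gamma> in the linear subspace, and
  \<open>V\<close> measuring how far the derivative along \<gamma> is from a unit. Integer vectors
  and divisibility replace \<open>p\<close>-adic numbers from here on, so that several primes can be
  merged.\<close>

definition local_datum :: "('s::finite \<Rightarrow> int) \<Rightarrow> 'd::finite itself \<Rightarrow> nat \<Rightarrow> nat \<Rightarrow> bool" where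
  "local_datum l (_ :: 'd itself) V P \<longleftrightarrow> (\<exists>(x :: 's \<times> 'd \<Rightarrow> int) \<gamma> b.
     (\<forall>j. (\<Sum>i\<in>UNIV. l i * x (i, j)) = 0) \<and> (\<forall>j. (\<Sum>i\<in>UNIV. l i * \<gamma> (i, j)) = 0) \<and>
     2 * bform l x \<gamma> = int V * b \<and> coprime b (int P) \<and> int (V\<^sup>2 * P) dvd qform l x)"

lemma padic_abs_of_int:
  "prime p \<Longrightarrow> a \<noteq> 0 \<Longrightarrow> padic_abs p (of_int a) = real p powi (- int (multiplicity (int p) a))"
  using padic_abs_Fract[of p a 1] by (simp add: of_int_rat)

text \<open>The direction \<gamma> changes two variables in one coordinate with weights
  \<open>l i'\<close> and \<open>- l i\<close>, which stays in the linear subspace; the derivative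
  of the form along it is \<open>w\<close>, nonzero because the two entries differ. With
  \<open>v\<close> the valuation of \<open>w\<close>, the strict inequality becomes divisibility of
  the form by \<open>p ^ (2 * v + 1)\<close>.\<close>

lemma local_datum_prime:
  fixes x :: "'s::finite \<times> 'd::finite \<Rightarrow> padic"
  assumes p: "prime p" and nz: "\<forall>i. lam $ i \<noteq> 0" and ns: "nonsingular_padic_solution p lam x"
  shows "\<exists>v. local_datum (($) lam) TYPE('d) (p ^ v) p"
proof -
  define l where "l = ($) lam"
  obtain z :: "'s \<times> 'd \<Rightarrow> int" and i i' j where zl: "\<forall>j. (\<Sum>i\<in>UNIV. l i * z (i, j)) = 0" and zne: "z (i, j) \<noteq> z (i', j)"
    and lt: "padic_abs p (of_int (qform l z)) < (padic_abs p (of_int (2 * l i * l i' * (z (i, j) - z (i', j)))))\<^sup>2"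
    using padic_integer_point[OF p nz ns] unfolding l_def by blast
  define w where "w = 2 * l i * l i' * (z (i, j) - z (i', j))"
  have w0: "w \<noteq> 0" using nz zne by (simp add: w_def l_def)
  define \<gamma> where "\<gamma> c = (if c = (i, j) then l i' else 0) - (if c = (i', j) then l i else 0)" for c
  have gl: "(\<Sum>k\<in>UNIV. l k * \<gamma> (k, j')) = 0" for j'
    by (cases "j' = j") (simp_all add: \<gamma>_def right_diff_distrib sum_subtractf if_distrib[of "\<lambda>a. _ * a"] cong: if_cong)
  have "bform l z \<gamma> = l i * z (i, j) * l i' - l i' * z (i', j) * l i"
    by (simp add: bform_def \<gamma>_def right_diff_distrib sum_subtractf if_distrib[of "\<lambda>a. _ * a"] cong: if_cong)
  then have bw: "2 * bform l z \<gamma> = w" by (simp add: w_def algebra_simps)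
  define v where "v = multiplicity (int p) w"
  have pp: "prime (int p)" using p by simp
  obtain b where b: "w = int p ^ v * b" "\<not> int p dvd b"
    using multiplicity_decompose'[OF w0, of "int p"] pp unfolding v_def by (metis not_prime_unit)
  have cop: "coprime b (int p)" using prime_imp_coprime[OF pp b(2)] by (simp only: coprime_commute)
  have Q: "int ((p ^ v)\<^sup>2 * p) dvd qform l z"
  proof (cases "qform l z = 0")
    case False
    have "real p powi (- int (multiplicity (int p) (qform l z))) < (real p powi (- int v))\<^sup>2"
      using lt unfolding w_def[symmetric] padic_abs_of_int[OF p False] padic_abs_of_int[OF p w0] v_def .
    also have "\<dots> = real p powi (- int (2 * v))" 
    proof -
      have "- int (2 * v) = - int v + - int v" by simp
      moreover have "real p \<noteq> 0" using prime_gt_0_nat[OF p] by simp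
      ultimately show ?thesis by (simp only: power2_eq_square power_int_add simp_thms)
    qed
    finally have "- int (multiplicity (int p) (qform l z)) < - int (2 * v)"
      using prime_gt_1_nat[OF p] power_int_increasing[of "- int (2 * v)" "- int (multiplicity (int p) (qform l z))" "real p"] by linarith
    then have "2 * v + 1 \<le> multiplicity (int p) (qform l z)" by linarith
    then have "int p ^ (2 * v + 1) dvd qform l z" by (rule multiplicity_dvd')
    then show ?thesis by (simp add: power_mult[symmetric] mult.commute)
  qed simp
  show ?thesis unfolding local_datum_def l_def[symmetric]
  proof (intro exI conjI)
    show "\<forall>j. (\<Sum>i\<in>UNIV. l i * z (i, j)) = 0" by (rule zl)
    show "\<forall>j. (\<Sum>i\<in>UNIV. l i * \<gamma> (i, j)) = 0" using gl by blast
    show "2 * bform l z \<gamma> = int (p ^ v) * b" unfolding bw using b(1) by simp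
  qed (rule cop, rule Q)
qed

lemma coprime_mult_add_int:
  fixes z P :: int assumes "coprime z P" shows "coprime (t * P + z) P"
proof -
  have "gcd P (t * P + z) = gcd P z" by (rule gcd_add_mult)
  then show ?thesis using assms by (simp only: coprime_iff_gcd_eq_1 gcd.commute[of _ P])
qed

lemma qform_comb: "qform l (\<lambda>c. a * x c + a' * x' c) = a\<^sup>2 * qform l x + a * a' * (2 * bform l x x') + a'\<^sup>2 * qform l x'"
  unfolding qform_def bform_def by (simp add: power2_eq_square algebra_simps sum.distrib sum_distrib_left)

lemma bform_comb: "bform l (\<lambda>c. a * x c + a' * x' c) (\<lambda>c. a * g c + a' * g' c)
    = a\<^sup>2 * bform l x g + a * a' * (bform l x g' + bform l x' g) + a'\<^sup>2 * bform l x' g'"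
  unfolding bform_def by (simp add: power2_eq_square algebra_simps sum.distrib sum_distrib_left)

text \<open>Chinese remaindering of the point and the direction with the same idempotents:
  \<open>a\<close> is 1 mod \<open>m\<close> and 0 mod \<open>m'\<close>, and \<open>a'\<close> the
  reverse. The derivative \<open>W\<close> must be divisible by \<open>V * V'\<close> with a
  cofactor prime to \<open>P * P'\<close>; writing \<open>W\<close> once for each modulus exhibits
  both.\<close>

lemma local_datum_merge:
  fixes l :: "'s::finite \<Rightarrow> int"
  assumes d: "local_datum l TYPE('d::finite) V P" and d': "local_datum l TYPE('d) V' P'"
    and cop: "coprime (int (V\<^sup>2 * P)) (int (V'\<^sup>2 * P'))" and V0: "V > 0" "V' > 0"
  shows "local_datum l TYPE('d) (V * V') (P * P')"
proof -
  obtain x \<gamma> :: "'s \<times> 'd \<Rightarrow> int" and b where x: "\<And>j. (\<Sum>i\<in>UNIV. l i * x (i, j)) = 0" "\<And>j. (\<Sum>i\<in>UNIV. l i * \<gamma> (i, j)) = 0"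
     "2 * bform l x \<gamma> = int V * b" "coprime b (int P)" "int (V\<^sup>2 * P) dvd qform l x"
    using d unfolding local_datum_def by blast
  obtain x' \<gamma>' :: "'s \<times> 'd \<Rightarrow> int" and b' where x': "\<And>j. (\<Sum>i\<in>UNIV. l i * x' (i, j)) = 0" "\<And>j. (\<Sum>i\<in>UNIV. l i * \<gamma>' (i, j)) = 0"
     "2 * bform l x' \<gamma>' = int V' * b'" "coprime b' (int P')" "int (V'\<^sup>2 * P') dvd qform l x'"
    using d' unfolding local_datum_def by blast
  define m m' where "m = int (V\<^sup>2 * P)" and "m' = int (V'\<^sup>2 * P')"
  obtain u t where ut: "u * m + t * m' = 1"
    using bezout_int[of m m'] cop unfolding m_def m'_def by (auto simp: coprime_iff_gcd_eq_1)
  define a a' where "a = t * m'" and "a' = u * m"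
  define X \<Gamma> where "X c = a * x c + a' * x' c" and "\<Gamma> c = a * \<gamma> c + a' * \<gamma>' c" for c
  have XL: "(\<Sum>i\<in>UNIV. l i * X (i, j)) = 0" for j
  proof -
    have "(\<Sum>i\<in>UNIV. l i * X (i, j)) = a * (\<Sum>i\<in>UNIV. l i * x (i, j)) + a' * (\<Sum>i\<in>UNIV. l i * x' (i, j))"
      by (simp add: X_def sum_distrib_left sum.distrib algebra_simps)
    then show ?thesis by (simp add: x(1) x'(1))
  qed
  have GL: "(\<Sum>i\<in>UNIV. l i * \<Gamma> (i, j)) = 0" for j
  proof -
    have "(\<Sum>i\<in>UNIV. l i * \<Gamma> (i, j)) = a * (\<Sum>i\<in>UNIV. l i * \<gamma> (i, j)) + a' * (\<Sum>i\<in>UNIV. l i * \<gamma>' (i, j))"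
      by (simp add: \<Gamma>_def sum_distrib_left sum.distrib algebra_simps)
    then show ?thesis by (simp add: x(2) x'(2))
  qed
  have QX: "qform l X = a\<^sup>2 * qform l x + a * a' * (2 * bform l x x') + a'\<^sup>2 * qform l x'"
    unfolding X_def by (rule qform_comb)
  have da: "m' dvd a" "m dvd a'" by (simp_all add: a_def a'_def)
  have "m dvd a\<^sup>2 * qform l x" by (rule dvd_mult[OF x(5)[folded m_def]])
  moreover have "m dvd a * a' * (2 * bform l x x')" by (rule dvd_mult2[OF dvd_mult[OF da(2)]])
  moreover have "m dvd a'\<^sup>2 * qform l x'" unfolding power2_eq_square by (rule dvd_mult2[OF dvd_mult[OF da(2)]])
  ultimately have "m dvd qform l X" unfolding QX by (intro dvd_add)
  moreover have "m' dvd qform l X"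
  proof -
    have "m' dvd a\<^sup>2 * qform l x" unfolding power2_eq_square by (rule dvd_mult2[OF dvd_mult[OF da(1)]])
    moreover have "m' dvd a * a' * (2 * bform l x x')" by (rule dvd_mult2[OF dvd_mult2[OF da(1)]])
    moreover have "m' dvd a'\<^sup>2 * qform l x'" by (rule dvd_mult[OF x'(5)[folded m'_def]])
    ultimately show ?thesis unfolding QX by (intro dvd_add)
  qed
  ultimately have mm: "m * m' dvd qform l X" using cop by (intro divides_mult) (simp_all add: m_def m'_def)
  define S where "S = 2 * (bform l x \<gamma>' + bform l x' \<gamma>)"
  define W where "W = 2 * bform l X \<Gamma>"
  have W: "W = a\<^sup>2 * (int V * b) + a * a' * S + a'\<^sup>2 * (int V' * b')"
    unfolding W_def X_def \<Gamma>_def bform_comb x(3)[symmetric] x'(3)[symmetric] S_def by (simp add: algebra_simps)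
  define k where "k = a * u * int V * S + a' * u * int V * int V' * b'"
  define k' where "k' = a' * t * int V' * S + a * t * int V' * int V * b"
  have W1: "W = int V * (k * int P + a\<^sup>2 * b)"
    unfolding W k_def a'_def m_def by (simp add: power2_eq_square algebra_simps)
  have W2: "W = int V' * (k' * int P' + a'\<^sup>2 * b')"
    unfolding W k'_def a_def m'_def by (simp add: power2_eq_square algebra_simps)
  have "coprime a (int P)"
  proof -
    have "a = (- u * (int V)\<^sup>2) * int P + 1" using ut by (simp add: a_def m_def algebra_simps)
    then show ?thesis using coprime_mult_add_int[of 1 "int P" "- u * (int V)\<^sup>2"] by simp
  qed
  then have c1: "coprime (k * int P + a\<^sup>2 * b) (int P)" using x(4) by (intro coprime_mult_add_int) simp
  have "coprime a' (int P')"
  proof -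
    have "a' = (- t * (int V')\<^sup>2) * int P' + 1" using ut by (simp add: a'_def m'_def algebra_simps)
    then show ?thesis using coprime_mult_add_int[of 1 "int P'" "- t * (int V')\<^sup>2"] by simp
  qed
  then have c2: "coprime (k' * int P' + a'\<^sup>2 * b') (int P')" using x'(4) by (intro coprime_mult_add_int) simp
  have "coprime (int V) (int V')" using cop by (simp add: power2_eq_square)
  then have "int V * int V' dvd W" by (rule divides_mult[OF dvdI[OF W1] dvdI[OF W2]])
  then obtain B where B: "W = int V * int V' * B" by (elim dvdE)
  have "k * int P + a\<^sup>2 * b = int V' * B" using W1 V0 unfolding B by simp
  then have cB1: "coprime B (int P)" using c1 by simp
  have "k' * int P' + a'\<^sup>2 * b' = int V * B" using W2 V0 unfolding B by simp
  then have cB2: "coprime B (int P')" using c2 by simp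
  show ?thesis unfolding local_datum_def
  proof (intro exI conjI)
    show "\<forall>j. (\<Sum>i\<in>UNIV. l i * X (i, j)) = 0" "\<forall>j. (\<Sum>i\<in>UNIV. l i * \<Gamma> (i, j)) = 0" using XL GL by blast+
    show "2 * bform l X \<Gamma> = int (V * V') * B" using B by (simp add: W_def)
    show "coprime B (int (P * P'))" using cB1 cB2 by simp
    show "int ((V * V')\<^sup>2 * (P * P')) dvd qform l X"
      using mm by (simp add: m_def m'_def power_mult_distrib mult_ac)
  qed
qed

text \<open>The clause that \<open>V\<close> divides a power of the product drives the induction,
  since it makes the next prime coprime to \<open>V\<close>; it also lets moduli built from
  \<open>V\<close> divide a power of the product later.\<close>

lemma local_datum_exists:
  fixes l :: "'s::finite \<Rightarrow> int"
  assumes "finite A" "\<And>p. p \<in> A \<Longrightarrow> prime p" "\<And>p. p \<in> A \<Longrightarrow> \<exists>v. local_datum l TYPE('d::finite) (p ^ v) p"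
  shows "\<exists>V k. V > 0 \<and> V dvd (\<Prod>A) ^ k \<and> local_datum l TYPE('d) V (\<Prod>A)"
  using assms
proof (induction A rule: finite_induct)
  case empty
  have "local_datum l TYPE('d) 1 1" unfolding local_datum_def
    by (rule exI[of _ "\<lambda>_. 0"], rule exI[of _ "\<lambda>_. 0"], rule exI[of _ 0]) (simp add: bform_def qform_def)
  then show ?case by (intro exI[of _ 1]) simp
next
  case (insert p A)
  then obtain V k where V: "V > 0" "V dvd (\<Prod>A) ^ k" "local_datum l TYPE('d) V (\<Prod>A)" by blast
  have p: "prime p" using insert.prems(1) by simp
  obtain v where v: "local_datum l TYPE('d) (p ^ v) p" using insert.prems(2) by blast
  have "coprime p q" if "q \<in> A" for q
    using p insert.prems(1)[of q] insert.hyps that by (intro primes_coprime) auto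
  then have c: "coprime p (\<Prod>A)" by (intro prod_coprime_right)
  have "coprime (p ^ v) V"
  proof -
    have "coprime (p ^ v) ((\<Prod>A) ^ k)" using c by simp
    then show ?thesis using V(2) by (rule coprime_divisors[OF dvd_refl, rotated])
  qed
  moreover have "coprime p V"
  proof -
    have "coprime p ((\<Prod>A) ^ k)" using c by simp
    then show ?thesis using V(2) by (rule coprime_divisors[OF dvd_refl, rotated])
  qed
  ultimately have "coprime ((p ^ v)\<^sup>2 * p) (V\<^sup>2 * \<Prod>A)" using c by simp
  then have cop: "coprime (int ((p ^ v)\<^sup>2 * p)) (int (V\<^sup>2 * \<Prod>A))" by (simp only: coprime_int_iff)
  have "p ^ v > 0" using p by (simp add: prime_gt_0_nat)
  from local_datum_merge[OF v V(3) cop this V(1)]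
  have "local_datum l TYPE('d) (p ^ v * V) (\<Prod>(insert p A))" using insert.hyps by simp
  moreover have "p ^ v * V > 0" using V p by (simp add: prime_gt_0_nat)
  moreover have "p ^ v * V dvd (\<Prod>(insert p A)) ^ (v + k)"
  proof -
    have "p ^ v dvd (p * \<Prod>A) ^ v" "V dvd (p * \<Prod>A) ^ k"
      using V(2) by (simp_all add: power_mult_distrib)
    then have "p ^ v * V dvd (p * \<Prod>A) ^ v * (p * \<Prod>A) ^ k" by (rule mult_dvd_mono)
    then show ?thesis using insert.hyps by (simp add: power_add)
  qed
  ultimately show ?case by blast
qed

subsection \<open>Lower bound for the real density\<close>

lemma sum_option_UNIV: "(\<Sum>r\<in>UNIV. f r) = f None + (\<Sum>j\<in>UNIV. f (Some j))"
  for f :: "'d::finite option \<Rightarrow> 'a::comm_monoid_add"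
  by (simp add: UNIV_option_conv sum.reindex)

text \<open>The real form of \<open>padic_linear_dependence_rank\<close>: if all variables coincide,
  the entries of \<open>u\<close> are the coefficients of a nontrivial relation between the rows of
  the Jacobian, with coefficient 1 at the quadratic row.\<close>

lemma nonsingular_real_solution_neq:
  fixes x :: "real ^ ('s::finite \<times> 'd::finite)"
  assumes "nonsingular_real_solution lam x"
  shows "\<exists>i i' j. x $ (i, j) \<noteq> x $ (i', j)"
proof (rule ccontr)
  assume "\<not> ?thesis"
  then have eq: "x $ (i, j) = x $ (i', j)" for i i' j by blast
  define J where "J = jacobian (lin_quad_system lam) (at x)"
  have J: "J $ r $ c = (case r of Some j \<Rightarrow> (if snd c = j then of_int (lam $ fst c) else 0)
      | None \<Rightarrow> of_int (2 * lam $ fst c) * x $ c)" for r c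
    unfolding J_def jacobian_lin_quad_system by simp
  have "rank (transpose J) = CARD('d option)"
    using assms by (simp add: rank_transpose nonsingular_real_solution_def J_def card_UNIV_option)
  then have inj: "inj ((*v) (transpose J))" by (simp only: full_rank_injective)
  define u :: "real ^ 'd option" where "u = (\<chi> r. case r of None \<Rightarrow> 1 | Some j \<Rightarrow> - 2 * x $ (undefined, j))"
  have "transpose J *v u = 0"
  proof (rule vec_eq_iff[THEN iffD2], rule allI)
    fix c :: "'s \<times> 'd"
    obtain i j where c: "c = (i, j)" by (cases c)
    have "(transpose J *v u) $ c = (\<Sum>r\<in>UNIV. J $ r $ c * u $ r)"
      by (simp add: matrix_vector_mult_def transpose_def)
    also have "\<dots> = of_int (2 * lam $ i) * x $ (i, j) + (\<Sum>j'\<in>UNIV. (if j = j' then of_int (lam $ i) else 0) * (- 2 * x $ (undefined, j')))"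
      unfolding sum_option_UNIV by (simp add: J u_def c cong: if_cong)
    also have "(\<Sum>j'\<in>UNIV. (if j = j' then of_int (lam $ i) else 0) * (- 2 * x $ (undefined, j'))) =
        (\<Sum>j'\<in>UNIV. if j = j' then of_int (lam $ i) * (- 2 * x $ (undefined, j')) else 0)"
      by (rule sum.cong) auto
    also have "\<dots> = of_int (lam $ i) * (- 2 * x $ (undefined, j))"
      by (simp only: sum.delta'[OF finite] UNIV_I if_True)
    also have "of_int (2 * lam $ i) * x $ (i, j) + of_int (lam $ i) * (- 2 * x $ (undefined, j)) = 0"
      using eq[of i j undefined] by simp
    finally show "(transpose J *v u) $ c = 0 $ c" by simp
  qed
  then have "u = 0" using inj by (metis injD matrix_vector_mult_0_right)
  then have "u $ None = 0" by simp
  then show False by (simp add: u_def)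
qed

text \<open>The real counterpart of \<open>cmpl\<close>, with the division by \<open>l i0\<close>
  carried out; row \<open>i0\<close> of \<open>r\<close> is again a dummy.\<close>

definition rx :: "('s::finite \<Rightarrow> int) \<Rightarrow> 's \<Rightarrow> real ^ ('s \<times> 'd::finite) \<Rightarrow> 's \<times> 'd \<Rightarrow> real" where
  "rx l i0 r c = (if fst c = i0 then - (\<Sum>i\<in>UNIV - {i0}. of_int (l i) * r $ (i, snd c)) / of_int (l i0) else r $ c)"

definition rbox :: "('s::finite \<Rightarrow> int) \<Rightarrow> 's \<Rightarrow> (real ^ ('s \<times> 'd::finite)) set" where
  "rbox l i0 = {r. (\<forall>c. 0 < r $ c \<and> r $ c \<le> 1) \<and> (\<forall>j. 0 < rx l i0 r (i0, j) \<and> rx l i0 r (i0, j) \<le> 1)}"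

text \<open>For positive \<open>T\<close> it has height \<open>T\<close>, base \<open>2 / T\<close>
  and integral 1, so that \<open>rdens\<close> is a smoothed delta function on the zero set of the
  form.\<close>

definition tent :: "real \<Rightarrow> real \<Rightarrow> real" where "tent T u = T * max 0 (1 - T * \<bar>u\<bar>)"

definition rdens :: "('s::finite \<Rightarrow> int) \<Rightarrow> 's \<Rightarrow> real \<Rightarrow> real ^ ('s \<times> 'd::finite) \<Rightarrow> real" where
  "rdens l i0 T r = indicator (rbox l i0) r * tent T (qform l (rx l i0 r))"

lemma continuous_rx: "continuous_on UNIV (\<lambda>r. rx l i0 r c)"
  unfolding rx_def by (cases "fst c = i0") (auto intro!: continuous_intros simp: divide_inverse)

lemma continuous_qform_rx: "continuous_on UNIV (\<lambda>r. qform l (rx l i0 r))"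
  unfolding qform_def by (intro continuous_intros continuous_rx)

lemma continuous_bform_rx: "continuous_on UNIV (\<lambda>r. bform l (rx l i0 r) \<gamma>)"
  unfolding bform_def by (intro continuous_intros continuous_rx)

lemma continuous_nth: "continuous_on UNIV (\<lambda>r :: real ^ 'n. r $ c)"
  by (intro continuous_intros)

lemma rbox_borel: "(rbox l i0 :: (real ^ ('s::finite \<times> 'd::finite)) set) \<in> sets borel"
proof -
  have slab: "{r. 0 < f r \<and> f r \<le> 1} \<in> sets borel" if "continuous_on UNIV f" for f :: "real ^ ('s \<times> 'd) \<Rightarrow> real"
  proof -
    have "{r. 0 < f r \<and> f r \<le> 1} = {r. 0 < f r} \<inter> {r. f r \<le> 1}" by auto
    also have "\<dots> \<in> sets borel"
      by (intro sets.Int borel_open borel_closed open_Collect_less closed_Collect_le that continuous_on_const)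
    finally show ?thesis .
  qed
  have coord: "{r :: real ^ ('s \<times> 'd). 0 < r $ c \<and> r $ c \<le> 1} \<in> sets borel" for c by (rule slab[OF continuous_nth])
  have row: "{r :: real ^ ('s \<times> 'd). 0 < rx l i0 r (i0, j) \<and> rx l i0 r (i0, j) \<le> 1} \<in> sets borel" for j
    by (rule slab[OF continuous_rx])
  have eq: "rbox l i0 = (\<Inter>c. {r :: real ^ ('s \<times> 'd). 0 < r $ c \<and> r $ c \<le> 1}) \<inter> (\<Inter>j. {r. 0 < rx l i0 r (i0, j) \<and> rx l i0 r (i0, j) \<le> 1})"
    unfolding rbox_def by blast
  show ?thesis unfolding eq by (intro sets.Int sets.finite_INT finite UNIV_not_empty coord row)
qed

lemma rdens_borel: "rdens l i0 T \<in> borel_measurable borel"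
proof -
  note [measurable] = rbox_borel[of l i0] borel_measurable_continuous_onI[OF continuous_qform_rx[of l i0]]
  show ?thesis unfolding rdens_def[abs_def] tent_def by measurable
qed

lemma rx_add:
  fixes \<gamma> :: "'s::finite \<times> 'd::finite \<Rightarrow> real"
  assumes l0: "l i0 \<noteq> 0" and g: "\<And>j. (\<Sum>i\<in>UNIV. of_int (l i) * \<gamma> (i, j)) = 0"
  shows "rx l i0 (r + t *\<^sub>R (\<chi> c. \<gamma> c)) = (\<lambda>c. rx l i0 r c + t * \<gamma> c)"
proof
  fix c :: "'s \<times> 'd"
  show "rx l i0 (r + t *\<^sub>R (\<chi> c. \<gamma> c)) c = rx l i0 r c + t * \<gamma> c"
  proof (cases "fst c = i0")
    case True
    then obtain j where c: "c = (i0, j)" by (cases c) auto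
    have "(\<Sum>i\<in>UNIV. of_int (l i) * \<gamma> (i, j)) = of_int (l i0) * \<gamma> (i0, j) + (\<Sum>i\<in>UNIV - {i0}. of_int (l i) * \<gamma> (i, j))"
      by (rule sum.remove) auto
    then have s: "(\<Sum>i\<in>UNIV - {i0}. of_int (l i) * \<gamma> (i, j)) = - (of_int (l i0) * \<gamma> (i0, j))" using g[of j] by simp
    have "(\<Sum>i\<in>UNIV - {i0}. of_int (l i) * (r + t *\<^sub>R (\<chi> c. \<gamma> c)) $ (i, j)) =
        (\<Sum>i\<in>UNIV - {i0}. of_int (l i) * r $ (i, j)) + t * (\<Sum>i\<in>UNIV - {i0}. of_int (l i) * \<gamma> (i, j))"
      by (simp add: algebra_simps sum.distrib sum_distrib_left)
    then show ?thesis unfolding rx_def c s using l0 by (simp add: field_simps)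
  qed (simp add: rx_def)
qed

lemma rx_of_lin:
  fixes r :: "real ^ ('s::finite \<times> 'd::finite)"
  assumes l0: "l i0 \<noteq> 0" and g: "\<And>j. (\<Sum>i\<in>UNIV. of_int (l i) * r $ (i, j)) = 0"
  shows "rx l i0 r c = r $ c"
proof -
  have "rx l i0 (0 + 1 *\<^sub>R (\<chi> c. r $ c)) = (\<lambda>c. rx l i0 0 c + 1 * r $ c)" by (rule rx_add[OF l0 g])
  moreover have "rx l i0 (0 :: real ^ ('s \<times> 'd)) c = 0" by (simp add: rx_def)
  ultimately show ?thesis by (simp add: vec_lambda_eta)
qed

text \<open>At distance \<delta> from 0 the linear term dominates the constant and the quadratic
  term together, so the polynomial changes sign on the interval.\<close>

lemma quadratic_root_near:
  fixes Q B q b \<delta> :: real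
  assumes B: "\<bar>B\<bar> \<ge> b / 2" and b: "b > 0" "\<delta> > 0" and q: "\<delta> * \<bar>q\<bar> \<le> b / 2" and Q: "\<bar>Q\<bar> < \<delta> * b / 2"
  shows "\<exists>t. \<bar>t\<bar> \<le> \<delta> \<and> Q + t * (2 * B) + t\<^sup>2 * q = 0"
proof -
  let ?f = "\<lambda>t. Q + t * (2 * B) + t\<^sup>2 * q"
  have "\<delta> * (\<delta> * \<bar>q\<bar>) \<le> \<delta> * (b / 2)" using q b by (intro mult_left_mono) auto
  then have q2: "\<bar>\<delta>\<^sup>2 * q\<bar> \<le> \<delta> * b / 2" by (simp add: abs_mult power2_eq_square)
  have B2: "\<delta> * (b / 2) \<le> \<delta> * \<bar>B\<bar>" using B b by (intro mult_left_mono) auto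
  have cont: "continuous_on {- \<delta>..\<delta>} ?f" by (intro continuous_intros)
  show ?thesis
  proof (cases "B \<ge> 0")
    case True
    then have "?f (- \<delta>) \<le> 0" "0 \<le> ?f \<delta>" using q2 B2 Q by (auto simp: abs_le_iff abs_less_iff)
    then obtain t where "- \<delta> \<le> t" "t \<le> \<delta>" "?f t = 0" using IVT'[of ?f "- \<delta>" 0 \<delta>] cont b by auto
    then show ?thesis by (intro exI[of _ t]) auto
  next
    case False
    then have "?f \<delta> \<le> 0" "0 \<le> ?f (- \<delta>)" using q2 B2 Q by (auto simp: abs_le_iff abs_less_iff)
    then obtain t where "- \<delta> \<le> t" "t \<le> \<delta>" "?f t = 0" using IVT2'[of ?f \<delta> 0 "- \<delta>"] cont b by auto
    then show ?thesis by (intro exI[of _ t]) auto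
  qed
qed

lemma rdens_integrable: "T \<ge> 0 \<Longrightarrow> integrable lborel (rdens l i0 T :: real ^ ('s::finite \<times> 'd::finite) \<Rightarrow> real)"
proof -
  assume T: "T \<ge> 0"
  have "integrable lborel (\<lambda>r. T * indicator (cbox (0 :: real ^ ('s \<times> 'd)) (\<chi> k. 1)) r)"
    by (intro integrable_mult_right integrable_real_indicator emeasure_bounded_finite bounded_cbox) simp
  then show ?thesis
  proof (rule Bochner_Integration.integrable_bound)
    show "(rdens l i0 T :: real ^ ('s \<times> 'd) \<Rightarrow> real) \<in> borel_measurable lborel" using rdens_borel by simp
    show "AE r in lborel. norm (rdens l i0 T r) \<le> norm (T * indicator (cbox (0 :: real ^ ('s \<times> 'd)) (\<chi> k. 1)) r)"
    proof (rule AE_I2)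
      fix r :: "real ^ ('s \<times> 'd)"
      have "T * max 0 (1 - T * \<bar>u\<bar>) \<le> T * 1" for u using T by (intro mult_left_mono) auto
      then have "\<bar>tent T u\<bar> \<le> T" for u using T by (simp add: tent_def)
      moreover have "r \<in> cbox 0 (\<chi> k. 1)" if "r \<in> rbox l i0"
        using that by (auto simp: rbox_def mem_box_cart less_imp_le)
      ultimately show "norm (rdens l i0 T r) \<le> norm (T * indicator (cbox (0 :: real ^ ('s \<times> 'd)) (\<chi> k. 1)) r)"
        using T by (auto simp: rdens_def indicator_def)
    qed
  qed
qed

text \<open>A covering argument replaces the implicit function theorem. Near a rescaled solution
  every \<open>r\<close> reaches the zero set of the form by a shift along \<open>g\<close> with
  parameter at most \<delta>; rounding the parameter to a multiple of \<kappa>, of order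
  \<open>1 / T\<close>, lands in the set \<open>S\<close> on which the tent is at least
  \<open>T / 2\<close>. A fixed ball is therefore covered by a number of translates of
  \<open>S\<close> of order \<open>T\<close>, and \<open>T\<close> times the volume of
  \<open>S\<close> is bounded below.\<close>

lemma real_density_lower:
  fixes x :: "real ^ ('s::finite \<times> 'd::finite)"
  assumes nz: "\<forall>i. lam $ i \<noteq> 0" and pos: "\<forall>c. x $ c > 0" and ns: "nonsingular_real_solution lam x"
  defines "l \<equiv> ($) lam"
  shows "\<exists>c>0. \<exists>T0. \<forall>T\<ge>T0. integral\<^sup>L lborel (rdens l i0 T :: real ^ ('s \<times> 'd) \<Rightarrow> real) \<ge> c"
proof -
  have l0: "l i \<noteq> 0" for i using nz by (simp add: l_def)
  have sys: "lin_quad_system lam x = 0" using ns by (simp add: nonsingular_real_solution_def)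
  have xl: "(\<Sum>i\<in>UNIV. of_int (l i) * x $ (i, j)) = 0" for j
    using arg_cong[OF sys, of "\<lambda>v. v $ Some j"] by (simp add: lin_quad_system_def l_def)
  have "(\<Sum>i\<in>UNIV. \<Sum>j\<in>UNIV. of_int (l i) * (x $ (i, j))\<^sup>2) = 0"
    using arg_cong[OF sys, of "\<lambda>v. v $ None"] by (simp add: lin_quad_system_def l_def sum_distrib_left)
  then have xq: "qform l (\<lambda>c. x $ c) = 0" unfolding qform_def sum_pairs by (subst sum.swap) simp
  obtain i i' j where ne: "x $ (i, j) \<noteq> x $ (i', j)" using nonsingular_real_solution_neq[OF ns] by blast
  \<comment> \<open>Dividing by \<open>K\<close> puts the positive solution strictly inside the unit
    cube; both equations are homogeneous and persist.\<close>
  define K where "K = 1 + (\<Sum>c\<in>UNIV. x $ c)"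
  have xK: "x $ c < K" for c
  proof -
    have "x $ c \<le> (\<Sum>c\<in>UNIV. x $ c)" using pos by (intro member_le_sum) (auto intro: less_imp_le)
    then show ?thesis by (simp add: K_def)
  qed
  have K: "K > 0" using xK[of undefined] pos by (meson less_trans)
  define \<rho>0 :: "real ^ ('s \<times> 'd)" where "\<rho>0 = x /\<^sub>R K"
  have \<rho>n: "\<rho>0 $ c = inverse K * x $ c" for c by (simp add: \<rho>0_def)
  have \<rho>l: "(\<Sum>i\<in>UNIV. of_int (l i) * \<rho>0 $ (i, j)) = 0" for j
  proof -
    have "(\<Sum>i\<in>UNIV. of_int (l i) * \<rho>0 $ (i, j)) = inverse K * (\<Sum>i\<in>UNIV. of_int (l i) * x $ (i, j))"
      by (simp add: \<rho>n sum_distrib_left mult_ac)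
    then show ?thesis by (simp add: xl)
  qed
  have rx\<rho>: "rx l i0 \<rho>0 = (\<lambda>c. inverse K * x $ c)"
    by (rule ext) (simp add: rx_of_lin[OF l0 \<rho>l] \<rho>n)
  have q\<rho>: "qform l (rx l i0 \<rho>0) = 0" unfolding rx\<rho> qform_scale xq by simp
  define \<gamma> :: "'s \<times> 'd \<Rightarrow> real" where "\<gamma> c = (if c = (i, j) then of_int (l i') else 0) - (if c = (i', j) then of_int (l i) else 0)" for c
  have gl: "(\<Sum>k\<in>UNIV. of_int (l k) * \<gamma> (k, j')) = 0" for j'
    by (cases "j' = j") (simp_all add: \<gamma>_def right_diff_distrib sum_subtractf if_distrib[of "\<lambda>a. _ * a"] cong: if_cong)
  define Bf where "Bf r = bform l (rx l i0 r) \<gamma>" for r :: "real ^ ('s \<times> 'd)"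
  define Qf where "Qf r = qform l (rx l i0 r)" for r :: "real ^ ('s \<times> 'd)"
  define q where "q = qform l \<gamma>"
  have "Bf \<rho>0 = inverse K * (of_int (l i) * of_int (l i') * (x $ (i, j) - x $ (i', j)))"
    by (simp add: Bf_def rx\<rho> bform_def \<gamma>_def right_diff_distrib sum_subtractf if_distrib[of "\<lambda>a. _ * a"] mult_ac cong: if_cong)
  then have B0: "Bf \<rho>0 \<noteq> 0" using ne K l0 by simp
  define b where "b = \<bar>Bf \<rho>0\<bar>"
  have b: "b > 0" using B0 by (simp add: b_def)
  define g where "g = (\<chi> c. \<gamma> c)"
  have shift: "Qf (r + t *\<^sub>R g) = Qf r + t * (2 * Bf r) + t\<^sup>2 * q" for r t
    unfolding Qf_def g_def rx_add[OF l0 gl] qform_add by (simp add: Bf_def q_def)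
  define O1 where "O1 = {r :: real ^ ('s \<times> 'd). \<forall>c. 0 < r $ c \<and> r $ c < 1} \<inter> {r. \<forall>j. 0 < rx l i0 r (i0, j) \<and> rx l i0 r (i0, j) < 1}"
  have slab: "open {r. 0 < f r \<and> f r < 1}" if "continuous_on UNIV f" for f :: "real ^ ('s \<times> 'd) \<Rightarrow> real"
    by (intro open_Collect_conj open_Collect_less that continuous_on_const)
  have "O1 = (\<Inter>c. {r. 0 < r $ c \<and> r $ c < 1}) \<inter> (\<Inter>j. {r. 0 < rx l i0 r (i0, j) \<and> rx l i0 r (i0, j) < 1})"
    unfolding O1_def by blast
  also have "open \<dots>"
    by (intro open_Int open_INT ballI finite slab[OF continuous_nth] slab[OF continuous_rx])
  finally have "open O1" .
  moreover have "\<rho>0 \<in> O1"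
  proof -
    have "0 < inverse K * x $ c \<and> inverse K * x $ c < 1" for c using spec[OF pos, of c] xK[of c] K by (simp add: field_simps)
    then show ?thesis unfolding O1_def by (simp add: \<rho>n rx\<rho>)
  qed
  ultimately obtain \<epsilon> where \<epsilon>: "\<epsilon> > 0" "ball \<rho>0 \<epsilon> \<subseteq> O1" by (meson open_contains_ball)
  have O1r: "O1 \<subseteq> rbox l i0" unfolding O1_def rbox_def by (auto intro: less_imp_le)
  \<comment> \<open>The first bound keeps all shifts with parameter up to
    \<open>2 * \<delta>\<close> in the box, rounding included; the second makes the quadratic term
    harmless in \<open>quadratic_root_near\<close>.\<close>
  define \<delta> where "\<delta> = min (\<epsilon> / (8 * (norm g + 1))) (b / (2 * (\<bar>q\<bar> + 1)))"
  have ng: "norm g + 1 > 0" by (simp add: add_nonneg_pos)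
  have \<delta>: "\<delta> > 0" using \<epsilon> b ng by (simp add: \<delta>_def)
  have \<delta>q: "\<delta> * \<bar>q\<bar> \<le> b / 2"
  proof -
    have "\<delta> * (\<bar>q\<bar> + 1) \<le> b / (2 * (\<bar>q\<bar> + 1)) * (\<bar>q\<bar> + 1)" by (intro mult_right_mono) (auto simp: \<delta>_def)
    also have "\<dots> = b / 2" by (simp add: field_simps)
    finally show ?thesis using \<delta> by (simp add: algebra_simps)
  qed
  have \<delta>g: "2 * \<delta> * norm g < \<epsilon> / 2"
  proof -
    have "\<delta> * (norm g + 1) \<le> \<epsilon> / (8 * (norm g + 1)) * (norm g + 1)" using ng by (intro mult_right_mono) (auto simp: \<delta>_def)
    also have "\<dots> = \<epsilon> / 8" using ng by (simp add: field_simps)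
    finally have "\<delta> * norm g \<le> \<epsilon> / 8" using \<delta> by (simp add: algebra_simps)
    then show ?thesis using \<epsilon> by simp
  qed
  have contB: "isCont Bf \<rho>0" and contQ: "isCont Qf \<rho>0"
    using continuous_bform_rx[of l i0 \<gamma>] continuous_qform_rx[of l i0] unfolding Bf_def[abs_def] Qf_def[abs_def]
    by (auto simp: continuous_on_eq_continuous_at)
  obtain d1 where d1: "d1 > 0" "\<And>r. dist r \<rho>0 < d1 \<Longrightarrow> dist (Bf r) (Bf \<rho>0) < b / 2"
    using contB b unfolding continuous_at_eps_delta by (meson half_gt_zero)
  have "\<delta> * b / 2 > 0" using \<delta> b by simp
  then obtain d2 where d2: "d2 > 0" "\<And>r. dist r \<rho>0 < d2 \<Longrightarrow> dist (Qf r) (Qf \<rho>0) < \<delta> * b / 2"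
    using contQ unfolding continuous_at_eps_delta by meson
  define \<rho> where "\<rho> = min (\<epsilon> / 2) (min d1 d2)"
  have \<rho>: "\<rho> > 0" using \<epsilon> d1 d2 by (simp add: \<rho>_def)
  define U where "U = ball \<rho>0 \<rho>"
  \<comment> \<open>A bound for the divided difference \<open>2 * Bf r + (s + t) * q\<close>: its
    parts are at most \<open>4 * b\<close> and \<open>3 * b / 2\<close>.\<close>
  define C where "C = 6 * b"
  have C: "C > 0" using b by (simp add: C_def)
  have root: "\<exists>t. \<bar>t\<bar> \<le> \<delta> \<and> Qf (r + t *\<^sub>R g) = 0" and Bup: "\<bar>Bf r\<bar> \<le> 2 * b" if "r \<in> U" for r
  proof -
    have "dist r \<rho>0 < d1" "dist r \<rho>0 < d2" using that by (simp_all add: U_def \<rho>_def dist_commute)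
    from d1(2)[OF this(1)] d2(2)[OF this(2)]
    have dB: "\<bar>Bf r - Bf \<rho>0\<bar> < b / 2" and dQ: "\<bar>Qf r - Qf \<rho>0\<bar> < \<delta> * b / 2"
      by (simp_all only: dist_real_def)
    have B: "\<bar>Bf r\<bar> \<ge> b / 2" "\<bar>Bf r\<bar> \<le> 2 * b" using dB unfolding b_def by linarith+
    have Q: "\<bar>Qf r\<bar> < \<delta> * b / 2" using dQ q\<rho> by (simp only: Qf_def[of \<rho>0] diff_0_right)
    show "\<exists>t. \<bar>t\<bar> \<le> \<delta> \<and> Qf (r + t *\<^sub>R g) = 0" unfolding shift by (rule quadratic_root_near[OF B(1) b \<delta> \<delta>q Q])
    show "\<bar>Bf r\<bar> \<le> 2 * b" by (rule B(2))
  qed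
  have inbox: "r + t *\<^sub>R g \<in> rbox l i0" if "r \<in> U" "\<bar>t\<bar> \<le> 2 * \<delta>" for r t
  proof -
    have "dist \<rho>0 (r + t *\<^sub>R g) \<le> dist \<rho>0 r + norm (t *\<^sub>R g)"
      using dist_triangle[of \<rho>0 "r + t *\<^sub>R g" r] by (simp add: dist_norm)
    also have "norm (t *\<^sub>R g) \<le> 2 * \<delta> * norm g" using that(2) by (simp add: mult_right_mono)
    also have "dist \<rho>0 r + 2 * \<delta> * norm g < \<epsilon>" using that(1) \<delta>g by (simp add: U_def \<rho>_def)
    finally have "r + t *\<^sub>R g \<in> ball \<rho>0 \<epsilon>" by simp
    then show ?thesis using \<epsilon> O1r by blast
  qed
  define mU where "mU = measure lebesgue U"
  have "ball \<rho>0 \<rho> \<in> sets lborel" by simp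
  from measure_completion[OF this] have mU: "mU > 0"
    unfolding mU_def U_def using content_ball_pos[OF \<rho>, of \<rho>0] by (simp only:)
  have low: "integral\<^sup>L lborel (rdens l i0 T :: real ^ ('s \<times> 'd) \<Rightarrow> real) \<ge> mU / (28 * C * \<delta>)" if T: "T \<ge> 1 / (2 * C * \<delta>)" for T
  proof -
    have "0 < 1 / (2 * C * \<delta>)" using C \<delta> by simp
    then have T0: "T > 0" using T by linarith
    \<comment> \<open>The mesh for which rounding the shift changes the form by at most
      \<open>\<kappa> * C = 1 / (2 * T)\<close>.\<close>
    define \<kappa> where "\<kappa> = 1 / (2 * T * C)"
    have \<kappa>: "\<kappa> > 0" using T0 C by (simp add: \<kappa>_def)
    have \<kappa>\<delta>: "\<kappa> \<le> \<delta>" using T T0 C \<delta> by (simp add: \<kappa>_def field_simps)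
    define S where "S = {r \<in> rbox l i0. \<bar>Qf r\<bar> \<le> 1 / (2 * T)}"
    have Sm: "S \<in> sets borel"
    proof -
      note [measurable] = rbox_borel[of l i0] borel_measurable_continuous_onI[OF continuous_qform_rx[of l i0]]
      have "S = rbox l i0 \<inter> {r. \<bar>Qf r\<bar> \<le> 1 / (2 * T)}" by (auto simp: S_def)
      also have "\<dots> \<in> sets borel" unfolding Qf_def by measurable
      finally show ?thesis .
    qed
    have Sb: "S \<subseteq> cbox 0 (\<chi> k. 1)" by (auto simp: S_def rbox_def mem_box_cart less_imp_le)
    have Sl: "S \<in> lmeasurable"
      by (rule fmeasurableI2[OF _ Sb]) (use Sm in auto)
    define I where "I = {k :: int. \<bar>k\<bar> \<le> \<lceil>\<delta> / \<kappa>\<rceil> + 1}"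
    have Ieq: "I = {- (\<lceil>\<delta> / \<kappa>\<rceil> + 1)..\<lceil>\<delta> / \<kappa>\<rceil> + 1}" by (auto simp: I_def abs_le_iff)
    have cI: "real (card I) \<le> 7 * (\<delta> / \<kappa>)"
    proof -
      have "1 \<le> \<delta> / \<kappa>" using \<kappa>\<delta> \<kappa> by simp
      then have "\<lceil>\<delta> / \<kappa>\<rceil> \<ge> 0" by linarith
      then have "real (card I) = 2 * (of_int \<lceil>\<delta> / \<kappa>\<rceil> + 1) + 1" unfolding Ieq by simp
      then have "real (card I) = 2 * of_int \<lceil>\<delta> / \<kappa>\<rceil> + 3" by simp
      moreover have "2 * real_of_int \<lceil>\<delta> / \<kappa>\<rceil> \<le> 2 * (\<delta> / \<kappa> + 1)"
        by (rule mult_left_mono[OF of_int_ceiling_le_add_one]) simp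
      ultimately have "real (card I) \<le> 2 * (\<delta> / \<kappa> + 1) + 3" by (simp only: add_right_mono)
      also have "\<dots> = 2 * (\<delta> / \<kappa>) + 5 * 1" by simp
      also have "\<dots> \<le> 2 * (\<delta> / \<kappa>) + 5 * (\<delta> / \<kappa>)"
        by (intro add_left_mono mult_left_mono \<open>1 \<le> \<delta> / \<kappa>\<close>) simp
      also have "\<dots> = 7 * (\<delta> / \<kappa>)" by simp
      finally show ?thesis .
    qed
    have "U \<subseteq> (\<Union>k\<in>I. (+) (- (of_int k * \<kappa>) *\<^sub>R g) ` S)"
    proof
      fix r assume r: "r \<in> U"
      obtain t where t: "\<bar>t\<bar> \<le> \<delta>" "Qf (r + t *\<^sub>R g) = 0" using root[OF r] by blast
      define k where "k = \<lfloor>t / \<kappa>\<rfloor>"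
      have k1: "of_int k \<le> t / \<kappa>" "t / \<kappa> < of_int k + 1" by (auto simp: k_def)
      define s where "s = of_int k * \<kappa>"
      have s1: "s \<le> t" "t < s + \<kappa>" using k1 \<kappa> by (auto simp: s_def field_simps)
      then have st: "\<bar>s - t\<bar> \<le> \<kappa>" by linarith
      have s2: "\<bar>s\<bar> \<le> 2 * \<delta>" using s1 t \<kappa>\<delta> by linarith
      have "\<bar>t / \<kappa>\<bar> \<le> \<delta> / \<kappa>" using t \<kappa> by (simp add: divide_right_mono)
      then have "\<bar>real_of_int k\<bar> \<le> \<delta> / \<kappa> + 1" using k1 by linarith
      then have kI: "k \<in> I" unfolding I_def mem_Collect_eq by linarith
      have "Qf (r + s *\<^sub>R g) = (Qf (r + s *\<^sub>R g) - Qf (r + t *\<^sub>R g))" using t by simp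
      also have "\<dots> = (s - t) * (2 * Bf r + (s + t) * q)" unfolding shift by (simp add: power2_eq_square algebra_simps)
      finally have "\<bar>Qf (r + s *\<^sub>R g)\<bar> = \<bar>s - t\<bar> * \<bar>2 * Bf r + (s + t) * q\<bar>" by (simp add: abs_mult)
      also have "\<dots> \<le> \<kappa> * C"
      proof (intro mult_mono st)
        have "\<bar>s + t\<bar> \<le> 3 * \<delta>" using s2 t by linarith
        then have "\<bar>(s + t) * q\<bar> \<le> (3 * \<delta>) * \<bar>q\<bar>" unfolding abs_mult by (intro mult_right_mono) auto
        then have "\<bar>(s + t) * q\<bar> \<le> 3 * (b / 2)" using \<delta>q by linarith
        then show "\<bar>2 * Bf r + (s + t) * q\<bar> \<le> C" using Bup[OF r] b unfolding C_def by linarith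
      qed (use \<kappa> in auto)
      also have "\<kappa> * C = 1 / (2 * T)" using C by (simp add: \<kappa>_def)
      finally have "r + s *\<^sub>R g \<in> S" using inbox[OF r s2] by (simp add: S_def)
      then have "r \<in> (+) (- s *\<^sub>R g) ` S" by (intro image_eqI[of _ _ "r + s *\<^sub>R g"]) auto
      then show "r \<in> (\<Union>k\<in>I. (+) (- (of_int k * \<kappa>) *\<^sub>R g) ` S)" using kI unfolding s_def by blast
    qed
    moreover have "(\<Union>k\<in>I. (+) (- (of_int k * \<kappa>) *\<^sub>R g) ` S) \<in> lmeasurable"
      using Sl by (intro fmeasurable.finite_UN measurable_translation) (auto simp: Ieq)
    ultimately have "mU \<le> measure lebesgue (\<Union>k\<in>I. (+) (- (of_int k * \<kappa>) *\<^sub>R g) ` S)"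
      unfolding mU_def by (intro measure_mono_fmeasurable) (auto simp: U_def)
    also have "\<dots> \<le> (\<Sum>k\<in>I. measure lebesgue ((+) (- (of_int k * \<kappa>) *\<^sub>R g) ` S))"
      by (intro measure_UNION_le fmeasurableD measurable_translation Sl) (simp add: Ieq)
    also have "\<dots> = real (card I) * measure lebesgue S" by (simp only: measure_translation sum_constant)
    also have "\<dots> \<le> (7 * (\<delta> / \<kappa>)) * measure lebesgue S" by (intro mult_right_mono cI) simp
    also have "\<dots> = (14 * C * \<delta>) * (T * measure lebesgue S)" using T0 C by (simp add: \<kappa>_def field_simps)
    finally have 1: "mU \<le> (14 * C * \<delta>) * (T * measure lebesgue S)" .
    have "T / 2 * measure lborel S = integral\<^sup>L lborel (\<lambda>r. T / 2 * indicator S r)" by simp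
    also have "\<dots> \<le> integral\<^sup>L lborel (rdens l i0 T :: real ^ ('s \<times> 'd) \<Rightarrow> real)"
    proof (rule integral_mono)
      have "emeasure lborel S < \<infinity>"
        using emeasure_mono[OF Sb, of lborel] emeasure_bounded_finite[OF bounded_cbox, of 0 "\<chi> k. 1"] by (auto intro: le_less_trans)
      then show "integrable lborel (\<lambda>r. T / 2 * indicator S r)" using Sm
        by (intro integrable_mult_right integrable_real_indicator) auto
      show "integrable lborel (rdens l i0 T :: real ^ ('s \<times> 'd) \<Rightarrow> real)" using T0 by (intro rdens_integrable) simp
      fix r :: "real ^ ('s \<times> 'd)"
      show "T / 2 * indicator S r \<le> rdens l i0 T r"
      proof (cases "r \<in> S")
        case True
        then have "\<bar>Qf r\<bar> \<le> 1 / (2 * T)" "r \<in> rbox l i0" by (auto simp: S_def)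
        then have "T * \<bar>Qf r\<bar> \<le> T * (1 / (2 * T))" using T0 by (intro mult_left_mono) auto
        then have "T * \<bar>Qf r\<bar> \<le> 1 / 2" using T0 by simp
        then have "T * (1 / 2) \<le> T * max 0 (1 - T * \<bar>Qf r\<bar>)" using T0 by (intro mult_left_mono) auto
        then show ?thesis using True \<open>r \<in> rbox l i0\<close> by (simp add: rdens_def tent_def Qf_def)
      next
        case False
        then show ?thesis using T0 by (simp add: rdens_def tent_def)
      qed
    qed
    finally have 2: "T / 2 * measure lborel S \<le> integral\<^sup>L lborel (rdens l i0 T :: real ^ ('s \<times> 'd) \<Rightarrow> real)" .
    have "measure lebesgue S = measure lborel S" using Sm by simp
    then have "mU / (14 * C * \<delta>) \<le> T * measure lborel S" using 1 C \<delta> by (simp add: pos_divide_le_eq mult.commute)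
    then have half: "(mU / (14 * C * \<delta>)) / 2 \<le> (T * measure lborel S) / 2" by (rule divide_right_mono) simp
    have "mU / (28 * C * \<delta>) = (mU / (14 * C * \<delta>)) / 2" by simp
    also note half
    also have "(T * measure lborel S) / 2 = T / 2 * measure lborel S" by simp
    finally show ?thesis using 2 by (rule order_trans)
  qed
  then show ?thesis using mU C \<delta> by (intro exI[of _ "mU / (28 * C * \<delta>)"] conjI exI[of _ "1 / (2 * C * \<delta>)"]) auto
qed

subsection \<open>The weighted count\<close>

text \<open>The dummy row \<open>i0\<close> of \<open>y\<close> is free on the right, whence the
  factor \<open>N ^ d\<close>; the other rows determine the point, provided the eliminated row comes
  out integral and inside the box.\<close>

lemma sum_sys_points_lift:
  fixes l :: "'s::finite \<Rightarrow> int" and f :: "('s \<times> 'd::finite \<Rightarrow> int) \<Rightarrow> real"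
  assumes l0: "l i0 \<noteq> 0"
  shows "real N ^ CARD('d) * (\<Sum>x\<in>sys_points l N. f x) =
    (\<Sum>y\<in>{y \<in> pbox N. (\<forall>c. l i0 dvd cmpl l i0 y c) \<and> (\<forall>j. cmpl l i0 y (i0, j) div l i0 \<in> {1..int N})}. f (\<lambda>c. cmpl l i0 y c div l i0))"
    (is "_ = sum _ ?Y")
proof -
  let ?up = "\<lambda>(x :: 's \<times> 'd \<Rightarrow> int, w :: 'd \<Rightarrow> int) c. if fst c = i0 then w (snd c) else x c"
  let ?dn = "\<lambda>y :: 's \<times> 'd \<Rightarrow> int. ((\<lambda>c. cmpl l i0 y c div l i0), (\<lambda>j. y (i0, j)))"
  have cm: "cmpl l i0 (?up (x, w)) c = l i0 * x c" if "x \<in> sys_points l N" for x :: "'s \<times> 'd \<Rightarrow> int" and w c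
  proof -
    have "cmpl l i0 (?up (x, w)) c = cmpl l i0 x c" by (simp add: cmpl_def)
    also have "\<dots> = of_int (l i0) * x c" using that by (intro cmpl_of_lin) (simp add: sys_points_def)
    finally show ?thesis by simp
  qed
  have "(\<Sum>(x, w :: 'd \<Rightarrow> int)\<in>sys_points l N \<times> pbox N. f x) = (\<Sum>y\<in>?Y. f (\<lambda>c. cmpl l i0 y c div l i0))"
  proof (rule sum.reindex_bij_witness[of _ ?dn ?up])
    fix y :: "'s \<times> 'd \<Rightarrow> int" assume y: "y \<in> ?Y"
    have dv: "l i0 * (cmpl l i0 y c div l i0) = cmpl l i0 y c" for c
    proof -
      have "l i0 dvd cmpl l i0 y c" using y by blast
      then show ?thesis by simp
    qed
    show "?up (?dn y) = y"
      using l0 by (auto simp: fun_eq_iff cmpl_def)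
    have "cmpl l i0 y c div l i0 \<in> {1..int N}" for c
    proof (cases "fst c = i0")
      case True
      then have "c = (i0, snd c)" by (cases c) auto
      then show ?thesis using y by (metis (mono_tags, lifting) mem_Collect_eq)
    next
      case False
      moreover have "1 \<le> y c \<and> y c \<le> int N" using y unfolding pbox_def by blast
      ultimately show ?thesis using l0 by (simp add: cmpl_def)
    qed
    moreover have "(\<Sum>i\<in>UNIV. l i * (cmpl l i0 y (i, j) div l i0)) = 0" for j
    proof -
      have "l i0 * (\<Sum>i\<in>UNIV. l i * (cmpl l i0 y (i, j) div l i0)) = (\<Sum>i\<in>UNIV. of_int (l i) * cmpl l i0 y (i, j))"
        unfolding sum_distrib_left by (intro sum.cong refl) (simp add: mult.left_commute[of "l i0"] dv)
      then show ?thesis using l0 lin_cmpl[of l i0 y j] by simp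
    qed
    moreover have "(\<lambda>j. y (i0, j)) \<in> pbox N" using y by (simp add: pbox_def)
    ultimately show "?dn y \<in> sys_points l N \<times> (pbox N :: ('d \<Rightarrow> int) set)" by (simp add: sys_points_def)
  next
    fix a :: "('s \<times> 'd \<Rightarrow> int) \<times> ('d \<Rightarrow> int)" assume "a \<in> sys_points l N \<times> pbox N"
    then obtain x w where a: "a = (x, w)" "x \<in> sys_points l N" "w \<in> pbox N" by (cases a) auto
    have c: "cmpl l i0 (?up a) c = l i0 * x c" for c unfolding a(1) by (rule cm[OF a(2)])
    show "?dn (?up a) = a" unfolding c using l0 by (simp add: a(1))
    have "?up a c \<in> {1..int N}" for c using a(2,3) by (cases c) (simp add: a(1) sys_points_def pbox_def)
    then have "?up a \<in> pbox N" by (simp add: pbox_def)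
    moreover have "\<forall>j. x (i0, j) \<in> {1..int N}" using a(2) by (simp add: sys_points_def)
    ultimately show "?up a \<in> ?Y" unfolding mem_Collect_eq c using l0 by simp
    show "f (\<lambda>c. cmpl l i0 (?up a) c div l i0) = (case a of (x, w) \<Rightarrow> f x)"
      unfolding c using l0 by (simp add: a(1))
  qed
  moreover have "(\<Sum>(x, w :: 'd \<Rightarrow> int)\<in>sys_points l N \<times> pbox N. f x) = (\<Sum>x\<in>sys_points l N. \<Sum>w\<in>(pbox N :: ('d \<Rightarrow> int) set). f x)"
    by (simp only: sum.cartesian_product)
  ultimately show ?thesis by (simp add: card_pbox sum_distrib_left)
qed

lemma card_diff_pairs:
  "real (card {m \<in> {..<H} \<times> {..<H}. k + (int (fst m) - int (snd m)) = 0}) = max 0 (real H - \<bar>real_of_int k\<bar>)"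
proof (cases "k \<ge> 0")
  case True
  have "{m \<in> {..<H} \<times> {..<H}. k + (int (fst m) - int (snd m)) = 0} = (\<lambda>a. (a, a + nat k)) ` {..<H - nat k}"
  proof (rule subset_antisym; rule subsetI)
    fix m assume "m \<in> {m \<in> {..<H} \<times> {..<H}. k + (int (fst m) - int (snd m)) = 0}"
    then show "m \<in> (\<lambda>a. (a, a + nat k)) ` {..<H - nat k}" using True
      by (intro image_eqI[of _ _ "fst m"]) (auto simp: prod_eq_iff)
  qed (use True in auto)
  moreover have "inj_on (\<lambda>a. (a, a + nat k)) {..<H - nat k}" by (auto simp: inj_on_def)
  ultimately show ?thesis using True by (simp add: card_image max_def of_nat_diff)
next
  case False
  have "{m \<in> {..<H} \<times> {..<H}. k + (int (fst m) - int (snd m)) = 0} = (\<lambda>a. (a + nat (- k), a)) ` {..<H - nat (- k)}"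
  proof (rule subset_antisym; rule subsetI)
    fix m assume "m \<in> {m \<in> {..<H} \<times> {..<H}. k + (int (fst m) - int (snd m)) = 0}"
    then show "m \<in> (\<lambda>a. (a + nat (- k), a)) ` {..<H - nat (- k)}" using False
      by (intro image_eqI[of _ _ "snd m"]) (auto simp: prod_eq_iff)
  qed (use False in auto)
  moreover have "inj_on (\<lambda>a. (a + nat (- k), a)) {..<H - nat (- k)}" by (auto simp: inj_on_def)
  ultimately show ?thesis using False by (simp add: card_image max_def of_nat_diff)
qed

lemma kcount_eq:
  assumes H: "H \<ge> 1" and M: "M \<ge> 1"
  shows "kcount M H n = of_bool (int M dvd n) * (max 0 (1 - \<bar>real_of_int n\<bar> / (real M * real H)) / real H)"
proof (cases "int M dvd n")
  case True
  then obtain k where k: "n = int M * k" ..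
  have e: "n + int M * (int (fst m) - int (snd m)) = 0 \<longleftrightarrow> k + (int (fst m) - int (snd m)) = 0" for m :: "nat \<times> nat"
  proof -
    have "n + int M * (int (fst m) - int (snd m)) = int M * (k + (int (fst m) - int (snd m)))" by (simp add: k algebra_simps)
    then show ?thesis using M by simp
  qed
  have "kcount M H n = real (card {m \<in> {..<H} \<times> {..<H}. k + (int (fst m) - int (snd m)) = 0}) / (real H)\<^sup>2"
    unfolding kcount_def e by (simp add: of_bool_def sum.If_cases Int_def)
  also have "\<dots> = max 0 (real H - \<bar>real_of_int k\<bar>) / (real H)\<^sup>2" by (simp only: card_diff_pairs)
  also have "\<dots> = (max 0 (real H - \<bar>real_of_int k\<bar>) / real H) / real H" by (simp add: power2_eq_square)
  also have "max 0 (real H - \<bar>real_of_int k\<bar>) / real H = max 0 (1 - \<bar>real_of_int n\<bar> / (real M * real H))"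
  proof -
    have "\<bar>real_of_int n\<bar> / (real M * real H) = \<bar>real_of_int k\<bar> / real H" using M by (simp add: k abs_mult)
    moreover have "max 0 (real H - x) / real H = max 0 (1 - x / real H)" for x
      using H by (simp add: max_def diff_divide_distrib pos_le_divide_eq)
    ultimately show ?thesis by simp
  qed
  finally show ?thesis using True by simp
next
  case False
  have "n + int M * (int (fst m) - int (snd m)) \<noteq> 0" for m :: "nat \<times> nat"
  proof
    assume "n + int M * (int (fst m) - int (snd m)) = 0"
    then have "n = int M * (int (snd m) - int (fst m))" by (simp add: algebra_simps)
    then show False using False by simp
  qed
  then show ?thesis using False by (simp add: kcount_def)
qed

lemma rx_vreal:
  fixes y :: "'s::finite \<times> 'd::finite \<Rightarrow> int"
  assumes l0: "l i0 \<noteq> 0"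
  shows "rx l i0 (vreal y /\<^sub>R real N) c = of_int (cmpl l i0 y c) / (of_int (l i0) * real N)"
  using l0 by (simp add: rx_def cmpl_def vreal_def sum_divide_distrib sum_distrib_left divide_inverse mult_ac sum_negf)

text \<open>Brings the weighted count into the shape required by
  \<open>riemann_sum_periodic\<close>: \<open>hcond\<close> is periodic in \<open>y\<close>, and
  \<open>rdens\<close> depends on \<open>y / N\<close>. The tent of half-width \<open>M * H\<close>
  in the value of the form becomes a tent with parameter \<open>N\<^sup>2 / (M * H)\<close> in the
  rescaled value, and normalising its integral produces the factor
  \<open>M / N\<^sup>2\<close>.\<close>

lemma kernel_sum_eq:
  fixes l :: "'s::finite \<Rightarrow> int"
  assumes l0: "l i0 \<noteq> 0" and N: "N \<ge> 1" and H: "H \<ge> 1" and M: "M \<ge> 1"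
  shows "real N ^ CARD('d) * (\<Sum>x\<in>sys_points l N. kcount M H (qform l (x :: 's \<times> 'd::finite \<Rightarrow> int))) =
    real M / (real N)\<^sup>2 * (\<Sum>y\<in>pbox N. of_bool (hcond l i0 M (y :: 's \<times> 'd \<Rightarrow> int)) *
       rdens l i0 ((real N)\<^sup>2 / (real M * real H)) (vreal y /\<^sub>R real N))"
proof -
  let ?Y = "{y \<in> pbox N. (\<forall>c. l i0 dvd cmpl l i0 (y :: 's \<times> 'd \<Rightarrow> int) c) \<and> (\<forall>j. cmpl l i0 y (i0, j) div l i0 \<in> {1..int N})}"
  let ?t = "(real N)\<^sup>2 / (real M * real H)"
  let ?g = "\<lambda>y :: 's \<times> 'd \<Rightarrow> int. of_bool (hcond l i0 M y) * rdens l i0 ?t (vreal y /\<^sub>R real N)"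
  have "real N ^ CARD('d) * (\<Sum>x\<in>sys_points l N. kcount M H (qform l (x :: 's \<times> 'd \<Rightarrow> int))) =
      (\<Sum>y\<in>?Y. kcount M H (qform l (\<lambda>c. cmpl l i0 y c div l i0)))"
    by (rule sum_sys_points_lift[of l i0, OF l0])
  also have "\<dots> = (\<Sum>y\<in>?Y. real M / (real N)\<^sup>2 * ?g y)"
  proof (rule sum.cong[OF refl])
    fix y assume y: "y \<in> ?Y"
    define X where "X c = cmpl l i0 y c div l i0" for c
    have cX: "cmpl l i0 y c = l i0 * X c" for c
    proof -
      have "l i0 dvd cmpl l i0 y c" using y by blast
      then show ?thesis by (simp add: X_def)
    qed
    have q: "qform l (cmpl l i0 y) = (l i0)\<^sup>2 * qform l X"
    proof -
      have "cmpl l i0 y = (\<lambda>c. l i0 * X c)" by (rule ext) (rule cX)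
      then show ?thesis by (simp only: qform_scale)
    qed
    have hc: "hcond l i0 M y \<longleftrightarrow> int M dvd qform l X"
      unfolding hcond_def q using l0 by (simp add: cX mult.commute[of "int M"])
    have rX: "rx l i0 (vreal y /\<^sub>R real N) c = of_int (X c) / real N" for c
      unfolding rx_vreal[of l i0, OF l0] cX using l0 by simp
    have "y \<in> pbox N" using y by simp
    then have "0 < (vreal y /\<^sub>R real N) $ c \<and> (vreal y /\<^sub>R real N) $ c \<le> 1" for c
    proof -
      have "1 \<le> y c \<and> y c \<le> int N" using \<open>y \<in> pbox N\<close> unfolding pbox_def by blast
      then have "0 < real_of_int (y c) \<and> real_of_int (y c) \<le> real N" by linarith
      then show ?thesis using N by (simp add: vreal_def field_simps)
    qed
    moreover have "0 < rx l i0 (vreal y /\<^sub>R real N) (i0, j) \<and> rx l i0 (vreal y /\<^sub>R real N) (i0, j) \<le> 1" for j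
    proof -
      have "X (i0, j) \<in> {1..int N}" using y unfolding X_def by blast
      then have "0 < real_of_int (X (i0, j)) \<and> real_of_int (X (i0, j)) \<le> real N" by auto
      then show ?thesis unfolding rX using N by simp
    qed
    ultimately have inb: "vreal y /\<^sub>R real N \<in> rbox l i0" by (simp add: rbox_def)
    have "qform l (rx l i0 (vreal y /\<^sub>R real N)) = qform l (\<lambda>c. inverse (real N) * of_int (X c))"
      by (rule arg_cong[of _ _ "qform l"]) (rule ext, simp add: rX divide_inverse)
    also have "\<dots> = of_int (qform l X) / (real N)\<^sup>2"
      unfolding qform_scale of_int_qform by (simp add: power_inverse divide_inverse)
    finally have qr: "qform l (rx l i0 (vreal y /\<^sub>R real N)) = of_int (qform l X) / (real N)\<^sup>2" .
    have "?t * \<bar>of_int (qform l X) / (real N)\<^sup>2\<bar> = \<bar>real_of_int (qform l X)\<bar> / (real M * real H)"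
      using N by simp
    then have "?g y = of_bool (int M dvd qform l X) * (?t * max 0 (1 - \<bar>real_of_int (qform l X)\<bar> / (real M * real H)))"
      using inb by (simp add: rdens_def tent_def qr hc)
    then have "real M / (real N)\<^sup>2 * ?g y = of_bool (int M dvd qform l X) * (max 0 (1 - \<bar>real_of_int (qform l X)\<bar> / (real M * real H)) / real H)"
      using N M by simp
    also have "\<dots> = kcount M H (qform l X)" by (rule kcount_eq[OF H M, symmetric])
    finally show "kcount M H (qform l (\<lambda>c. cmpl l i0 y c div l i0)) = real M / (real N)\<^sup>2 * ?g y"
      by (simp add: X_def[abs_def])
  qed
  also have "\<dots> = (\<Sum>y\<in>pbox N. real M / (real N)\<^sup>2 * ?g y)"
  proof (rule sum.mono_neutral_left)
    \<comment> \<open>Outside \<open>?Y\<close> either divisibility by \<open>l i0\<close> fails,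
      which \<open>hcond\<close> detects, or the eliminated row leaves the box, which
      \<open>rbox\<close> detects.\<close>
    show "\<forall>y\<in>pbox N - ?Y. real M / (real N)\<^sup>2 * ?g y = 0"
    proof
      fix y assume y: "y \<in> pbox N - ?Y"
      have "?g y = 0"
      proof (cases "hcond l i0 M y")
        case True
        then have dv: "\<forall>c. l i0 dvd cmpl l i0 y c" by (simp add: hcond_def)
        then obtain j where j: "cmpl l i0 y (i0, j) div l i0 \<notin> {1..int N}" using y by blast
        define k where "k = cmpl l i0 y (i0, j) div l i0"
        have ck: "cmpl l i0 y (i0, j) = l i0 * k" using dv by (simp add: k_def)
        have "rx l i0 (vreal y /\<^sub>R real N) (i0, j) = of_int k / real N"
          unfolding rx_vreal[of l i0, OF l0] ck using l0 by simp
        moreover have "k \<le> 0 \<or> k > int N" using j by (auto simp: k_def)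
        then have "of_int k / real N \<le> 0 \<or> of_int k / real N > 1" using N
          by (auto simp: divide_le_0_iff less_divide_eq)
        ultimately have "\<not> (0 < rx l i0 (vreal y /\<^sub>R real N) (i0, j) \<and> rx l i0 (vreal y /\<^sub>R real N) (i0, j) \<le> 1)"
          by auto
        then have "vreal y /\<^sub>R real N \<notin> rbox l i0" unfolding rbox_def by blast
        then show ?thesis by (simp add: rdens_def)
      qed simp
      then show "real M / (real N)\<^sup>2 * ?g y = 0" by simp
    qed
  qed auto
  finally show ?thesis by (simp only: sum_distrib_left)
qed

text \<open>The exceptional points lie on finitely many hyperplanes. A row \<open>i1\<close> other
  than \<open>i0\<close> ensures that the eliminated row is given by nonzero linear forms, whose
  level sets are null.\<close>

lemma ae_regular_point:
  fixes l :: "'s::finite \<Rightarrow> int"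
  assumes l0: "\<forall>i. l i \<noteq> 0" and i1: "i1 \<noteq> i0"
  shows "AE r :: real ^ ('s \<times> 'd::finite) in lborel. (\<forall>c. r $ c \<noteq> 0 \<and> r $ c \<noteq> 1) \<and> (\<forall>j. rx l i0 r (i0, j) \<noteq> 0 \<and> rx l i0 r (i0, j) \<noteq> 1)"
proof -
  have ae: "AE r :: real ^ ('s \<times> 'd) in lborel. f r \<noteq> a" if "continuous_on UNIV f" "negligible {r. f r = a}"
    for f :: "real ^ ('s \<times> 'd) \<Rightarrow> real" and a :: real
  proof (rule AE_I')
    have "{r. f r = a} \<in> sets borel" by (intro borel_closed closed_Collect_eq that continuous_on_const)
    then show "{r. f r = a} \<in> null_sets lborel"
      using that(2) by (simp add: negligible_iff_null_sets null_sets_completion_iff)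
  qed auto
  have "AE r :: real ^ ('s \<times> 'd) in lborel. r $ c \<noteq> a" for c a
  proof (rule ae)
    show "continuous_on UNIV (\<lambda>r :: real ^ ('s \<times> 'd). r $ c)" by (rule continuous_nth)
    show "negligible {r :: real ^ ('s \<times> 'd). r $ c = a}"
      using negligible_hyperplane[of "axis c 1 :: real ^ ('s \<times> 'd)" a] by (simp add: inner_axis')
  qed
  moreover have "AE r :: real ^ ('s \<times> 'd) in lborel. rx l i0 r (i0, j) \<noteq> a" for j a
  proof (rule ae[OF continuous_rx])
    define u :: "real ^ ('s \<times> 'd)" where "u = (\<chi> c. if snd c = j \<and> fst c \<noteq> i0 then - of_int (l (fst c)) / of_int (l i0) else 0)"
    have "u $ (i1, j) \<noteq> 0" using i1 l0 by (simp add: u_def)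
    then have "u \<noteq> 0" by auto
    moreover have "rx l i0 r (i0, j) = u \<bullet> r" for r
    proof -
      have "u \<bullet> r = (\<Sum>j'\<in>UNIV. \<Sum>i\<in>UNIV. u $ (i, j') * r $ (i, j'))"
        by (simp add: inner_vec_def sum_pairs)
      also have "\<dots> = (\<Sum>j'\<in>UNIV. if j' = j then (\<Sum>i\<in>UNIV. u $ (i, j') * r $ (i, j')) else 0)"
      proof (rule sum.cong[OF refl])
        fix j'
        show "(\<Sum>i\<in>UNIV. u $ (i, j') * r $ (i, j')) = (if j' = j then (\<Sum>i\<in>UNIV. u $ (i, j') * r $ (i, j')) else 0)"
          by (cases "j' = j") (simp_all add: u_def)
      qed
      also have "\<dots> = (\<Sum>i\<in>UNIV. u $ (i, j) * r $ (i, j))" by simp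
      also have "\<dots> = (\<Sum>i\<in>UNIV - {i0}. u $ (i, j) * r $ (i, j))"
        by (rule sum.mono_neutral_right) (simp_all add: u_def)
      also have "\<dots> = (\<Sum>i\<in>UNIV - {i0}. - (of_int (l i) * r $ (i, j)) / of_int (l i0))"
        by (rule sum.cong[OF refl]) (simp add: u_def)
      also have "\<dots> = rx l i0 r (i0, j)" by (simp add: rx_def sum_divide_distrib sum_negf)
      finally show ?thesis by simp
    qed
    ultimately show "negligible {r. rx l i0 r (i0, j) = a}" using negligible_hyperplane[of u a] by simp
  qed
  ultimately show ?thesis by (intro AE_conjI AE_all_countable[THEN iffD2] allI)
qed

text \<open>Off the faces of the box each condition defining \<open>rbox\<close> is locally
  constant, and the tent is continuous jointly in its parameter and its argument.\<close>

lemma rdens_tendsto: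
  fixes r :: "real ^ ('s::finite \<times> 'd::finite)"
  assumes reg: "\<forall>c. r $ c \<noteq> 0 \<and> r $ c \<noteq> 1" "\<forall>j. rx l i0 r (i0, j) \<noteq> 0 \<and> rx l i0 r (i0, j) \<noteq> 1"
    and \<rho>: "\<rho> \<longlonglongrightarrow> r" and t: "t \<longlonglongrightarrow> T"
  shows "(\<lambda>N. rdens l i0 (t N) (\<rho> N)) \<longlonglongrightarrow> rdens l i0 T r"
proof -
  have lim: "(\<lambda>N. f (\<rho> N)) \<longlonglongrightarrow> f r" if "continuous_on UNIV f" for f :: "real ^ ('s \<times> 'd) \<Rightarrow> real"
    using that \<rho> by (intro isCont_tendsto_compose[of r f]) (auto simp: continuous_on_eq_continuous_at)
  have ev: "\<forall>\<^sub>F N in sequentially. (0 < f (\<rho> N) \<and> f (\<rho> N) \<le> 1) \<longleftrightarrow> (0 < f r \<and> f r \<le> 1)"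
    if f: "continuous_on UNIV f" "f r \<noteq> 0 \<and> f r \<noteq> 1" for f :: "real ^ ('s \<times> 'd) \<Rightarrow> real"
  proof -
    consider "f r < 0" | "f r > 1" | "0 < f r" "f r < 1" using f(2) by linarith
    then show ?thesis
    proof cases
      case 1
      show ?thesis using order_tendstoD(2)[OF lim[OF f(1)] 1] by eventually_elim (use 1 in auto)
    next
      case 2
      show ?thesis using order_tendstoD(1)[OF lim[OF f(1)] 2] by eventually_elim (use 2 in auto)
    next
      case 3
      show ?thesis using order_tendstoD(1)[OF lim[OF f(1)] 3(1)] order_tendstoD(2)[OF lim[OF f(1)] 3(2)]
        by eventually_elim (use 3 in auto)
    qed
  qed
  have e1: "\<forall>\<^sub>F N in sequentially. \<forall>c. (0 < \<rho> N $ c \<and> \<rho> N $ c \<le> 1) \<longleftrightarrow> (0 < r $ c \<and> r $ c \<le> 1)"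
    by (intro eventually_all_finite ev[OF continuous_nth]) (use reg(1) in blast)
  have e2: "\<forall>\<^sub>F N in sequentially. \<forall>j. (0 < rx l i0 (\<rho> N) (i0, j) \<and> rx l i0 (\<rho> N) (i0, j) \<le> 1) \<longleftrightarrow> (0 < rx l i0 r (i0, j) \<and> rx l i0 r (i0, j) \<le> 1)"
    by (intro eventually_all_finite ev[OF continuous_rx]) (use reg(2) in blast)
  have "\<forall>\<^sub>F N in sequentially. indicator (rbox l i0) (\<rho> N) = (indicator (rbox l i0) r :: real)"
    using e1 e2
  proof eventually_elim
    case (elim N)
    then have "\<rho> N \<in> rbox l i0 \<longleftrightarrow> r \<in> rbox l i0" unfolding rbox_def mem_Collect_eq by metis
    then show ?case by (simp add: indicator_def)
  qed
  then have "(\<lambda>N. indicator (rbox l i0) (\<rho> N) :: real) \<longlonglongrightarrow> indicator (rbox l i0) r" by (rule tendsto_eventually)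
  moreover have "(\<lambda>N. tent (t N) (qform l (rx l i0 (\<rho> N)))) \<longlonglongrightarrow> tent T (qform l (rx l i0 r))"
    unfolding tent_def by (intro tendsto_intros t lim[OF continuous_qform_rx])
  ultimately show ?thesis unfolding rdens_def by (rule tendsto_mult)
qed

section \<open>Limits, tails and the modulus for the final approximation\<close>

lemma square_div_tendsto:
  assumes c: "c > (0::nat)"
  shows "(\<lambda>N. (real (Suc N))\<^sup>2 / real ((Suc N)\<^sup>2 div c)) \<longlonglongrightarrow> real c"
proof -
  let ?H = "\<lambda>N. real ((Suc N)\<^sup>2 div c)"
  have H: "real c * ?H N \<le> (real (Suc N))\<^sup>2" "(real (Suc N))\<^sup>2 < real c * (?H N + 1)" for N
  proof -
    have "c * ((Suc N)\<^sup>2 div c) \<le> (Suc N)\<^sup>2" by (rule times_div_less_eq_dividend)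
    then have "real (c * ((Suc N)\<^sup>2 div c)) \<le> real ((Suc N)\<^sup>2)" by (rule of_nat_mono)
    then show "real c * ?H N \<le> (real (Suc N))\<^sup>2" by (simp only: of_nat_mult of_nat_power)
    have "(Suc N)\<^sup>2 < c * ((Suc N)\<^sup>2 div c + 1)"
      using dividend_less_div_times[OF c, of "(Suc N)\<^sup>2"] by (simp add: algebra_simps)
    then have "real ((Suc N)\<^sup>2) < real (c * ((Suc N)\<^sup>2 div c + 1))" by (simp only: of_nat_less_iff)
    then show "(real (Suc N))\<^sup>2 < real c * (?H N + 1)" by (simp only: of_nat_mult of_nat_power of_nat_add of_nat_1)
  qed
  have Hinf: "filterlim ?H at_top sequentially"
    unfolding filterlim_at_top eventually_sequentially
  proof
    fix Z
    obtain n0 where n0: "real c * (Z + 1) < real n0" using reals_Archimedean2 by blast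
    have "Z \<le> ?H N" if "N \<ge> n0" for N
    proof -
      have "real c * (Z + 1) < real (Suc N)" using n0 that by linarith
      also have "\<dots> \<le> (real (Suc N))\<^sup>2" by (simp add: power2_eq_square mult_le_cancel_left1)
      finally have "real c * (Z + 1) < real c * (?H N + 1)" using H(2)[of N] by linarith
      then show ?thesis using c by (simp only: mult_less_cancel_left_pos of_nat_0_less_iff)
    qed
    then show "\<exists>n0. \<forall>N\<ge>n0. Z \<le> ?H N" by blast
  qed
  then have "(\<lambda>N. real c * (1 + inverse (?H N))) \<longlonglongrightarrow> real c * (1 + 0)"
    by (intro tendsto_intros tendsto_inverse_0_at_top)
  then have up: "(\<lambda>N. real c * (1 + inverse (?H N))) \<longlonglongrightarrow> real c" by simp
  have pos: "\<forall>\<^sub>F N in sequentially. ?H N > 0" using Hinf by (simp only: filterlim_at_top_dense)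
  show ?thesis
  proof (rule tendsto_sandwich[OF _ _ tendsto_const up])
    show "\<forall>\<^sub>F N in sequentially. real c \<le> (real (Suc N))\<^sup>2 / ?H N"
      using pos by eventually_elim (use H in \<open>simp add: pos_le_divide_eq\<close>)
    show "\<forall>\<^sub>F N in sequentially. (real (Suc N))\<^sup>2 / ?H N \<le> real c * (1 + inverse (?H N))"
    proof (use pos in eventually_elim)
      fix N assume p: "?H N > 0"
      have "(real (Suc N))\<^sup>2 / ?H N \<le> real c * (?H N + 1) / ?H N" using H(2)[of N] p by (intro divide_right_mono) auto
      also have "\<dots> = real c * (1 + inverse (?H N))" using p by (simp add: field_simps)
      finally show "(real (Suc N))\<^sup>2 / ?H N \<le> real c * (1 + inverse (?H N))" .
    qed
  qed
qed

text \<open>The approximants and their limits may depend on the tolerance; only the lower bound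
  \<kappa> is common to all. Eventual closeness to convergent sequences makes \<open>a\<close>
  Cauchy, and the limit inherits the bound.\<close>

lemma convergent_by_approximation:
  fixes a :: "nat \<Rightarrow> real"
  assumes "\<And>e. e > 0 \<Longrightarrow> \<exists>b \<Lambda>. b \<longlonglongrightarrow> \<Lambda> \<and> \<Lambda> \<ge> \<kappa> \<and> (\<forall>\<^sub>F n in sequentially. \<bar>a n - b n\<bar> \<le> e)"
  shows "\<exists>L\<ge>\<kappa>. a \<longlonglongrightarrow> L"
proof -
  have near: "\<exists>\<Lambda>\<ge>\<kappa>. \<forall>\<^sub>F n in sequentially. \<bar>a n - \<Lambda>\<bar> \<le> 2 * e" if e: "e > 0" for e
  proof -
    obtain b \<Lambda> where b: "b \<longlonglongrightarrow> \<Lambda>" "\<Lambda> \<ge> \<kappa>" "\<forall>\<^sub>F n in sequentially. \<bar>a n - b n\<bar> \<le> e" using assms[OF e] by blast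
    have "\<forall>\<^sub>F n in sequentially. dist (b n) \<Lambda> < e" using b(1) e by (rule tendstoD)
    then have "\<forall>\<^sub>F n in sequentially. \<bar>a n - \<Lambda>\<bar> \<le> 2 * e"
      using b(3) by eventually_elim (auto simp: dist_real_def)
    then show ?thesis using b(2) by blast
  qed
  have "Cauchy a"
  proof (rule CauchyI)
    fix e :: real assume "e > 0"
    then obtain \<Lambda> where "\<forall>\<^sub>F n in sequentially. \<bar>a n - \<Lambda>\<bar> \<le> 2 * (e / 8)" using near[of "e / 8"] by auto
    then obtain M where M: "\<And>n. n \<ge> M \<Longrightarrow> \<bar>a n - \<Lambda>\<bar> \<le> 2 * (e / 8)" by (auto simp: eventually_sequentially)
    have "norm (a m - a n) < e" if "m \<ge> M" "n \<ge> M" for m n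
    proof -
      have "\<bar>a m - a n\<bar> \<le> \<bar>a m - \<Lambda>\<bar> + \<bar>a n - \<Lambda>\<bar>" by linarith
      then show ?thesis using M[OF that(1)] M[OF that(2)] \<open>e > 0\<close> by (simp add: real_norm_def)
    qed
    then show "\<exists>M. \<forall>m\<ge>M. \<forall>n\<ge>M. norm (a m - a n) < e" by blast
  qed
  then obtain L where L: "a \<longlonglongrightarrow> L" using Cauchy_convergent convergent_def by blast
  have "L \<ge> \<kappa> - e" if e: "e > 0" for e
  proof -
    have e2: "e / 2 > 0" using e by simp
    obtain \<Lambda> where \<Lambda>: "\<Lambda> \<ge> \<kappa>" "\<forall>\<^sub>F n in sequentially. \<bar>a n - \<Lambda>\<bar> \<le> 2 * (e / 2)" using near[OF e2] by blast
    then have "\<forall>\<^sub>F n in sequentially. \<kappa> - e \<le> a n" by (auto elim!: eventually_mono)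
    then show ?thesis using L by (intro tendsto_lowerbound[of a L sequentially]) auto
  qed
  then have "\<kappa> \<le> L + e" if "e > 0" for e using that by fastforce
  then have "L \<ge> \<kappa>" by (rule field_le_epsilon)
  then show ?thesis using L by blast
qed

text \<open>Removing \<open>gcd q P\<close> strictly shrinks \<open>q\<close> as long as it is not
  1, so fewer than \<open>q\<close> removals are needed; this explains the crude exponent.\<close>

lemma coprime_part_exists:
  fixes q P :: nat
  assumes "q > 0"
  shows "\<exists>q1 q2. q = q1 * q2 \<and> q1 dvd P ^ q \<and> coprime q2 P"
  using assms
proof (induction q rule: less_induct)
  case (less q)
  define g where "g = gcd q P"
  show ?case
  proof (cases "g = 1")
    case True
    then have "coprime q P" by (simp add: g_def coprime_iff_gcd_eq_1)
    then show ?thesis by (intro exI[of _ 1] exI[of _ q]) simp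
  next
    case False
    have g0: "g > 0" using less.prems by (simp add: g_def)
    define q' where "q' = q div g"
    have q: "q = g * q'" by (simp add: q'_def g_def)
    have "g > 1" using False g0 by simp
    moreover have q'0: "q' > 0" using q less.prems by (intro gr0I) simp
    ultimately have lt: "q' < q" unfolding q by simp
    from less.IH[OF lt q'0] obtain q1 q2 where q12: "q' = q1 * q2" "q1 dvd P ^ q'" "coprime q2 P" by blast
    have "g * q1 dvd P * P ^ q'" using q12(2) by (intro mult_dvd_mono) (simp_all add: g_def)
    also have "P * P ^ q' = P ^ Suc q'" by simp
    also have "P ^ Suc q' dvd P ^ q" using lt by (intro le_imp_power_dvd) simp
    finally show ?thesis using q12 q by (intro exI[of _ "g * q1"] exI[of _ q2]) simp
  qed
qed

lemma powr_tail_small: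
  fixes s e :: real
  assumes s: "s < -1" and e: "e > 0"
  shows "\<exists>Q. \<forall>n. (\<Sum>q\<in>{Q<..n}. real q powr s) \<le> e"
proof -
  let ?f = "\<lambda>q :: nat. real q powr s"
  have sm: "summable ?f" using s by (simp add: summable_real_powr_iff)
  have "(\<lambda>n. \<Sum>k\<le>n. ?f k) \<longlonglongrightarrow> suminf ?f" using sm by (rule summable_LIMSEQ')
  then obtain Q where Q: "\<forall>n\<ge>Q. norm ((\<Sum>k\<le>n. ?f k) - suminf ?f) < e" using e LIMSEQ_D by blast
  have "(\<Sum>q\<in>{Q<..n}. ?f q) \<le> e" for n
  proof (cases "Q \<le> n")
    case True
    have "(\<Sum>k\<le>n. ?f k) = (\<Sum>k\<le>Q. ?f k) + (\<Sum>q\<in>{Q<..n}. ?f q)"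
    proof -
      have "{..n} = {..Q} \<union> {Q<..n}" using True by auto
      moreover have "(\<Sum>k\<in>{..Q} \<union> {Q<..n}. ?f k) = (\<Sum>k\<le>Q. ?f k) + (\<Sum>q\<in>{Q<..n}. ?f q)"
        by (rule sum.union_disjoint) auto
      ultimately show ?thesis by (simp only:)
    qed
    moreover have "(\<Sum>k\<le>n. ?f k) \<le> suminf ?f" using sm by (intro sum_le_suminf) auto
    moreover have "\<bar>(\<Sum>k\<le>Q. ?f k) - suminf ?f\<bar> < e" using Q by simp
    ultimately show ?thesis by linarith
  qed (use e in simp)
  then show ?thesis by blast
qed

lemma powr_sum_bounded:
  fixes s :: real
  assumes s: "s < -1"
  shows "(\<Sum>q\<in>{1..n}. real q powr s) \<le> (\<Sum>q. real q powr s)"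
  using s by (intro sum_le_suminf) (auto simp: summable_real_powr_iff)

text \<open>The modulus splits as \<open>M1 * M2\<close>: \<open>M1\<close> carries the primes up to
  \<open>P0\<close> and is handled by lifting, \<open>M2\<close> is prime to them and is handled by
  complete sums. Either bound is a fixed proportion of the expected count, so \<kappa> does not
  depend on \<open>K\<close>, however divisible \<open>M\<close> becomes.\<close>

lemma local_factor_lower:
  fixes l :: "'s::finite \<Rightarrow> int" and i0 i1 :: 's
  assumes l0: "\<forall>i. l i \<noteq> 0" and i: "i0 \<noteq> i1" and r: "CARD('d::finite) * (CARD('s) - 2) \<ge> 5"
    and loc: "\<And>p. prime p \<Longrightarrow> \<exists>v. local_datum l TYPE('d) (p ^ v) p"
  shows "\<exists>\<kappa>>0. \<forall>K. \<exists>M m. M \<ge> 1 \<and> m > 0 \<and> int m = int M * (l i0)\<^sup>2 \<and> (\<forall>q\<in>{1..K}. q dvd M) \<and>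
    \<kappa> \<le> real M * ((\<Sum>y\<in>ibox m. of_bool (hcond l i0 M (y :: 's \<times> 'd \<Rightarrow> int))) / real m ^ CARD('s \<times> 'd))"
proof -
  let ?n = "CARD('s \<times> 'd)"
  obtain Q where Q: "\<And>n. (\<Sum>q\<in>{Q<..n}. real q powr (-3/2)) \<le> 1 / 2"
    using powr_tail_small[of "-3/2" "1/2"] by auto
  \<comment> \<open>Beyond \<open>Q\<close> the tail of the series is at most \<open>1/2\<close>;
    beyond all \<open>2 * \<bar>l i\<bar>\<close> a divisor of \<open>M2\<close> cannot divide
    \<open>2 * l i\<close>.\<close>
  define P0 where "P0 = max Q (\<Sum>i\<in>UNIV. nat (2 * \<bar>l i\<bar>))"
  have tail: "(\<Sum>q\<in>{P0<..n}. real q powr (-3/2)) \<le> 1 / 2" for n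
  proof -
    have "(\<Sum>q\<in>{P0<..n}. real q powr (-3/2)) \<le> (\<Sum>q\<in>{Q<..n}. real q powr (-3/2))"
      by (rule sum_mono2) (auto simp: P0_def)
    then show ?thesis using Q[of n] by linarith
  qed
  have lP0: "nat (2 * \<bar>l i\<bar>) \<le> P0" for i
    unfolding P0_def by (rule max.coboundedI2, rule member_le_sum) auto
  define A where "A = {p. prime p \<and> p \<le> P0}"
  have A: "finite A" "\<And>p. p \<in> A \<Longrightarrow> prime p" by (auto simp: A_def)
  define P where "P = \<Prod>A"
  have P0: "P > 0" unfolding P_def using A by (intro prod_pos) (auto simp: prime_gt_0_nat)
  have small: "p dvd P" if "prime p" "p \<le> P0" for p
    unfolding P_def by (rule dvd_prodI[of A p "\<lambda>p. p", OF A(1)]) (use that in \<open>simp add: A_def\<close>)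
  obtain V k where V: "V > 0" "V dvd P ^ k" "local_datum l TYPE('d) V P"
    using local_datum_exists[OF A(1) A(2) loc[OF A(2)]] unfolding P_def by blast
  obtain x \<gamma> :: "'s \<times> 'd \<Rightarrow> int" and b where x: "\<And>j. (\<Sum>i\<in>UNIV. l i * x (i, j)) = 0" "\<And>j. (\<Sum>i\<in>UNIV. l i * \<gamma> (i, j)) = 0"
     "2 * bform l x \<gamma> = int V * b" "coprime b (int P)" "int (V\<^sup>2 * P) dvd qform l x"
    using V(3) unfolding local_datum_def by blast
  define e where "e = V\<^sup>2 * P"
  have e0: "e > 0" using V P0 by (simp add: e_def)
  define a0 where "a0 = nat \<bar>l i0\<bar>"
  have a0: "int a0 = \<bar>l i0\<bar>" "a0 > 0" "int (a0\<^sup>2) = (l i0)\<^sup>2" using l0 by (simp_all add: a0_def)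
  define E where "E = a0 * e"
  have E0: "E > 0" using a0 e0 by (simp add: E_def)
  \<comment> \<open>Lifting keeps the proportion of one residue class mod \<open>E\<close> in every
    coordinate; the complete sums lose a factor 2.\<close>
  define \<kappa> where "\<kappa> = (1 / real E) ^ ?n / 2"
  have \<kappa>: "\<kappa> > 0" using E0 by (simp add: \<kappa>_def)
  have "\<exists>M m. M \<ge> 1 \<and> m > 0 \<and> int m = int M * (l i0)\<^sup>2 \<and> (\<forall>q\<in>{1..K}. q dvd M) \<and>
    \<kappa> \<le> real M * ((\<Sum>y\<in>ibox m. of_bool (hcond l i0 M (y :: 's \<times> 'd \<Rightarrow> int))) / real m ^ ?n)" for K
  proof -
    \<comment> \<open>The factor \<open>e\<close> makes \<open>E\<close> divide \<open>m1\<close>,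
      and \<open>P ^ K\<close> absorbs the part of every \<open>q \<le> K\<close> composed of primes
      dividing \<open>P\<close>.\<close>
    define M1 where "M1 = e * P ^ K"
    define J where "J = {n \<in> {1..K}. coprime n P}"
    define M2 where "M2 = \<Prod>J"
    have finJ: "finite J" by (simp add: J_def)
    have M10: "M1 > 0" using e0 P0 by (simp add: M1_def)
    have M20: "M2 > 0" unfolding M2_def by (rule prod_pos) (auto simp: J_def)
    have cM2: "coprime M2 P" unfolding M2_def by (rule prod_coprime_left) (auto simp: J_def)
    have M1P: "M1 dvd P ^ (k * 2 + 1 + K)"
    proof -
      have "V\<^sup>2 dvd (P ^ k)\<^sup>2" using V(2) by (rule dvd_power_same)
      then have "V\<^sup>2 * P * P ^ K dvd (P ^ k)\<^sup>2 * P * P ^ K" by (intro mult_dvd_mono) simp_all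
      also have "(P ^ k)\<^sup>2 * P * P ^ K = P ^ (k * 2 + 1 + K)" by (simp add: power_add power_mult)
      finally show ?thesis by (simp add: M1_def e_def)
    qed
    have dvdM: "q dvd M1 * M2" if q: "q \<in> {1..K}" for q
    proof -
      obtain q1 q2 where q12: "q = q1 * q2" "q1 dvd P ^ q" "coprime q2 P" using coprime_part_exists[of q P] q by auto
      have "q2 \<noteq> 0" using q12(1) q by auto
      moreover have "q2 \<le> q" using q12(1) q by (intro dvd_imp_le) auto
      ultimately have "q2 \<in> J" using q q12(3) by (simp add: J_def)
      then have "q2 dvd M2" unfolding M2_def by (rule dvd_prodI[of J q2 "\<lambda>q. q", OF finJ])
      moreover have "q1 dvd M1"
      proof -
        have "P ^ q dvd P ^ K" using q by (intro le_imp_power_dvd) simp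
        then show ?thesis unfolding M1_def using q12(2) by (meson dvd_mult dvd_trans)
      qed
      ultimately show ?thesis unfolding q12(1) by (intro mult_dvd_mono)
    qed
    have big: "q > P0" if q: "q dvd M2" "q > 1" for q
    proof (rule ccontr)
      assume "\<not> q > P0"
      obtain p where p: "prime p" "p dvd q" using q(2) prime_factor_nat[of q] by auto
      have "p \<le> q" using p(2) q(2) by (intro dvd_imp_le) auto
      then have "p dvd P" using \<open>\<not> q > P0\<close> p(1) by (intro small) auto
      moreover have "p dvd M2" using p(2) q(1) by (rule dvd_trans)
      ultimately have "is_unit p" using cM2 by (meson coprime_common_divisor)
      then show False using p(1) not_prime_unit by blast
    qed
    have cl: "coprime (int M2) (2 * l i)" for i
    proof (rule ccontr)
      assume nc: "\<not> coprime (int M2) (2 * l i)"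
      define g where "g = nat (gcd (int M2) (2 * l i))"
      have gi: "int g = gcd (int M2) (2 * l i)" by (simp add: g_def)
      have "int g \<noteq> 1" using nc by (simp add: gi coprime_iff_gcd_eq_1)
      moreover have "int g \<noteq> 0" using M20 by (simp add: gi)
      ultimately have "g > 1" by linarith
      moreover have "int g dvd int M2" unfolding gi by (rule gcd_dvd1)
      then have "g dvd M2" by simp
      ultimately have "g > P0" by (intro big)
      moreover have "int g dvd 2 * l i" unfolding gi by (rule gcd_dvd2)
      then have "int g \<le> \<bar>2 * l i\<bar>" using l0 by (intro zdvd_imp_le[of "int g" "\<bar>2 * l i\<bar>"]) auto
      then have "g \<le> nat (2 * \<bar>l i\<bar>)" by (simp add: abs_mult)
      ultimately show False using lP0[of i] by linarith
    qed
    define m1 where "m1 = M1 * a0\<^sup>2"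
    have m1: "int m1 = int M1 * (l i0)\<^sup>2" using a0(3) by (simp only: m1_def of_nat_mult)
    have m10: "m1 > 0" using M10 a0 by (simp add: m1_def)
    have cop: "coprime (int M2) (int M1 * (l i0)\<^sup>2)"
    proof -
      have "coprime M2 (P ^ (k * 2 + 1 + K))" using cM2 by simp
      then have "coprime M2 M1" using M1P by (meson coprime_divisors dvd_refl)
      moreover have "coprime (int M2) (l i0)" using cl[of i0] by (simp only: coprime_mult_right_iff)
      ultimately show ?thesis by simp
    qed
    then have "coprime (int M2) (int m1)" by (simp only: m1)
    then have copm: "coprime m1 M2" by (simp only: coprime_int_iff coprime_commute)
    define M m where "M = M1 * M2" and "m = m1 * M2"
    have m: "int m = int M * (l i0)\<^sup>2" by (simp add: m_def M_def m1)
    let ?h1 = "\<lambda>y :: 's \<times> 'd \<Rightarrow> int. of_bool (hcond l i0 M1 y) :: real"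
    let ?h2 = "\<lambda>y :: 's \<times> 'd \<Rightarrow> int. of_bool (int M2 dvd qform l (cmpl l i0 y)) :: real"
    have per2: "?h2 (\<lambda>k. y k mod int M2) = ?h2 y" for y
    proof -
      have "int M2 dvd qform l (cmpl l i0 (\<lambda>k. y k mod int M2)) - qform l (cmpl l i0 y)"
        by (intro qform_cong_dvd cmpl_cong_dvd) (simp add: mod_eq_dvd_iff[symmetric])
      then show ?thesis by (simp only: dvd_iff_of_dvd_diff)
    qed
    have "(\<Sum>y\<in>ibox m. of_bool (hcond l i0 M (y :: 's \<times> 'd \<Rightarrow> int)) :: real) = (\<Sum>y\<in>ibox (m1 * M2). ?h1 y * ?h2 y)"
      unfolding m_def M_def hcond_mult[of M2 M1 l i0, OF cop] by (intro sum.cong refl) (simp add: of_bool_conj)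
    also have "\<dots> = (\<Sum>y\<in>ibox m1. ?h1 y) * (\<Sum>y\<in>ibox M2. ?h2 y)"
      by (rule sum_ibox_coprime[of m1 M2 ?h1 ?h2, OF m10 M20 copm _ per2]) (simp only: hcond_mod[of m1 M1 l i0, OF m1])
    finally have prod: "(\<Sum>y\<in>ibox m. of_bool (hcond l i0 M (y :: 's \<times> 'd \<Rightarrow> int)) :: real) = (\<Sum>y\<in>ibox m1. ?h1 y) * (\<Sum>y\<in>ibox M2. ?h2 y)" .
    have E: "int E = \<bar>l i0\<bar> * int (V\<^sup>2 * P)" by (simp only: E_def e_def of_nat_mult a0(1))
    have "E dvd m1" by (simp add: E_def m1_def M1_def power2_eq_square mult_ac)
    from local_density_lower[where ?i0.0 = i0 and l = l and x = x and \<gamma> = \<gamma> and V = V and P = P and M = M1 and m = m1 and E = E and b = b, OF _ x M10 M1P m1 E E0 this]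
    have 1: "(real m1 / real E) ^ ?n \<le> real M1 * (\<Sum>y\<in>ibox m1. ?h1 y)" using l0 by blast
    have 2: "real M2 ^ ?n / 2 \<le> real M2 * (\<Sum>y\<in>ibox M2. ?h2 y)"
      by (rule complete_sum_lower[OF M20 cl i r big tail])
    have "\<kappa> * real m ^ ?n = (real m1 / real E) ^ ?n * (real M2 ^ ?n / 2)"
      by (simp add: \<kappa>_def m_def power_mult_distrib power_divide)
    also have "\<dots> \<le> (real M1 * (\<Sum>y\<in>ibox m1. ?h1 y)) * (real M2 * (\<Sum>y\<in>ibox M2. ?h2 y))"
      using 1 2 by (intro mult_mono) (auto intro!: mult_nonneg_nonneg sum_nonneg)
    also have "\<dots> = real M * (\<Sum>y\<in>ibox m. of_bool (hcond l i0 M (y :: 's \<times> 'd \<Rightarrow> int)))"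
      unfolding prod by (simp only: M_def of_nat_mult mult_ac)
    finally have fin: "\<kappa> * real m ^ ?n \<le> real M * (\<Sum>y\<in>ibox m. of_bool (hcond l i0 M (y :: 's \<times> 'd \<Rightarrow> int)))" .
    have m0: "m > 0" using m10 M20 by (simp add: m_def)
    then have "real m ^ ?n > 0" by simp
    then have "\<kappa> \<le> (real M * (\<Sum>y\<in>ibox m. of_bool (hcond l i0 M (y :: 's \<times> 'd \<Rightarrow> int)))) / real m ^ ?n"
      using fin by (simp only: pos_le_divide_eq)
    then have "\<kappa> \<le> real M * ((\<Sum>y\<in>ibox m. of_bool (hcond l i0 M (y :: 's \<times> 'd \<Rightarrow> int))) / real m ^ ?n)"
      by (simp only: times_divide_eq_right)
    moreover have "M \<ge> 1" using M10 M20 by (simp add: M_def)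
    moreover have "\<forall>q\<in>{1..K}. q dvd M" using dvdM by (simp add: M_def)
    ultimately show ?thesis using m0 m by blast
  qed
  then show ?thesis using \<kappa> by blast
qed

subsection \<open>The asymptotic formula\<close>

text \<open>For a given tolerance, \<open>T\<close> is taken large enough for the
  \<open>T powr (-1/4)\<close> error and for the real lower bound, and \<open>M\<close> divisible by
  all \<open>q \<le> Q\<close> for the tail error; with both fixed,
  \<open>H = N\<^sup>2 div (T * M)\<close> keeps the tent parameter converging to \<open>T\<close>.
  The resulting limits are all at least \<open>\<kappa> * c\<close>, which is what makes the limit
  positive.\<close>

lemma sys_points_asymptotics:
  fixes lam :: "int ^ 's::finite" and x :: "real ^ ('s \<times> 'd::finite)"
  defines "l \<equiv> ($) lam"
  assumes nz: "\<forall>i. lam $ i \<noteq> 0" and pos: "\<forall>c. x $ c > 0" and ns: "nonsingular_real_solution lam x"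
    and pad: "\<forall>p::nat. prime p \<longrightarrow> (\<exists>x :: 's \<times> 'd \<Rightarrow> padic. nonsingular_padic_solution p lam x)"
    and s: "CARD('s) \<ge> 2" and r: "CARD('d) * (CARD('s) - 2) \<ge> 5"
    and D: "D + (CARD('d) + 2) = CARD('d) * CARD('s)"
  shows "\<exists>\<Lambda>>0. (\<lambda>N. real (card {x \<in> sys_points l (Suc N). qform l (x :: 's \<times> 'd \<Rightarrow> int) = 0}) / real (Suc N) ^ D) \<longlonglongrightarrow> \<Lambda>"
proof -
  have l0: "\<forall>i. l i \<noteq> 0" using nz by (simp add: l_def)
  obtain i0 i1 :: 's where i01: "i0 \<noteq> i1"
  proof -
    obtain B where "B \<subseteq> (UNIV :: 's set)" "card B = 2" using obtain_subset_with_card_n[OF s] by blast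
    then show thesis using that unfolding card_2_iff by blast
  qed
  have li0: "l i0 \<noteq> 0" using l0 by blast
  define L where "L = (\<Sum>i\<in>UNIV. nat (2 * \<bar>l i\<bar>))"
  have L: "\<forall>i. 2 * \<bar>l i\<bar> \<le> int L"
  proof
    fix i
    have "nat (2 * \<bar>l i\<bar>) \<le> L" unfolding L_def by (rule member_le_sum) auto
    then show "2 * \<bar>l i\<bar> \<le> int L" by linarith
  qed
  from kernel_error[where 's = 's and 'd = 'd, OF l0 L s r] obtain C where C: "C > 0" and
    CB: "\<forall>N\<ge>1. \<forall>M\<ge>1. \<forall>H\<ge>1. \<forall>T>0. real M * real H * T \<le> (real N)\<^sup>2 \<longrightarrow>
    \<bar>real (card {x \<in> sys_points l N. qform l (x :: 's \<times> 'd \<Rightarrow> int) = 0})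
       - (\<Sum>x\<in>sys_points l N. kcount M H (qform l (x :: 's \<times> 'd \<Rightarrow> int)))\<bar>
    \<le> C * (real N ^ (CARD('d) * (CARD('s) - 1)) / (real N)\<^sup>2) *
       (T powr (-1/4) * (\<Sum>q\<in>{1..2*L*N}. real q powr (-5/4)) + (\<Sum>q\<in>{q\<in>{1..2*L*N}. \<not> q dvd M}. real q powr (-5/4)))"
    by (elim exE conjE)
  have loc: "\<exists>v. local_datum l TYPE('d) (p ^ v) p" if "prime p" for p
    using pad that local_datum_prime[OF that nz] unfolding l_def by blast
  obtain \<kappa> where \<kappa>: "\<kappa> > 0" and \<kappa>M: "\<forall>K. \<exists>M m. M \<ge> 1 \<and> m > 0 \<and> int m = int M * (l i0)\<^sup>2 \<and> (\<forall>q\<in>{1..K}. q dvd M) \<and>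
    \<kappa> \<le> real M * ((\<Sum>y\<in>ibox m. of_bool (hcond l i0 M (y :: 's \<times> 'd \<Rightarrow> int))) / real m ^ CARD('s \<times> 'd))"
    by (rule exE[OF local_factor_lower[where 'd = 'd, OF l0 i01 r]]) (erule loc, elim conjE, rule that)
  obtain c T0 where c: "c > 0" and cT: "\<forall>T\<ge>T0. integral\<^sup>L lborel (rdens l i0 T :: real ^ ('s \<times> 'd) \<Rightarrow> real) \<ge> c"
    using real_density_lower[OF nz pos ns, of i0] unfolding l_def by blast
  define S where "S = (\<Sum>q. real q powr (-5/4))"
  have S: "(\<Sum>q\<in>{1..n}. real q powr (-5/4)) \<le> S" for n unfolding S_def by (rule powr_sum_bounded) simp
  have S0: "S \<ge> 0" using S[of 0] by simp
  have De: "CARD('d) * (CARD('s) - 1) = D + 2"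
    using D s by (cases "CARD('s)") (auto simp: algebra_simps)
  let ?R = "\<lambda>N. real (card {x \<in> sys_points l N. qform l (x :: 's \<times> 'd \<Rightarrow> int) = 0})"
  let ?K = "\<lambda>M H N. (\<Sum>x\<in>sys_points l N. kcount M H (qform l (x :: 's \<times> 'd \<Rightarrow> int)))"
  have "\<exists>\<Lambda>\<ge>\<kappa> * c. (\<lambda>N. ?R (Suc N) / real (Suc N) ^ D) \<longlonglongrightarrow> \<Lambda>"
  proof (rule convergent_by_approximation)
    fix e :: real assume e: "e > 0"
    have "((\<lambda>T. C * S * T powr (-1/4)) \<longlongrightarrow> C * S * 0) at_top"
      by (intro tendsto_intros tendsto_neg_powr filterlim_ident) simp
    then have "\<forall>\<^sub>F T in at_top. C * S * T powr (-1/4) < e / 2"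
      using e by (intro order_tendstoD(2)) auto
    then obtain T1 where T1: "\<forall>T\<ge>T1. C * S * T powr (-1/4) < e / 2" by (auto simp: eventually_at_top_linorder)
    obtain T :: nat where "real T > max 1 (max T0 T1)" using reals_Archimedean2 by blast
    then have T: "real T > 1" "real T \<ge> T0" "real T \<ge> T1" by auto
    have Tpos: "T > 0" using T(1) by simp
    obtain Q where Q: "\<forall>n. (\<Sum>q\<in>{Q<..n}. real q powr (-5/4)) \<le> e / (2 * C)"
      using powr_tail_small[of "-5/4" "e / (2 * C)"] e C by auto
    from \<kappa>M[THEN spec, of Q] obtain M m where M: "M \<ge> 1" "m > 0" "int m = int M * (l i0)\<^sup>2" "\<forall>q\<in>{1..Q}. q dvd M"
      "\<kappa> \<le> real M * ((\<Sum>y\<in>ibox m. of_bool (hcond l i0 M (y :: 's \<times> 'd \<Rightarrow> int))) / real m ^ CARD('s \<times> 'd))"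
      by (elim exE conjE)
    have TM: "T * M > 0" using Tpos M(1) by simp
    define H where "H N = N\<^sup>2 div (T * M)" for N :: nat
    have MHT: "real M * real (H N) * real T \<le> (real N)\<^sup>2" for N
    proof -
      have "M * H N * T \<le> N\<^sup>2" using times_div_less_eq_dividend[of "T * M" "N\<^sup>2"] by (simp add: H_def mult_ac)
      then have "real (M * H N * T) \<le> real (N\<^sup>2)" by (rule of_nat_mono)
      then show ?thesis by simp
    qed
    have H1: "H N \<ge> 1" if "N \<ge> T * M" for N
    proof -
      have "T * M \<le> N * N" using that le_square[of N] by linarith
      then have "T * M div (T * M) \<le> H N" unfolding H_def power2_eq_square by (rule div_le_mono)
      then show ?thesis using TM by simp
    qed
    define t where "t N = (real N)\<^sup>2 / (real M * real (H N))" for N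
    define F where "F N = (rdens l i0 (t N) :: real ^ ('s \<times> 'd) \<Rightarrow> real)" for N
    have tlim: "(\<lambda>N. t (Suc N)) \<longlonglongrightarrow> real T"
    proof -
      have "(\<lambda>N. (real (Suc N))\<^sup>2 / real ((Suc N)\<^sup>2 div (T * M)) / real M) \<longlonglongrightarrow> real (T * M) / real M"
        using M(1) by (intro tendsto_divide square_div_tendsto[OF TM] tendsto_const) simp
      then show ?thesis using M(1) by (simp add: t_def H_def divide_divide_eq_left mult.commute)
    qed
    \<comment> \<open>Any bound independent of \<open>N\<close> serves for dominated convergence, so
      a spare factor \<open>M\<close> is tolerated. For \<open>H N = 0\<close> division by zero
      yields \<open>t N = 0\<close>.\<close>
    have tb: "0 \<le> t N \<and> t N \<le> 2 * real (T * M)" for N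
    proof (cases "H N = 0")
      case True
      then show ?thesis by (simp add: t_def)
    next
      case False
      have "N\<^sup>2 \<le> T * M * (H N + 1)"
        using dividend_less_div_times[OF TM, of "N\<^sup>2"] by (simp add: H_def algebra_simps)
      also have "\<dots> \<le> T * M * (2 * H N)" using False by (intro mult_le_mono2) simp
      also have "\<dots> \<le> M * (T * M * (2 * H N))" using M(1) by simp
      finally have "real (N\<^sup>2) \<le> real (M * (T * M * (2 * H N)))" by (rule of_nat_mono)
      then have "(real N)\<^sup>2 \<le> 2 * real (T * M) * (real M * real (H N))" by (simp add: mult_ac)
      moreover have "real M * real (H N) > 0" using False M(1) by simp
      ultimately show ?thesis unfolding t_def by (simp only: pos_divide_le_eq) simp
    qed
    define h where "h y = (of_bool (hcond l i0 M (y :: 's \<times> 'd \<Rightarrow> int)) :: real)" for y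
    have "(\<lambda>N. (\<Sum>y\<in>pbox (Suc N). h y * F (Suc N) (vreal y /\<^sub>R real (Suc N))) / real (Suc N) ^ CARD('s \<times> 'd))
      \<longlonglongrightarrow> (\<Sum>y\<in>ibox m. h y) / real m ^ CARD('s \<times> 'd) * integral\<^sup>L lborel (rdens l i0 (real T) :: real ^ ('s \<times> 'd) \<Rightarrow> real)"
    proof (rule riemann_sum_periodic)
      show "m > 0" by (rule M(2))
      show "h (\<lambda>k. y k mod int m) = h y" for y unfolding h_def by (simp only: hcond_mod[of m M l i0, OF M(3)])
      show "\<bar>F N r\<bar> \<le> 2 * real (T * M)" for N r
      proof -
        have "\<bar>tent (t N) u\<bar> \<le> t N" for u
        proof -
          have "t N * max 0 (1 - t N * \<bar>u\<bar>) \<le> t N * 1" using tb[of N] by (intro mult_left_mono) auto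
          then show ?thesis using tb[of N] by (simp add: tent_def)
        qed
        then show ?thesis using tb[of N] unfolding F_def rdens_def by (auto simp: indicator_def intro: order_trans)
      qed
      show "\<forall>k. 0 < r $ k \<and> r $ k \<le> 1" if "F N r \<noteq> 0" for N r
      proof -
        have "r \<in> rbox l i0" using that unfolding F_def rdens_def by (auto simp: indicator_def split: if_splits)
        then show ?thesis unfolding rbox_def by blast
      qed
      show "rdens l i0 (real T) \<in> borel_measurable borel" by (rule rdens_borel)
      have reg: "AE r :: real ^ ('s \<times> 'd) in lborel. (\<forall>c. r $ c \<noteq> 0 \<and> r $ c \<noteq> 1) \<and> (\<forall>j. rx l i0 r (i0, j) \<noteq> 0 \<and> rx l i0 r (i0, j) \<noteq> 1)"
        by (rule ae_regular_point[OF l0 i01[symmetric]])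
      show "AE r in lborel. \<forall>\<rho>. \<rho> \<longlonglongrightarrow> r \<longrightarrow> (\<lambda>N. F (Suc N) (\<rho> N)) \<longlonglongrightarrow> rdens l i0 (real T) r"
        using reg by (rule AE_mp) (intro AE_I2 impI allI, unfold F_def, elim conjE, rule rdens_tendsto[OF _ _ _ tlim])
    qed
    then have "(\<lambda>N. real M * ((\<Sum>y\<in>pbox (Suc N). h y * F (Suc N) (vreal y /\<^sub>R real (Suc N))) / real (Suc N) ^ CARD('s \<times> 'd)))
      \<longlonglongrightarrow> real M * ((\<Sum>y\<in>ibox m. h y) / real m ^ CARD('s \<times> 'd) * integral\<^sup>L lborel (rdens l i0 (real T) :: real ^ ('s \<times> 'd) \<Rightarrow> real))"
      (is "?f \<longlonglongrightarrow> ?\<Lambda>") by (intro tendsto_intros)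
    moreover have "\<kappa> * c \<le> ?\<Lambda>"
    proof -
      have "\<kappa> * c \<le> real M * ((\<Sum>y\<in>ibox m. h y) / real m ^ CARD('s \<times> 'd)) * integral\<^sup>L lborel (rdens l i0 (real T) :: real ^ ('s \<times> 'd) \<Rightarrow> real)"
      proof (rule mult_mono)
        show "\<kappa> \<le> real M * ((\<Sum>y\<in>ibox m. h y) / real m ^ CARD('s \<times> 'd))" using M(5) by (simp only: h_def)
        show "c \<le> integral\<^sup>L lborel (rdens l i0 (real T) :: real ^ ('s \<times> 'd) \<Rightarrow> real)" using cT T(2) by blast
        show "0 \<le> real M * ((\<Sum>y\<in>ibox m. h y) / real m ^ CARD('s \<times> 'd))" using M(5) \<kappa> unfolding h_def by linarith
      qed (use c in simp)
      then show ?thesis by (simp only: mult.assoc)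
    qed
    moreover have "\<forall>\<^sub>F N in sequentially. \<bar>?R (Suc N) / real (Suc N) ^ D - ?f N\<bar> \<le> e"
      unfolding eventually_sequentially
    proof (intro exI allI impI)
      fix n assume n: "n \<ge> T * M"
      define N where "N = Suc n"
      have N1: "N \<ge> 1" and HN: "H N \<ge> 1" using n H1[of N] by (simp_all add: N_def)
      have NR: "real N > 0" using N1 by simp
      \<comment> \<open>The exponents match because \<open>s * d = D + d + 2\<close>: the
        \<open>d\<close> belongs to the dummy row and the 2 to the factor
        \<open>M / N\<^sup>2\<close>.\<close>
      have fK: "?f n = ?K M (H N) N / real N ^ D"
      proof -
        have "real N ^ CARD('d) * ?K M (H N) N = real M / (real N)\<^sup>2 * (\<Sum>y\<in>pbox N. h y * F N (vreal y /\<^sub>R real N))"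
          using kernel_sum_eq[where 'd = 'd and l = l and ?i0.0 = i0, OF li0 N1 HN M(1)] by (simp only: h_def F_def t_def)
        moreover have "real N ^ CARD('s \<times> 'd) = real N ^ D * real N ^ CARD('d) * (real N)\<^sup>2"
          using D by (simp flip: power_add add: mult.commute[of "CARD('s)"] add.assoc)
        ultimately show ?thesis unfolding N_def[symmetric] using NR by (simp add: field_simps)
      qed
      have tailM: "(\<Sum>q\<in>{q\<in>{1..2*L*N}. \<not> q dvd M}. real q powr (-5/4)) \<le> e / (2 * C)"
      proof -
        have "(\<Sum>q\<in>{q\<in>{1..2*L*N}. \<not> q dvd M}. real q powr (-5/4)) \<le> (\<Sum>q\<in>{Q<..2*L*N}. real q powr (-5/4))"
        proof (rule sum_mono2)
          show "{q\<in>{1..2*L*N}. \<not> q dvd M} \<subseteq> {Q<..2*L*N}"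
          proof
            fix q assume q: "q \<in> {q\<in>{1..2*L*N}. \<not> q dvd M}"
            then have "\<not> q \<le> Q" using M(4) by auto
            then show "q \<in> {Q<..2*L*N}" using q by simp
          qed
        qed auto
        then show ?thesis using Q by (meson order_trans)
      qed
      have "\<bar>?R N - ?K M (H N) N\<bar> \<le> C * (real N ^ (CARD('d) * (CARD('s) - 1)) / (real N)\<^sup>2) *
        (real T powr (-1/4) * (\<Sum>q\<in>{1..2*L*N}. real q powr (-5/4)) + (\<Sum>q\<in>{q\<in>{1..2*L*N}. \<not> q dvd M}. real q powr (-5/4)))"
        by (rule CB[rule_format, OF N1 M(1) HN _ MHT]) (use T(1) in simp)
      also have "\<dots> \<le> C * (real N ^ (CARD('d) * (CARD('s) - 1)) / (real N)\<^sup>2) * (real T powr (-1/4) * S + e / (2 * C))"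
        using S tailM C by (intro mult_left_mono add_mono) auto
      also have "real N ^ (CARD('d) * (CARD('s) - 1)) / (real N)\<^sup>2 = real N ^ D"
        unfolding De power_add using NR by simp
      also have "C * real N ^ D * (real T powr (-1/4) * S + e / (2 * C)) = real N ^ D * (C * S * real T powr (-1/4) + e / 2)"
        using C by (simp add: algebra_simps)
      also have "\<dots> \<le> real N ^ D * e"
      proof (rule mult_left_mono)
        have "C * S * real T powr (-1/4) < e / 2" using T1 T(3) by blast
        then show "C * S * real T powr (-1/4) + e / 2 \<le> e" by linarith
      qed simp
      finally have "\<bar>?R N - ?K M (H N) N\<bar> / real N ^ D \<le> e"
        using NR by (simp add: pos_divide_le_eq mult.commute)
      moreover have "?R N / real N ^ D - ?f n = (?R N - ?K M (H N) N) / real N ^ D"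
        unfolding fK by (simp only: diff_divide_distrib)
      ultimately have "\<bar>?R N / real N ^ D - ?f n\<bar> \<le> e" by simp
      then show "\<bar>?R (Suc n) / real (Suc n) ^ D - ?f n\<bar> \<le> e" unfolding N_def .
    qed
    ultimately show "\<exists>b \<Lambda>. b \<longlonglongrightarrow> \<Lambda> \<and> \<kappa> * c \<le> \<Lambda> \<and> (\<forall>\<^sub>F n in sequentially. \<bar>?R (Suc n) / real (Suc n) ^ D - b n\<bar> \<le> e)"
      by blast
  qed
  then obtain \<Lambda> where \<Lambda>: "\<Lambda> \<ge> \<kappa> * c" "(\<lambda>N. ?R (Suc N) / real (Suc N) ^ D) \<longlonglongrightarrow> \<Lambda>" by blast
  have "\<kappa> * c > 0" using \<kappa> c by (rule mult_pos_pos)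
  then have "\<Lambda> > 0" using \<Lambda>(1) by linarith
  then show ?thesis using \<Lambda>(2) by blast
qed

lemma num_solutions_eq_card:
  fixes lam :: "int ^ 's::finite"
  defines "l \<equiv> ($) lam"
  shows "num_solutions TYPE('d::finite) lam N = card {x \<in> sys_points l N. qform l (x :: 's \<times> 'd \<Rightarrow> int) = 0}"
  unfolding num_solutions_def
proof (rule bij_betw_same_card[of "($)"], rule bij_betw_byWitness[of _ vec_lambda])
  have eq: "lin_quad_system lam x = 0 \<longleftrightarrow> (\<forall>j. (\<Sum>i\<in>UNIV. l i * x $ (i, j)) = 0) \<and> qform l (($) x) = 0"
    for x :: "int ^ ('s \<times> 'd)"
  proof -
    have "qform l (($) x) = (\<Sum>i\<in>UNIV. l i * (\<Sum>j\<in>UNIV. (x $ (i, j))\<^sup>2))"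
      unfolding qform_def sum_pairs sum_distrib_left by (subst sum.swap) simp
    then show ?thesis
      by (auto simp: lin_quad_system_def vec_eq_iff split_option_all l_def)
  qed
  show "($) ` {x :: int ^ ('s \<times> 'd). (\<forall>c. x $ c \<in> {1..int N}) \<and> lin_quad_system lam x = 0} \<subseteq> {x \<in> sys_points l N. qform l x = 0}"
  proof (rule image_subsetI)
    fix x :: "int ^ ('s \<times> 'd)" assume "x \<in> {x. (\<forall>c. x $ c \<in> {1..int N}) \<and> lin_quad_system lam x = 0}"
    then show "($) x \<in> {x \<in> sys_points l N. qform l x = 0}" unfolding mem_Collect_eq eq sys_points_def by blast
  qed
  show "vec_lambda ` {x \<in> sys_points l N. qform l x = 0} \<subseteq> {x :: int ^ ('s \<times> 'd). (\<forall>c. x $ c \<in> {1..int N}) \<and> lin_quad_system lam x = 0}"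
  proof (rule image_subsetI)
    fix x :: "'s \<times> 'd \<Rightarrow> int" assume "x \<in> {x \<in> sys_points l N. qform l x = 0}"
    then show "vec_lambda x \<in> {x :: int ^ ('s \<times> 'd). (\<forall>c. x $ c \<in> {1..int N}) \<and> lin_quad_system lam x = 0}"
      unfolding mem_Collect_eq eq sys_points_def vec_lambda_beta vec_lambda_inverse[OF UNIV_I] by blast
  qed
qed (simp_all add: vec_lambda_inverse)

theorem theorem1p7:
  fixes lam :: "int ^ 's::finite"
  assumes nonzero: "\<forall>i. lam $ i \<noteq> 0"
    and real_solution:
      "\<exists>x :: real ^ ('s \<times> 'd::finite). (\<forall>c. x $ c > 0) \<and> nonsingular_real_solution lam x"
    and padic_solutions:
      "\<forall>p::nat. prime p \<longrightarrow> (\<exists>x :: 's \<times> 'd \<Rightarrow> padic. nonsingular_padic_solution p lam x)"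
    and many_variables: "real CARD('s) > 2 + 4 / real CARD('d)"
  shows "\<exists>\<SS>>0. \<exists>\<JJ>>0. (\<lambda>N. real (num_solutions TYPE('d) lam N)) \<sim>[at_top]
    (\<lambda>N. \<SS> * \<JJ> * real N powi (int CARD('d) * int CARD('s) - (int CARD('d) + 2)))"
proof -
  let ?l = "($) lam"
  let ?d = "CARD('d)" and ?s = "CARD('s)"
  have d: "?d \<ge> 1" by (simp add: Suc_leI)
  have "real ?d * (2 + 4 / real ?d) < real ?d * real ?s" using many_variables d by (intro mult_strict_left_mono) auto
  then have "real (2 * ?d + 4) < real (?d * ?s)" using d by (simp add: algebra_simps)
  then have ds: "2 * ?d + 4 < ?d * ?s" by (simp only: of_nat_less_iff)
  have s: "?s \<ge> 2"
  proof (rule ccontr)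
    assume "\<not> ?s \<ge> 2"
    then have "?d * ?s \<le> ?d * 2" by (intro mult_le_mono2) simp
    then show False using ds by linarith
  qed
  have r: "?d * (?s - 2) \<ge> 5" using ds diff_mult_distrib2[of ?d ?s 2] by linarith
  \<comment> \<open>The subtraction of natural numbers is exact by \<open>ds\<close>, so the power
    with an integer exponent in the statement becomes an ordinary power.\<close>
  define D where "D = ?d * ?s - (?d + 2)"
  have D: "D + (?d + 2) = ?d * ?s" using ds by (simp add: D_def)
  obtain x :: "real ^ ('s \<times> 'd)" where x: "\<forall>c. x $ c > 0" "nonsingular_real_solution lam x" using real_solution by blast
  obtain \<Lambda> where \<Lambda>: "\<Lambda> > 0" and lim: "(\<lambda>N. real (num_solutions TYPE('d) lam (Suc N)) / real (Suc N) ^ D) \<longlonglongrightarrow> \<Lambda>"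
    using sys_points_asymptotics[OF nonzero x padic_solutions s r D] unfolding num_solutions_eq_card by blast
  have "int D = int ?d * int ?s - (int ?d + 2)"
    using arg_cong[OF D, of int] by (simp only: of_nat_add of_nat_mult of_nat_numeral)
  then have pw: "real N powi (int ?d * int ?s - (int ?d + 2)) = real N ^ D" for N
    by (simp only: power_int_of_nat flip: \<open>int D = _\<close>)
  have "(\<lambda>N. real (num_solutions TYPE('d) lam N) / real N ^ D) \<longlonglongrightarrow> \<Lambda>"
    using lim by (rule LIMSEQ_imp_Suc)
  then have "(\<lambda>N. real (num_solutions TYPE('d) lam N) / real N ^ D / \<Lambda>) \<longlonglongrightarrow> \<Lambda> / \<Lambda>"
    using \<Lambda> by (intro tendsto_intros) auto
  then have "(\<lambda>N. real (num_solutions TYPE('d) lam N) / (\<Lambda> * 1 * real N ^ D)) \<longlonglongrightarrow> 1"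
    using \<Lambda> by (simp add: mult.commute)
  then have asymp: "(\<lambda>N. real (num_solutions TYPE('d) lam N)) \<sim>[at_top] (\<lambda>N. \<Lambda> * 1 * real N ^ D)"
    by (rule asymp_equivI')
  \<comment> \<open>The whole limit \<Lambda> is taken as \<SS>, and 1 as \<JJ>.\<close>
  have "(1 :: real) > 0" by simp
  then have J: "\<exists>\<JJ>>0. (\<lambda>N. real (num_solutions TYPE('d) lam N)) \<sim>[at_top] (\<lambda>N. \<Lambda> * \<JJ> * real N ^ D)"
    using asymp by (intro exI[of _ "1 :: real"] conjI)
  show ?thesis
    unfolding pw by (rule exI[of _ \<Lambda>], rule conjI, rule \<Lambda>, rule J)
qed

end
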